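(* Let $X\subset\mathbb{P}^{107}=\mathbb{P}(\mathbb{C}^3\otimes\mathbb{C}^6\otimes\mathbb{C}^6)$ be the Segre embedding of $\mathbb{P}^2\times\mathbb{P}^5\times\mathbb{P}^5$. Then $X$ is not $8$-identifiable. Moreover, for a general point $Q$ of the secant variety $S_8(X)$, there are at least $6$ distinct linear subspaces of $\mathbb{P}^{107}$ of dimension $7$ which contain $Q$ and are $8$-secant to $X$.
   Context: We work over $\mathbb{C}$. The Segre variety $X$ is the projectivization of the cone of simple tensors (nonzero tensors $a\otimes b\otimes c$). For an irreducible projective variety $X\subset\mathbb{P}^N$, $S_k(X)$ denotes the $k$-th secant variety, i.e. the Zariski closure of $\bigcup_{x_1,\dots,x_k\in X}\langle x_1,\dots,x_k\rangle$. $X$ is called $k$-identifiable if the general element of $S_k(X)$ has a unique expression (up to order and scaling) as a sum of $k$ elements of $X$. A linear subspace of dimension $k-1$ is called $k$-secant to $X$ if it is spanned by $k$ points of $X$. "General" means in a suitable nonempty Zariski open subset. *)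

theory Defs
  imports "HOL-Analysis.Analysis"
begin

section \<open>Complex projective space and its Zariski topology\<close>

text \<open>
  A point of \<open>\<P>(\<complex>\<^sup>n)\<close> is a one-dimensional linear subspace of \<open>complex ^ 'n\<close>, so the type
  of points is \<open>(complex ^ 'n) set\<close> and \<open>\<P>(\<complex>\<^sup>n)\<close> is \<open>proj_space\<close>.  All spans are over the complex
  numbers (\<open>vec.span\<close>, not the real \<open>span\<close>).
\<close>

definition proj_point :: "complex ^ 'n \<Rightarrow> (complex ^ 'n) set" where
  "proj_point v = vec.span {v}"

definition proj_space :: "(complex ^ 'n) set set" where
  "proj_space = {proj_point v | v. v \<noteq> 0}"

text \<open>\<open>hom_form d f\<close>: \<open>f\<close> is the function given by a homogeneous polynomial of degree \<open>d\<close>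
  in the coordinates.\<close>

inductive hom_form :: "nat \<Rightarrow> (complex ^ 'n \<Rightarrow> complex) \<Rightarrow> bool" where
  const: "hom_form 0 (\<lambda>v. c)"
| coord: "hom_form 1 (\<lambda>v. v $ i)"
| add: "hom_form d f \<Longrightarrow> hom_form d g \<Longrightarrow> hom_form d (\<lambda>v. f v + g v)"
| mult: "hom_form d f \<Longrightarrow> hom_form e g \<Longrightarrow> hom_form (d + e) (\<lambda>v. f v * g v)"

definition hom_forms :: "(complex ^ 'n \<Rightarrow> complex) set" where
  "hom_forms = {f. \<exists>d. hom_form d f}"

definition proj_zeros :: "(complex ^ 'n \<Rightarrow> complex) set \<Rightarrow> (complex ^ 'n) set set" where
  "proj_zeros F = {P \<in> proj_space. \<forall>f\<in>F. \<forall>v\<in>P. f v = 0}"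

definition zariski :: "(complex ^ 'n) set topology" where
  "zariski = topology (\<lambda>U. U \<subseteq> proj_space \<and> (\<exists>F \<subseteq> hom_forms. proj_space - U = proj_zeros F))"

lemma hom_form_scale: "hom_form d f \<Longrightarrow> f (c *s v) = c ^ d * f v"
  by (induction rule: hom_form.induct) (auto simp: power_add algebra_simps)

lemma proj_zeros_subset: "proj_zeros F \<subseteq> proj_space"
  unfolding proj_zeros_def by (rule Collect_restrict)

lemma proj_zerosD: "P \<in> proj_zeros F \<Longrightarrow> f \<in> F \<Longrightarrow> v \<in> P \<Longrightarrow> f v = 0"
  unfolding proj_zeros_def by (drule CollectD, drule conjunct2, drule bspec, assumption, erule bspec)

lemma proj_zerosI:
  assumes "P \<in> proj_space" "\<And>f v. f \<in> F \<Longrightarrow> v \<in> P \<Longrightarrow> f v = 0"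
  shows "P \<in> proj_zeros F"
  unfolding proj_zeros_def by (intro CollectI conjI ballI; fact assms)

lemma hom_form_zero_on_line:
  assumes "f \<in> hom_forms" "f u = 0" "v \<in> proj_point u"
  shows "f v = 0"
proof -
  obtain d where d: "hom_form d f" using assms(1) unfolding hom_forms_def by (elim CollectE exE)
  obtain c where "v = c *s u"
    using assms(3) unfolding proj_point_def vec.span_singleton by (elim rangeE)
  then show ?thesis
    by (simp only: hom_form_scale[OF d] assms(2) mult_zero_right)
qed

lemma hom_forms_mult: "f \<in> hom_forms \<Longrightarrow> g \<in> hom_forms \<Longrightarrow> (\<lambda>v. f v * g v) \<in> hom_forms"
  unfolding hom_forms_def by (elim CollectE exE, rule CollectI, rule exI, erule (1) hom_form.mult)

lemma proj_zeros_Un: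
  fixes F G :: "(complex ^ 'n \<Rightarrow> complex) set"
  assumes F: "F \<subseteq> hom_forms" and G: "G \<subseteq> hom_forms"
  shows "proj_zeros F \<union> proj_zeros G = proj_zeros ((\<lambda>(f, g) v. f v * g v) ` (F \<times> G))"
    (is "_ = proj_zeros ?H")
proof (intro equalityI subsetI)
  fix P assume P: "P \<in> proj_zeros F \<union> proj_zeros G"
  show "P \<in> proj_zeros ?H"
  proof (rule proj_zerosI)
    show "P \<in> proj_space" using P proj_zeros_subset[of F] proj_zeros_subset[of G] by (elim UnE) (erule subsetD[rotated], assumption)+
    fix h v assume h: "h \<in> ?H" and v: "v \<in> P"
    from h obtain f g where fg: "f \<in> F" "g \<in> G" and h: "h = (\<lambda>v. f v * g v)"
      by (elim imageE SigmaE) simp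
    have "f v = 0 \<or> g v = 0"
      using P proj_zerosD[OF _ fg(1) v] proj_zerosD[OF _ fg(2) v] by (elim UnE) simp_all
    then show "h v = 0" unfolding h by (simp only: mult_eq_0_iff)
  qed
next
  fix P assume P: "P \<in> proj_zeros ?H"
  then have "P \<in> proj_space" using proj_zeros_subset by (rule subsetD[rotated])
  then obtain u where u: "P = proj_point u" unfolding proj_space_def by (elim CollectE exE conjE)
  have uP: "u \<in> P" unfolding u proj_point_def by (rule vec.span_base) simp
  show "P \<in> proj_zeros F \<union> proj_zeros G"
  proof (cases "\<forall>f\<in>F. f u = 0")
    case True
    have "P \<in> proj_zeros F"
    proof (rule proj_zerosI[OF \<open>P \<in> proj_space\<close>])
      fix f v assume "f \<in> F" "v \<in> P"
      show "f v = 0"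
        by (rule hom_form_zero_on_line[OF subsetD[OF F \<open>f \<in> F\<close>] bspec[OF True \<open>f \<in> F\<close>]
              \<open>v \<in> P\<close>[unfolded u]])
    qed
    then show ?thesis by (rule UnI1)
  next
    case False
    then obtain f where f: "f \<in> F" "f u \<noteq> 0" by (auto simp only: ball_simps)
    have "P \<in> proj_zeros G"
    proof (rule proj_zerosI[OF \<open>P \<in> proj_space\<close>])
      fix g v assume "g \<in> G" "v \<in> P"
      have "(\<lambda>v. f v * g v) \<in> ?H"
        by (rule image_eqI[of _ _ "(f, g)"]) (simp_all add: f \<open>g \<in> G\<close>)
      from proj_zerosD[OF P this uP] have "g u = 0" using f(2) by simp
      then show "g v = 0"
        by (rule hom_form_zero_on_line[OF subsetD[OF G \<open>g \<in> G\<close>] _ \<open>v \<in> P\<close>[unfolded u]])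
    qed
    then show ?thesis by (rule UnI2)
  qed
qed

lemma istopology_zariski:
  "istopology (\<lambda>U. U \<subseteq> (proj_space :: (complex ^ 'n) set set) \<and>
      (\<exists>F \<subseteq> hom_forms. proj_space - U = proj_zeros F))"
  unfolding istopology_def
proof (intro conjI allI impI)
  fix S T :: "(complex ^ 'n) set set"
  assume S: "S \<subseteq> proj_space \<and> (\<exists>F \<subseteq> hom_forms. proj_space - S = proj_zeros F)"
    and T: "T \<subseteq> proj_space \<and> (\<exists>F \<subseteq> hom_forms. proj_space - T = proj_zeros F)"
  show "S \<inter> T \<subseteq> proj_space" using S by auto
  obtain F where F: "F \<subseteq> hom_forms" "proj_space - S = proj_zeros F" using S by auto
  obtain G where G: "G \<subseteq> hom_forms" "proj_space - T = proj_zeros G" using T by auto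
  let ?H = "(\<lambda>(f, g) v. f v * g v) ` (F \<times> G)"
  have "?H \<subseteq> hom_forms"
  proof
    fix h assume "h \<in> ?H"
    then obtain f g where "f \<in> F" "g \<in> G" and h: "h = (\<lambda>v. f v * g v)"
      by (elim imageE SigmaE) simp
    then show "h \<in> hom_forms"
      unfolding h by (intro hom_forms_mult subsetD[OF F(1)] subsetD[OF G(1)])
  qed
  moreover have "proj_space - S \<inter> T = proj_zeros ?H"
    unfolding proj_zeros_Un[OF F(1) G(1), symmetric] F(2)[symmetric] G(2)[symmetric]
    by (rule Diff_Int)
  ultimately show "\<exists>F \<subseteq> hom_forms. proj_space - S \<inter> T = proj_zeros F" by blast
next
  fix K :: "(complex ^ 'n) set set set"
  assume K: "\<forall>U\<in>K. U \<subseteq> proj_space \<and> (\<exists>F \<subseteq> hom_forms. proj_space - U = proj_zeros F)"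
  show "\<Union>K \<subseteq> proj_space" using K by auto
  obtain F where F: "\<And>U. U \<in> K \<Longrightarrow> F U \<subseteq> hom_forms \<and> proj_space - U = proj_zeros (F U)"
    using K by metis
  have "proj_space - \<Union>K = proj_zeros (\<Union>(F ` K))"
  proof -
    have "proj_space - \<Union>K = {P \<in> proj_space. \<forall>U\<in>K. P \<in> proj_space - U}" by blast
    also have "\<dots> = {P \<in> proj_space. \<forall>U\<in>K. P \<in> proj_zeros (F U)}"
      by (intro Collect_cong conj_cong ball_cong refl) (simp only: F)
    also have "\<dots> = proj_zeros (\<Union>(F ` K))"
      unfolding proj_zeros_def by (simp only: ball_UN mem_Collect_eq) blast
    finally show ?thesis .
  qed
  moreover have "\<Union>(F ` K) \<subseteq> hom_forms" by (rule UN_least) (simp only: F)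
  ultimately show "\<exists>F \<subseteq> hom_forms. proj_space - \<Union>K = proj_zeros F" by blast
qed

lemma openin_zariski:
  "openin zariski U \<longleftrightarrow> U \<subseteq> proj_space \<and> (\<exists>F \<subseteq> hom_forms. proj_space - U = proj_zeros F)"
  unfolding zariski_def by (simp add: topology_inverse'[OF istopology_zariski])

lemma topspace_zariski: "topspace zariski = proj_space"
proof -
  have "openin zariski proj_space"
    unfolding openin_zariski
  proof (intro conjI exI)
    show "{\<lambda>v. 1} \<subseteq> hom_forms"
      using hom_form.const[of 1] unfolding hom_forms_def by blast
    have "P \<notin> proj_zeros {\<lambda>v. 1}" if "P \<in> proj_space" for P :: "(complex ^ 'n) set"
    proof
      assume P: "P \<in> proj_zeros {\<lambda>v. 1}"
      have "0 \<in> P" using that vec.span_zero unfolding proj_space_def proj_point_def by blast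
      from proj_zerosD[OF P _ this, of "\<lambda>v. 1"] show False by simp
    qed
    then show "proj_space - proj_space = proj_zeros {\<lambda>v. 1 :: complex}"
      using proj_zeros_subset by blast
  qed simp
  then have "proj_space \<subseteq> topspace zariski" by (rule openin_subset)
  moreover have "topspace zariski \<subseteq> proj_space"
    using openin_topspace[of zariski] unfolding openin_zariski by (rule conjunct1)
  ultimately show ?thesis by (rule equalityI[rotated])
qed

lemma closedin_zariski:
  "closedin zariski Z \<longleftrightarrow> (\<exists>F \<subseteq> hom_forms. Z = proj_zeros F)"
proof -
  have "Z \<subseteq> proj_space" if "Z = proj_zeros F" for F
    unfolding that proj_zeros_def by blast
  moreover have "proj_space - (proj_space - Z) = Z" if "Z \<subseteq> proj_space"
    using that by (rule double_diff) simp
  ultimately show ?thesis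
    unfolding closedin_def topspace_zariski openin_zariski by auto
qed

text \<open>A property holds for the general point of \<open>S\<close> if it holds on a nonempty Zariski open
  subset of \<open>S\<close>.\<close>

definition generally :: "(complex ^ 'n) set set \<Rightarrow> ((complex ^ 'n) set \<Rightarrow> bool) \<Rightarrow> bool" where
  "generally S P \<longleftrightarrow> (\<exists>U. openin (subtopology zariski S) U \<and> U \<noteq> {} \<and> (\<forall>Q\<in>U. P Q))"


section \<open>Linear subspaces, secant varieties, identifiability\<close>

definition proj_of :: "(complex ^ 'n) set \<Rightarrow> (complex ^ 'n) set set" where
  "proj_of W = {P \<in> proj_space. P \<subseteq> W}"

definition proj_linear :: "nat \<Rightarrow> (complex ^ 'n) set set \<Rightarrow> bool" where
  "proj_linear d L \<longleftrightarrow> (\<exists>W. vec.subspace W \<and> vec.dim W = d + 1 \<and> L = proj_of W)"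

definition proj_span :: "(complex ^ 'n) set set \<Rightarrow> (complex ^ 'n) set set" where
  "proj_span A = proj_of (vec.span (\<Union>A))"

definition secant_variety :: "nat \<Rightarrow> (complex ^ 'n) set set \<Rightarrow> (complex ^ 'n) set set" where
  "secant_variety k X =
     zariski closure_of (\<Union>{proj_span (set xs) | xs. length xs = k \<and> set xs \<subseteq> X})"

definition k_secant :: "nat \<Rightarrow> (complex ^ 'n) set set \<Rightarrow> (complex ^ 'n) set set \<Rightarrow> bool" where
  "k_secant k X L \<longleftrightarrow> k \<ge> 1 \<and> proj_linear (k - 1) L \<and>
     (\<exists>xs. length xs = k \<and> set xs \<subseteq> X \<and> L = proj_span (set xs))"

text \<open>\<open>as\<close> is an expression of the point \<open>Q\<close> as a sum of \<open>k\<close> elements of \<open>X\<close>: the summands are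
  vectors representing points of \<open>X\<close>, and their sum represents \<open>Q\<close>.\<close>

definition expresses :: "nat \<Rightarrow> (complex ^ 'n) set set \<Rightarrow> (complex ^ 'n) set
    \<Rightarrow> (complex ^ 'n) list \<Rightarrow> bool" where
  "expresses k X Q as \<longleftrightarrow> length as = k \<and> (\<forall>a\<in>set as. a \<noteq> 0 \<and> proj_point a \<in> X) \<and>
     sum_list as \<noteq> 0 \<and> proj_point (sum_list as) = Q"

text \<open>Two expressions agree up to order and scaling of the summands iff they have the same
  multiset of projective points.\<close>

definition identifiable :: "nat \<Rightarrow> (complex ^ 'n) set set \<Rightarrow> bool" where
  "identifiable k X \<longleftrightarrow> generally (secant_variety k X)
     (\<lambda>Q. \<exists>!D. \<exists>as. expresses k X Q as \<and> D = mset (map proj_point as))"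


section \<open>Segre varieties with three factors\<close>

text \<open>\<open>\<complex>\<^sup>m \<otimes> \<complex>\<^sup>n \<otimes> \<complex>\<^sup>p\<close> is the coordinate space of arrays indexed by \<open>'m \<times> 'n \<times> 'p\<close>.\<close>

definition tensor3 :: "complex ^ ('m::finite) \<Rightarrow> complex ^ ('n::finite) \<Rightarrow>
    complex ^ ('p::finite) \<Rightarrow> complex ^ ('m \<times> 'n \<times> 'p)"
  where "tensor3 a b c = (\<chi> t. case t of (i, j, k) \<Rightarrow> a $ i * b $ j * c $ k)"

definition segre3 :: "(complex ^ ('m::finite \<times> 'n::finite \<times> 'p::finite)) set set" where
  "segre3 = {proj_point (tensor3 a b c) | a b c. tensor3 a b c \<noteq> 0}"

end

theory Submission
  imports Defs "HOL-Complex_Analysis.Conformal_Mappings" "HOL-Library.Function_Algebras"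
    "HOL-Computational_Algebra.Fundamental_Theorem_Algebra"
begin

text \<open>
  After a change of coordinates in the two factors \<open>\<complex>\<^sup>6 = \<complex>\<^sup>2 \<otimes> \<complex>\<^sup>3\<close>, eight general simple tensors take the
  form \<open>a \<otimes> (s \<otimes> a) \<otimes> (t \<otimes> a)\<close>, so that a general tensor of rank 8 lies in the 40-dimensional space
  \<open>S\<^sup>3(\<complex>\<^sup>3) \<otimes> \<complex>\<^sup>2 \<otimes> \<complex>\<^sup>2\<close>, where \<open>a\<^sup>3 \<otimes> s \<otimes> t\<close> runs through a cone of dimension 5 and a decomposition into eight
  such terms depends on 40 parameters.  One explicit tensor of this space has six decompositions, and at
  each of them the tangent spaces of the cone span the whole space.  By the inverse function theorem
  the six decompositions extend holomorphically to all nearby tensors.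

  The passage from an open set of the classical topology to a Zariski open one is algebraic.  The
  coordinates of the tensor and of its six decompositions generate an integral domain of holomorphic
  functions, finitely generated over the subring generated by the coordinates of the tensor.
  Hence there is a nonzero \<open>A\<close> in that subring such that every specialization of it with \<open>A \<noteq> 0\<close>
  extends to the whole domain, and can be chosen to keep the six spans distinct.
\<close>

section \<open>Extension of homomorphisms to finitely generated overrings\<close>

text \<open>The normal form rests on a count: eight vectors of \<complex>^6 modulo
  \<open>GL(6)\<close> have 48 - 36 = 12 parameters, as have eight vectors of \<complex>^2 modulo
  \<open>GL(2)\<close>. That the count is realised is checked at one point, by solving a linear
  system. The obstacle is to find a tensor with six decompositions in closed form for which six
  determinants of size 40 can be shown nonzero by hand. Invariance under the diagonal matrix with
  entries 1, \<omega>, \<omega>^2 serves both ends. The decompositions used consist of two free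
  orbits and two of the three coordinate points: three choices of the omitted coordinate point,
  times two roots of a quadratic equation. Each determinant splits by characters into blocks of
  sizes 16, 12 and 12, which split further. Holomorphic continuation would not give a Zariski
  statement, since monodromy may permute the decompositions; specializing the ring that they
  generate takes its place.\<close>

definition subring_of :: "'a::comm_ring_1 set \<Rightarrow> 'a set \<Rightarrow> bool" where
  "subring_of R H \<longleftrightarrow> R \<subseteq> H \<and> 1 \<in> R \<and> (\<forall>x\<in>R. - x \<in> R) \<and> (\<forall>x\<in>R. \<forall>y\<in>R. x + y \<in> R \<and> x * y \<in> R)"

text \<open>Rings are carrier sets inside one type because the type of interest, functions with
  pointwise operations, has zero divisors; only the carrier of holomorphic functions is a
  domain.\<close>

definition domain_set :: "'a::comm_ring_1 set \<Rightarrow> bool" where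
  "domain_set H \<longleftrightarrow> subring_of H H \<and> (\<forall>x\<in>H. \<forall>y\<in>H. x * y = 0 \<longrightarrow> x = 0 \<or> y = 0)"

definition hom_on :: "'a::comm_ring_1 set \<Rightarrow> ('a \<Rightarrow> complex) \<Rightarrow> bool" where
  "hom_on R \<phi> \<longleftrightarrow> \<phi> 1 = 1 \<and>
     (\<forall>x\<in>R. \<forall>y\<in>R. \<phi> (x + y) = \<phi> x + \<phi> y \<and> \<phi> (x * y) = \<phi> x * \<phi> y)"

definition polys_over :: "'a::comm_ring_1 set \<Rightarrow> 'a poly set" where
  "polys_over R = {p. \<forall>i. coeff p i \<in> R}"

definition adjoin :: "'a::comm_ring_1 set \<Rightarrow> 'a \<Rightarrow> 'a set" where
  "adjoin R e = (\<lambda>p. poly p e) ` polys_over R"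

lemma subring_ofD:
  assumes "subring_of R H"
  shows "R \<subseteq> H" "1 \<in> R" "0 \<in> R" "x \<in> R \<Longrightarrow> - x \<in> R"
    "x \<in> R \<Longrightarrow> y \<in> R \<Longrightarrow> x + y \<in> R" "x \<in> R \<Longrightarrow> y \<in> R \<Longrightarrow> x * y \<in> R"
    "x \<in> R \<Longrightarrow> y \<in> R \<Longrightarrow> x - y \<in> R" "x \<in> R \<Longrightarrow> x ^ n \<in> R"
proof -
  have *: "R \<subseteq> H" "1 \<in> R" "\<And>x. x \<in> R \<Longrightarrow> - x \<in> R"
    "\<And>x y. x \<in> R \<Longrightarrow> y \<in> R \<Longrightarrow> x + y \<in> R" "\<And>x y. x \<in> R \<Longrightarrow> y \<in> R \<Longrightarrow> x * y \<in> R"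
    using assms unfolding subring_of_def by auto
  have "1 + - 1 \<in> R" using * by blast
  then show "0 \<in> R" by simp
  show "x \<in> R \<Longrightarrow> y \<in> R \<Longrightarrow> x - y \<in> R" using *(3)[of y] *(4)[of x "- y"] by simp
  show "x \<in> R \<Longrightarrow> x ^ n \<in> R" by (induction n) (use * in auto)
qed (use assms in \<open>auto simp: subring_of_def\<close>)

lemma subring_of_sum:
  assumes "subring_of R H" "\<And>i. i \<in> A \<Longrightarrow> f i \<in> R"
  shows "sum f A \<in> R"
  using assms(2) by (induction A rule: infinite_finite_induct)
    (auto simp: subring_ofD[OF assms(1)])

lemma hom_onD:
  assumes "hom_on R \<phi>" "subring_of R H"
  shows "\<phi> 1 = 1" "\<phi> 0 = 0" "x \<in> R \<Longrightarrow> y \<in> R \<Longrightarrow> \<phi> (x + y) = \<phi> x + \<phi> y"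
    "x \<in> R \<Longrightarrow> y \<in> R \<Longrightarrow> \<phi> (x * y) = \<phi> x * \<phi> y" "x \<in> R \<Longrightarrow> \<phi> (x ^ n) = \<phi> x ^ n"
    "(\<And>i. i \<in> A \<Longrightarrow> f i \<in> R) \<Longrightarrow> \<phi> (sum f A) = (\<Sum>i\<in>A. \<phi> (f i))"
proof -
  note R = subring_ofD[OF assms(2)]
  have *: "\<phi> 1 = 1" "\<And>x y. x \<in> R \<Longrightarrow> y \<in> R \<Longrightarrow> \<phi> (x + y) = \<phi> x + \<phi> y"
    "\<And>x y. x \<in> R \<Longrightarrow> y \<in> R \<Longrightarrow> \<phi> (x * y) = \<phi> x * \<phi> y"
    using assms(1) unfolding hom_on_def by auto
  show "\<phi> 1 = 1" "x \<in> R \<Longrightarrow> y \<in> R \<Longrightarrow> \<phi> (x + y) = \<phi> x + \<phi> y"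
    "x \<in> R \<Longrightarrow> y \<in> R \<Longrightarrow> \<phi> (x * y) = \<phi> x * \<phi> y" by (fact *)+
  show 0: "\<phi> 0 = 0" using *(2)[OF R(3) R(3)] by simp
  show "x \<in> R \<Longrightarrow> \<phi> (x ^ n) = \<phi> x ^ n" by (induction n) (auto simp: * R)
  show "(\<And>i. i \<in> A \<Longrightarrow> f i \<in> R) \<Longrightarrow> \<phi> (sum f A) = (\<Sum>i\<in>A. \<phi> (f i))"
    by (induction A rule: infinite_finite_induct) (auto simp: 0 * subring_of_sum[OF assms(2)])
qed

lemma polys_over_closed:
  assumes "subring_of R H" "p \<in> polys_over R" "q \<in> polys_over R"
  shows "p + q \<in> polys_over R" "p * q \<in> polys_over R" "- p \<in> polys_over R" "p - q \<in> polys_over R"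
    "c \<in> R \<Longrightarrow> smult c p \<in> polys_over R"
  using assms(2,3) unfolding polys_over_def
  by (auto simp: coeff_mult subring_ofD[OF assms(1)] intro!: subring_of_sum[OF assms(1)])

lemma polys_over_simple:
  assumes "subring_of R H" "c \<in> R"
  shows "monom c n \<in> polys_over R" "[:c:] \<in> polys_over R" "0 \<in> polys_over R"
  using assms(2) unfolding polys_over_def
  by (auto simp: subring_ofD[OF assms(1)] coeff_pCons split: nat.splits)

lemma poly_in_subring:
  assumes "subring_of H H'" "p \<in> polys_over H" "e \<in> H"
  shows "poly p e \<in> H"
  unfolding poly_altdef using assms(2,3)
  by (intro subring_of_sum[OF assms(1)]) (auto simp: polys_over_def subring_ofD[OF assms(1)])

lemma subring_of_adjoin:
  assumes "domain_set H" "subring_of R H" "e \<in> H"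
  shows "subring_of (adjoin R e) H" "R \<subseteq> adjoin R e" "e \<in> adjoin R e"
proof -
  have H: "subring_of H H" using assms(1) by (simp add: domain_set_def)
  have mono: "polys_over R \<subseteq> polys_over H"
    using subring_ofD(1)[OF assms(2)] by (auto simp: polys_over_def)
  note cl = polys_over_closed[OF assms(2)]
  show sub: "R \<subseteq> adjoin R e"
  proof
    fix r assume "r \<in> R"
    then have "[:r:] \<in> polys_over R" by (rule polys_over_simple[OF assms(2)])
    then have "poly [:r:] e \<in> adjoin R e" unfolding adjoin_def by (rule imageI)
    then show "r \<in> adjoin R e" by simp
  qed
  have "monom 1 1 \<in> polys_over R" by (intro polys_over_simple[OF assms(2)] subring_ofD[OF assms(2)])
  then have "poly (monom 1 1) e \<in> adjoin R e" unfolding adjoin_def by (rule imageI)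
  then show "e \<in> adjoin R e" by (simp add: poly_monom)
  have "adjoin R e \<subseteq> H"
    unfolding adjoin_def using mono poly_in_subring[OF H _ assms(3)] by blast
  moreover have "- x \<in> adjoin R e" if x: "x \<in> adjoin R e" for x
  proof -
    obtain p where p: "p \<in> polys_over R" "x = poly p e" using x unfolding adjoin_def by blast
    show ?thesis unfolding adjoin_def p(2) poly_minus[symmetric] by (intro imageI cl(3)[OF p(1) p(1)])
  qed
  moreover have "x + y \<in> adjoin R e \<and> x * y \<in> adjoin R e" if xy: "x \<in> adjoin R e" "y \<in> adjoin R e" for x y
  proof -
    obtain p q where p: "p \<in> polys_over R" "x = poly p e" and q: "q \<in> polys_over R" "y = poly q e"
      using xy unfolding adjoin_def by blast
    show ?thesis
      unfolding adjoin_def p(2) q(2) poly_add[symmetric] poly_mult[symmetric]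
      by (intro conjI imageI cl p(1) q(1))
  qed
  ultimately show "subring_of (adjoin R e) H"
    unfolding subring_of_def using sub subring_ofD(2)[OF assms(2)] by blast
qed

lemma poly_map_hom:
  assumes "hom_on R \<phi>" "subring_of R H" "p \<in> polys_over R" "q \<in> polys_over R"
  shows "map_poly \<phi> (p + q) = map_poly \<phi> p + map_poly \<phi> q"
    "map_poly \<phi> (p * q) = map_poly \<phi> p * map_poly \<phi> q"
proof -
  note h = hom_onD[OF assms(1,2)]
  show "map_poly \<phi> (p + q) = map_poly \<phi> p + map_poly \<phi> q"
    by (rule poly_eqI) (use assms(3,4) h in \<open>auto simp: coeff_map_poly polys_over_def\<close>)
  show "map_poly \<phi> (p * q) = map_poly \<phi> p * map_poly \<phi> q"
  proof (rule poly_eqI)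
    fix n
    have "\<phi> (\<Sum>i\<le>n. coeff p i * coeff q (n - i)) = (\<Sum>i\<le>n. \<phi> (coeff p i * coeff q (n - i)))"
      by (rule h(6)) (use assms(3,4) in \<open>auto simp: polys_over_def subring_ofD[OF assms(2)]\<close>)
    also have "\<dots> = (\<Sum>i\<le>n. \<phi> (coeff p i) * \<phi> (coeff q (n - i)))"
      using assms(3,4) by (intro sum.cong refl h(4)) (auto simp: polys_over_def)
    finally show "coeff (map_poly \<phi> (p * q)) n = coeff (map_poly \<phi> p * map_poly \<phi> q) n"
      by (simp add: coeff_map_poly h(2) coeff_mult)
  qed
qed

text \<open>\<open>R[e]\<close> is the quotient of \<open>R[t]\<close> by the relations of
  \<open>e\<close>, so \<phi> with a value \<xi> for \<open>e\<close> descends once every relation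
  of \<open>e\<close> becomes a relation of \<xi>. As \<psi> picks some representing polynomial,
  \<open>val\<close> says that the choice is harmless.\<close>

lemma hom_on_adjoin:
  assumes "hom_on R \<phi>" "subring_of R H"
    and kill: "\<And>p. p \<in> polys_over R \<Longrightarrow> poly p e = 0 \<Longrightarrow> poly (map_poly \<phi> p) \<xi> = 0"
  obtains \<psi> where "hom_on (adjoin R e) \<psi>" "\<And>r. r \<in> R \<Longrightarrow> \<psi> r = \<phi> r"
    "\<And>p. p \<in> polys_over R \<Longrightarrow> \<psi> (poly p e) = poly (map_poly \<phi> p) \<xi>"
proof -
  note h = hom_onD[OF assms(1,2)] and cl = polys_over_closed[OF assms(2)]
  define \<psi> where "\<psi> x = poly (map_poly \<phi> (SOME p. p \<in> polys_over R \<and> poly p e = x)) \<xi>" for x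
  have val: "\<psi> (poly p e) = poly (map_poly \<phi> p) \<xi>" if p: "p \<in> polys_over R" for p
  proof -
    define q where "q = (SOME q. q \<in> polys_over R \<and> poly q e = poly p e)"
    have q: "q \<in> polys_over R \<and> poly q e = poly p e"
      unfolding q_def by (rule someI[of _ p]) (use p in auto)
    have "poly (map_poly \<phi> (p - q)) \<xi> = 0"
      using p q by (intro kill cl) auto
    moreover have "map_poly \<phi> p = map_poly \<phi> (p - q) + map_poly \<phi> q"
      using poly_map_hom(1)[OF assms(1,2), of "p - q" q] p q cl by simp
    ultimately show ?thesis unfolding \<psi>_def q_def[symmetric] by simp
  qed
  have "\<psi> r = \<phi> r" if "r \<in> R" for r
    using val[OF polys_over_simple(2)[OF assms(2) that]]
    by (simp add: map_poly_pCons h(2))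
  moreover have "hom_on (adjoin R e) \<psi>"
    unfolding hom_on_def
  proof (intro conjI ballI)
    show "\<psi> 1 = 1"
      using val[OF polys_over_simple(2)[OF assms(2) subring_ofD(2)[OF assms(2)]]]
      by (simp add: map_poly_pCons h)
    fix x y assume "x \<in> adjoin R e" "y \<in> adjoin R e"
    then obtain p q where pq: "p \<in> polys_over R" "q \<in> polys_over R" "x = poly p e" "y = poly q e"
      unfolding adjoin_def by blast
    show "\<psi> (x + y) = \<psi> x + \<psi> y"
      using val[OF cl(1)[OF pq(1,2)]] val pq poly_map_hom(1)[OF assms(1,2) pq(1,2)] by simp
    show "\<psi> (x * y) = \<psi> x * \<psi> y"
      using val[OF cl(2)[OF pq(1,2)]] val pq poly_map_hom(2)[OF assms(1,2) pq(1,2)] by simp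
  qed
  ultimately show ?thesis using val that by blast
qed

section \<open>Adjoining one element: pseudo-division and norms\<close>

text \<open>Without inverses in \<open>R\<close>, the dividend must first be multiplied by a power
  of the leading coefficient. Degree bounds are phrased as vanishing coefficients, so that a zero
  remainder is no exception even for constant \<open>g\<close>. The top coefficient of the quotient
  is recorded to certify later that the quotient is nonzero.\<close>

lemma pseudo_division:
  assumes "subring_of R H" "g \<in> polys_over R" "q \<in> polys_over R" "\<forall>i\<ge>degree g + n. coeff q i = 0"
  shows "\<exists>h\<in>polys_over R. \<exists>r\<in>polys_over R. smult (lead_coeff g ^ n) q = h * g + r \<and>
     (\<forall>i\<ge>degree g. coeff r i = 0) \<and> (\<forall>i\<ge>n. coeff h i = 0) \<and>
     (n > 0 \<longrightarrow> coeff h (n - 1) = lead_coeff g ^ (n - 1) * coeff q (degree g + n - 1))"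
  using assms(3,4)
proof (induction n arbitrary: q)
  case 0
  have "0 \<in> polys_over R" by (rule polys_over_simple(3)[OF assms(1) subring_ofD(3)[OF assms(1)]])
  then show ?case using 0 by (intro bexI[of _ 0] bexI[of _ q]) auto
next
  case (Suc n)
  let ?c = "lead_coeff g" and ?m = "degree g"
  note cl = polys_over_closed[OF assms(1)] and R = subring_ofD[OF assms(1)]
  have c: "?c \<in> R" "coeff q (?m + n) \<in> R" using assms(2) Suc.prems(1) by (auto simp: polys_over_def)
  define q1 where "q1 = smult ?c q - monom (coeff q (?m + n)) n * g"
  have q1: "q1 \<in> polys_over R"
    unfolding q1_def using Suc.prems(1) assms(2) c polys_over_simple[OF assms(1)] by (intro cl) auto
  have q1': "\<forall>i\<ge>?m + n. coeff q1 i = 0"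
  proof (intro allI impI)
    fix i assume that: "i \<ge> ?m + n"
    show "coeff q1 i = 0"
    proof (cases "i = ?m + n")
      case True
      then show ?thesis by (simp add: q1_def coeff_monom_mult)
    next
      case False
      then have "coeff g (i - n) = 0" "coeff q i = 0"
        using that Suc.prems(2) by (auto intro: coeff_eq_0)
      then show ?thesis by (simp add: q1_def coeff_monom_mult)
    qed
  qed
  from Suc.IH[OF q1 q1'] obtain h r where hr: "h \<in> polys_over R" "r \<in> polys_over R"
    "smult (?c ^ n) q1 = h * g + r" "\<forall>i\<ge>?m. coeff r i = 0" "\<forall>i\<ge>n. coeff h i = 0"
    by (elim bexE conjE)
  define h' where "h' = h + monom (?c ^ n * coeff q (?m + n)) n"
  have "smult (?c ^ Suc n) q = smult (?c ^ n) (q1 + monom (coeff q (?m + n)) n * g)"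
    by (simp add: q1_def power_Suc2 del: power_Suc)
  also have "\<dots> = h * g + r + smult (?c ^ n) (monom (coeff q (?m + n)) n) * g"
    by (simp only: smult_add_right hr(3) mult_smult_left)
  also have "\<dots> = h' * g + r"
    by (simp only: h'_def smult_monom distrib_right add.assoc add.commute add.left_commute)
  finally have "smult (?c ^ Suc n) q = h' * g + r" .
  moreover have "h' \<in> polys_over R"
    unfolding h'_def using hr(1) c R polys_over_simple[OF assms(1)] by (intro cl) auto
  moreover have "\<forall>i\<ge>Suc n. coeff h' i = 0" "coeff h' n = ?c ^ n * coeff q (?m + n)"
    using hr(5) by (auto simp: h'_def)
  ultimately show ?case using hr(2,4) by (intro bexI[of _ h'] bexI[of _ r]) auto
qed

lemma pseudo_divisionE:
  assumes "subring_of R H" "g \<in> polys_over R" "q \<in> polys_over R" "degree q < degree g + n"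
  obtains h r where "h \<in> polys_over R" "r \<in> polys_over R"
    "smult (lead_coeff g ^ n) q = h * g + r" "\<forall>i\<ge>degree g. coeff r i = 0" "\<forall>i\<ge>n. coeff h i = 0"
    "n > 0 \<longrightarrow> coeff h (n - 1) = lead_coeff g ^ (n - 1) * coeff q (degree g + n - 1)"
proof -
  have "\<forall>i\<ge>degree g + n. coeff q i = 0" using assms(4) by (auto intro: coeff_eq_0)
  from pseudo_division[OF assms(1-3) this] show ?thesis
    by (elim bexE conjE) (rule that)
qed

lemma domain_set_power:
  assumes "domain_set H" "x \<in> H" "x \<noteq> 0" "(1::'a::comm_ring_1) \<noteq> 0" 
  shows "(x::'a) ^ n \<noteq> 0"
proof (induction n)
  case (Suc n)
  then show ?case using assms subring_ofD(8)[of H H x n] unfolding domain_set_def power_Suc by blast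
qed (use assms in auto)

text \<open>Among the nonzero multiples of \<open>b\<close> in \<open>R[e]\<close>, take one given
  by a polynomial \<open>r\<close> of least degree. Dividing \<open>r\<close> by the minimal
  relation \<open>p\<close> shows that \<open>r\<close> has smaller degree than \<open>p\<close>.
  Dividing \<open>p\<close> by \<open>r\<close> then shows that \<open>r\<close> is constant:
  otherwise the quotient does not vanish at \<open>e\<close>, by minimality of \<open>p\<close>, and
  the remainder is a multiple of smaller degree.\<close>

lemma algebraic_norm:
  fixes e :: "'a::comm_ring_1"
  assumes H: "domain_set H" and R: "subring_of R H" and e: "e \<in> H"
    and b: "b \<in> adjoin R e" "b \<noteq> 0"
    and p: "p \<in> polys_over R" "p \<noteq> 0" "poly p e = 0"
    and pmin: "\<And>q. q \<in> polys_over R \<Longrightarrow> q \<noteq> 0 \<Longrightarrow> poly q e = 0 \<Longrightarrow> degree p \<le> degree q"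
  obtains c h where "c \<in> R" "c \<noteq> 0" "h \<in> polys_over R" "c = b * poly h e"
proof -
  have HH: "subring_of H H" and nzd: "\<And>x y. x \<in> H \<Longrightarrow> y \<in> H \<Longrightarrow> x \<noteq> 0 \<Longrightarrow> y \<noteq> 0 \<Longrightarrow> x * y \<noteq> 0"
    using H by (auto simp: domain_set_def)
  note cl = polys_over_closed[OF R] and RD = subring_ofD[OF R]
  have one: "(1::'a) \<noteq> 0" using b(2) by auto
  have RH: "x \<in> R \<Longrightarrow> x \<in> H" for x using RD(1) by blast
  have evH: "q \<in> polys_over R \<Longrightarrow> poly q e \<in> H" for q
    using poly_in_subring[OF HH _ e, of q] RH by (auto simp: polys_over_def)
  have lcR: "q \<in> polys_over R \<Longrightarrow> lead_coeff q \<in> R" for q by (simp add: polys_over_def)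
  have pw: "lead_coeff q ^ n \<noteq> 0" "lead_coeff q ^ n \<in> R"
    if "q \<in> polys_over R" "q \<noteq> 0" for q n
    using domain_set_power[OF H RH[OF lcR[OF that(1)]] _ one, of n] that lcR RD(8) by auto
  define S where "S = {r \<in> polys_over R. poly r e \<noteq> 0 \<and> (\<exists>h\<in>polys_over R. poly r e = b * poly h e)}"
  obtain q where "q \<in> polys_over R" "poly q e = b" using b(1) unfolding adjoin_def by blast
  moreover have "[:1:] \<in> polys_over R" by (rule polys_over_simple(2)[OF R RD(2)])
  ultimately have "q \<in> S" using b(2) by (auto simp: S_def intro!: bexI[of _ "[:1:]"])
  then obtain r where r: "r \<in> S" and rmin: "\<And>s. s \<in> S \<Longrightarrow> degree r \<le> degree s"
    using arg_min_nat_lemma[of "\<lambda>s. s \<in> S" q degree] by blast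
  then obtain h where h: "r \<in> polys_over R" "poly r e \<noteq> 0" "h \<in> polys_over R" "poly r e = b * poly h e"
    by (auto simp: S_def)
  have r0: "r \<noteq> 0" using h(2) by auto
  have deg_less: "degree s < m" if "\<forall>i\<ge>m. coeff s i = 0" "s \<noteq> 0" for s :: "'a poly" and m
    using that by (metis leading_coeff_0_iff linorder_not_less)
  have red: "degree r < degree p"
  proof (rule ccontr)
    assume *: "\<not> degree r < degree p"
    define n where "n = Suc (degree r - degree p)"
    obtain h1 r1 where 1: "h1 \<in> polys_over R" "r1 \<in> polys_over R"
      "smult (lead_coeff p ^ n) r = h1 * p + r1" "\<forall>i\<ge>degree p. coeff r1 i = 0"
    proof (rule pseudo_divisionE[OF R p(1) h(1), of n])
      show "degree r < degree p + n" using * by (simp add: n_def)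
    qed
    have "lead_coeff p ^ n * poly r e = poly r1 e"
      using arg_cong[OF 1(3), of "\<lambda>q. poly q e"] p(3) by simp
    moreover have "lead_coeff p ^ n * poly r e \<noteq> 0"
      using pw[OF p(1,2)] evH[OF h(1)] h(2) RH by (intro nzd) auto
    moreover have "lead_coeff p ^ n * poly r e = b * poly (smult (lead_coeff p ^ n) h) e"
      by (simp add: h(4))
    ultimately have "r1 \<in> S"
      using 1(2) cl(5)[OF h(3) h(3) pw(2)[OF p(1,2)]] unfolding S_def
      by (intro CollectI conjI bexI[of _ "smult (lead_coeff p ^ n) h"]) auto
    moreover from \<open>r1 \<in> S\<close> have "r1 \<noteq> 0" by (auto simp: S_def)
    ultimately have "degree r \<le> degree r1" "degree r1 < degree p" using rmin deg_less[OF 1(4)] by blast+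
    then show False using * by linarith
  qed
  have "degree r = 0"
  proof (rule ccontr)
    assume m: "degree r \<noteq> 0"
    \<comment> \<open>This power makes the top coefficient of the quotient, at \<open>n - 1\<close>,
      correspond to the leading coefficient of \<open>p\<close>.\<close>
    define n where "n = Suc (degree p - degree r)"
    obtain h1 r1 where 1: "h1 \<in> polys_over R" "r1 \<in> polys_over R"
      "smult (lead_coeff r ^ n) p = h1 * r + r1" "\<forall>i\<ge>degree r. coeff r1 i = 0"
      "\<forall>i\<ge>n. coeff h1 i = 0"
      "n > 0 \<longrightarrow> coeff h1 (n - 1) = lead_coeff r ^ (n - 1) * coeff p (degree r + n - 1)"
    proof (rule pseudo_divisionE[OF R h(1) p(1), of n])
      show "degree p < degree r + n" using red by (simp add: n_def)
    qed
    have n: "n > 0" "degree r + n - 1 = degree p" using red by (simp_all add: n_def)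
    have 2: "coeff h1 (n - 1) = lead_coeff r ^ (n - 1) * lead_coeff p"
      using 1(6) n by simp
    have "coeff h1 (n - 1) \<noteq> 0"
      unfolding 2 using pw[OF h(1) r0] lcR[OF p(1)] p(2) RH by (intro nzd) auto
    then have h10: "h1 \<noteq> 0" by auto
    have "degree h1 < n" using deg_less[OF 1(5) h10] .
    then have "degree h1 < degree p" using m red by (simp add: n_def)
    then have "poly h1 e \<noteq> 0" using pmin[OF 1(1) h10] by auto
    then have "poly h1 e * poly r e \<noteq> 0" using nzd evH 1(1) h(1,2) by blast
    moreover have r1e: "poly r1 e = - (poly h1 e * poly r e)"
      using arg_cong[OF 1(3), of "\<lambda>q. poly q e"] p(3) by (simp add: eq_neg_iff_add_eq_0 add.commute)
    moreover have "poly r1 e = b * poly (- (h1 * h)) e" unfolding r1e by (simp add: h(4) algebra_simps)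
    ultimately have "r1 \<in> S"
      using 1(1,2) h(3) cl(2,3) unfolding S_def
      by (intro CollectI conjI bexI[of _ "- (h1 * h)"]) auto
    moreover from \<open>r1 \<in> S\<close> have "r1 \<noteq> 0" by (auto simp: S_def)
    ultimately have "degree r \<le> degree r1" "degree r1 < degree r" using rmin deg_less[OF 1(4)] by blast+
    then show False by linarith
  qed
  then obtain c where "r = [:c:]" by (rule degree_eq_zeroE)
  then have c: "lead_coeff r = c" "poly r e = c" by simp_all
  show ?thesis
  proof (rule that[of c h])
    show "c \<in> R" using lcR[OF h(1)] c(1) by (simp only:)
    show "c \<noteq> 0" using h(2) c(2) by (simp only: not_False_eq_True)
    show "c = b * poly h e" using h(4) c(2) by (simp only:)
  qed (rule h(3))
qed

text \<open>If \<open>e\<close> is transcendental, \<xi> is free and only has to avoid the roots of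
  one polynomial. If \<open>e\<close> is algebraic, \<xi> must be a root of the image of the minimal
  relation, and \<psi> cannot kill \<open>b\<close> because \<open>b\<close> divides an element of
  \<open>R\<close> that \<phi> does not kill.\<close>

lemma extend_hom_step:
  fixes e :: "'a::comm_ring_1"
  assumes H: "domain_set H" and R: "subring_of R H" and e: "e \<in> H"
    and b: "b \<in> adjoin R e" "b \<noteq> 0"
  shows "\<exists>a\<in>R. a \<noteq> 0 \<and> (\<forall>\<phi>. hom_on R \<phi> \<and> \<phi> a \<noteq> 0 \<longrightarrow>
    (\<exists>\<psi>. hom_on (adjoin R e) \<psi> \<and> (\<forall>r\<in>R. \<psi> r = \<phi> r) \<and> \<psi> b \<noteq> 0))"
proof (cases "\<exists>p\<in>polys_over R. p \<noteq> 0 \<and> poly p e = 0")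
  case False
  obtain q where q: "q \<in> polys_over R" "poly q e = b" using b(1) unfolding adjoin_def by blast
  have "lead_coeff q \<noteq> 0" using q(2) b(2) by auto
  moreover have "lead_coeff q \<in> R" using q(1) by (simp add: polys_over_def)
  moreover have "\<exists>\<psi>. hom_on (adjoin R e) \<psi> \<and> (\<forall>r\<in>R. \<psi> r = \<phi> r) \<and> \<psi> b \<noteq> 0"
    if \<phi>: "hom_on R \<phi>" "\<phi> (lead_coeff q) \<noteq> 0" for \<phi>
  proof -
    have "coeff (map_poly \<phi> q) (degree q) \<noteq> 0"
      using \<phi>(2) by (simp add: coeff_map_poly hom_onD(2)[OF \<phi>(1) R])
    then have "map_poly \<phi> q \<noteq> 0" by auto
    then have "finite {x. poly (map_poly \<phi> q) x = 0}" by (rule poly_roots_finite)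
    then obtain \<xi> where \<xi>: "poly (map_poly \<phi> q) \<xi> \<noteq> 0"
      using ex_new_if_finite[OF infinite_UNIV_char_0] by blast
    have "poly (map_poly \<phi> p) \<xi> = 0" if "p \<in> polys_over R" "poly p e = 0" for p
      using False that by auto
    from hom_on_adjoin[OF \<phi>(1) R this] obtain \<psi> where
      "hom_on (adjoin R e) \<psi>" "\<And>r. r \<in> R \<Longrightarrow> \<psi> r = \<phi> r"
      "\<And>p. p \<in> polys_over R \<Longrightarrow> \<psi> (poly p e) = poly (map_poly \<phi> p) \<xi>" by blast
    then show ?thesis using q \<xi> by auto
  qed
  ultimately show ?thesis by blast
next
  case True
  then obtain p where p: "p \<in> polys_over R" "p \<noteq> 0" "poly p e = 0"
    and pmin: "\<And>q. q \<in> polys_over R \<Longrightarrow> q \<noteq> 0 \<Longrightarrow> poly q e = 0 \<Longrightarrow> degree p \<le> degree q"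
    using arg_min_nat_lemma[of "\<lambda>p. p \<in> polys_over R \<and> p \<noteq> 0 \<and> poly p e = 0" _ degree] by blast
  obtain c h where c: "c \<in> R" "c \<noteq> 0" "h \<in> polys_over R" "c = b * poly h e"
    using algebraic_norm[OF H R e b p pmin] by blast
  \<comment> \<open>The first factor keeps the degree of the image of \<open>p\<close>, so that a
    root exists, and allows cancellation after pseudo-division; the second keeps the image of
    \<open>b\<close> nonzero.\<close>
  define a where "a = lead_coeff p * c"
  have lp: "lead_coeff p \<in> R" "lead_coeff p \<noteq> 0" using p by (auto simp: polys_over_def)
  have "a \<in> R" "a \<noteq> 0"
    using lp c(1,2) H subring_ofD(1,6)[OF R] unfolding a_def domain_set_def by blast+
  moreover have "\<exists>\<psi>. hom_on (adjoin R e) \<psi> \<and> (\<forall>r\<in>R. \<psi> r = \<phi> r) \<and> \<psi> b \<noteq> 0"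
    if \<phi>: "hom_on R \<phi>" "\<phi> a \<noteq> 0" for \<phi>
  proof -
    note h\<phi> = hom_onD[OF \<phi>(1) R]
    have l: "\<phi> (lead_coeff p) \<noteq> 0" "\<phi> c \<noteq> 0" using \<phi>(2) h\<phi>(4)[OF lp(1) c(1)] by (auto simp: a_def)
    have "degree p \<noteq> 0"
    proof
      assume "degree p = 0"
      then obtain k where "p = [:k:]" by (rule degree_eq_zeroE)
      then show False using p(2,3) by simp
    qed
    moreover have "degree (map_poly \<phi> p) = degree p"
      using l(1) by (intro antisym map_poly_degree_leq le_degree) (simp add: coeff_map_poly h\<phi>(2))
    ultimately have "\<not> constant (poly (map_poly \<phi> p))"
      by (simp add: constant_degree)
    then obtain \<xi> where \<xi>: "poly (map_poly \<phi> p) \<xi> = 0"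
      using fundamental_theorem_of_algebra by blast
    \<comment> \<open>The remainder of a relation modulo \<open>p\<close> is a relation of smaller
      degree, hence zero. So a power of the leading coefficient times \<open>q\<close> is a multiple
      of \<open>p\<close>, and \<phi> does not kill that power.\<close>
    have kill: "poly (map_poly \<phi> q) \<xi> = 0" if q: "q \<in> polys_over R" "poly q e = 0" for q
    proof -
      define n where "n = Suc (degree q)"
      obtain h r where hr: "h \<in> polys_over R" "r \<in> polys_over R"
        "smult (lead_coeff p ^ n) q = h * p + r" "\<forall>i\<ge>degree p. coeff r i = 0"
      proof (rule pseudo_divisionE[OF R p(1) q(1), of n])
        show "degree q < degree p + n" by (simp add: n_def)
      qed
      have "poly r e = 0" using arg_cong[OF hr(3), of "\<lambda>q. poly q e"] p(3) q(2) by simp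
      moreover have "degree r < degree p" if "r \<noteq> 0"
        using hr(4) that by (metis leading_coeff_0_iff linorder_not_less)
      ultimately have "r = 0" using pmin[OF hr(2)] by (meson linorder_not_less)
      then have "[:lead_coeff p ^ n:] * q = h * p" using hr(3) by simp
      then have "map_poly \<phi> ([:lead_coeff p ^ n:] * q) = map_poly \<phi> (h * p)" by (simp only:)
      then have "map_poly \<phi> [:lead_coeff p ^ n:] * map_poly \<phi> q = map_poly \<phi> h * map_poly \<phi> p"
        by (subst (asm) (1 2) poly_map_hom(2)[OF \<phi>(1) R])
          (intro polys_over_simple(2)[OF R] subring_ofD(8)[OF R lp(1)] q(1) hr(1) p(1))+
      then have "poly (map_poly \<phi> [:lead_coeff p ^ n:] * map_poly \<phi> q) \<xi> = 0"
        using \<xi> by simp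
      then show ?thesis
        using l(1) h\<phi>(5)[OF lp(1), of n] by (simp add: map_poly_pCons h\<phi>(2))
    qed
    from hom_on_adjoin[OF \<phi>(1) R kill] obtain \<psi> where \<psi>:
      "hom_on (adjoin R e) \<psi>" "\<And>r. r \<in> R \<Longrightarrow> \<psi> r = \<phi> r" by blast
    have "\<psi> c = \<psi> b * \<psi> (poly h e)"
      unfolding c(4) by (rule hom_onD(4)[OF \<psi>(1) subring_of_adjoin(1)[OF H R e]])
        (use b(1) c(3) in \<open>auto simp: adjoin_def\<close>)
    then have "\<psi> b \<noteq> 0" using \<psi>(2)[OF c(1)] l(2) by auto
    then show ?thesis using \<psi> by blast
  qed
  ultimately show ?thesis by blast
qed

text \<open>Elements are adjoined one at a time. The claim is made for every nonzero
  \<open>b\<close> in \<open>S\<close>, since the condition for the last element is a nonvanishing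
  condition in the previous ring, which has to be pushed down in turn.\<close>

lemma extend_hom:
  fixes E :: "'a::comm_ring_1 set"
  assumes H: "domain_set H" and R: "subring_of R H" and E: "finite E" "E \<subseteq> H"
  shows "\<exists>S. subring_of S H \<and> R \<subseteq> S \<and> E \<subseteq> S \<and> (\<forall>b\<in>S. b \<noteq> 0 \<longrightarrow>
    (\<exists>a\<in>R. a \<noteq> 0 \<and> (\<forall>\<phi>. hom_on R \<phi> \<and> \<phi> a \<noteq> 0 \<longrightarrow>
      (\<exists>\<psi>. hom_on S \<psi> \<and> (\<forall>r\<in>R. \<psi> r = \<phi> r) \<and> \<psi> b \<noteq> 0))))"
  using E
proof (induction E rule: finite_induct)
  case empty
  then show ?case using R by (intro exI[of _ R]) auto
next
  case (insert e E)
  then obtain S where S: "subring_of S H" "R \<subseteq> S" "E \<subseteq> S" and ext: "\<And>b. b\<in>S \<Longrightarrow> b \<noteq> 0 \<Longrightarrow>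
    (\<exists>a\<in>R. a \<noteq> 0 \<and> (\<forall>\<phi>. hom_on R \<phi> \<and> \<phi> a \<noteq> 0 \<longrightarrow>
      (\<exists>\<psi>. hom_on S \<psi> \<and> (\<forall>r\<in>R. \<psi> r = \<phi> r) \<and> \<psi> b \<noteq> 0)))" by auto
  have e: "e \<in> H" using insert.prems by simp
  note A = subring_of_adjoin[OF H S(1) e]
  have "\<exists>a\<in>R. a \<noteq> 0 \<and> (\<forall>\<phi>. hom_on R \<phi> \<and> \<phi> a \<noteq> 0 \<longrightarrow>
      (\<exists>\<psi>. hom_on (adjoin S e) \<psi> \<and> (\<forall>r\<in>R. \<psi> r = \<phi> r) \<and> \<psi> b \<noteq> 0))"
    if b: "b \<in> adjoin S e" "b \<noteq> 0" for b
  proof -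
    obtain a1 where a1: "a1 \<in> S" "a1 \<noteq> 0" and ext1: "\<And>\<phi>. hom_on S \<phi> \<Longrightarrow> \<phi> a1 \<noteq> 0 \<Longrightarrow>
      (\<exists>\<psi>. hom_on (adjoin S e) \<psi> \<and> (\<forall>r\<in>S. \<psi> r = \<phi> r) \<and> \<psi> b \<noteq> 0)"
      using extend_hom_step[OF H S(1) e b] by blast
    obtain a where a: "a \<in> R" "a \<noteq> 0" and ext2: "\<And>\<phi>. hom_on R \<phi> \<Longrightarrow> \<phi> a \<noteq> 0 \<Longrightarrow>
      (\<exists>\<psi>. hom_on S \<psi> \<and> (\<forall>r\<in>R. \<psi> r = \<phi> r) \<and> \<psi> a1 \<noteq> 0)"
      using ext[OF a1] by blast
    have "\<exists>\<psi>. hom_on (adjoin S e) \<psi> \<and> (\<forall>r\<in>R. \<psi> r = \<phi> r) \<and> \<psi> b \<noteq> 0"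
      if \<phi>: "hom_on R \<phi>" "\<phi> a \<noteq> 0" for \<phi>
    proof -
      obtain \<psi>1 where 1: "hom_on S \<psi>1" "\<forall>r\<in>R. \<psi>1 r = \<phi> r" "\<psi>1 a1 \<noteq> 0" using ext2[OF \<phi>] by blast
      obtain \<psi> where "hom_on (adjoin S e) \<psi>" "\<forall>r\<in>S. \<psi> r = \<psi>1 r" "\<psi> b \<noteq> 0"
        using ext1[OF 1(1,3)] by blast
      then show ?thesis using 1(2) S(2) by (intro exI[of _ \<psi>]) auto
    qed
    then show ?thesis using a by blast
  qed
  then show ?case using A S by (intro exI[of _ "adjoin S e"]) auto
qed

section \<open>Polynomial functions\<close>

inductive polyf :: "(complex ^ 'n \<Rightarrow> complex) \<Rightarrow> bool" where
  const: "polyf (\<lambda>v. c)"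
| coord: "polyf (\<lambda>v. v $ i)"
| add: "polyf f \<Longrightarrow> polyf g \<Longrightarrow> polyf (\<lambda>v. f v + g v)"
| mult: "polyf f \<Longrightarrow> polyf g \<Longrightarrow> polyf (\<lambda>v. f v * g v)"

lemma polyf_hom_form: "hom_form d f \<Longrightarrow> polyf f"
  by (induction rule: hom_form.induct) (auto intro: polyf.intros)

lemma polyf_minus: "polyf f \<Longrightarrow> polyf (\<lambda>v. - f v)"
  using polyf.mult[OF polyf.const[of "- 1"], of f] by simp

lemma polyf_diff: "polyf f \<Longrightarrow> polyf g \<Longrightarrow> polyf (\<lambda>v. f v - g v)"
  using polyf.add[OF _ polyf_minus] by fastforce

lemma polyf_sum: "(\<And>i. i \<in> A \<Longrightarrow> polyf (f i)) \<Longrightarrow> polyf (\<lambda>v. \<Sum>i\<in>A. f i v)"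
  by (induction A rule: infinite_finite_induct) (auto intro: polyf.intros)

lemma polyf_prod: "(\<And>i. i \<in> A \<Longrightarrow> polyf (f i)) \<Longrightarrow> polyf (\<lambda>v. \<Prod>i\<in>A. f i v)"
  by (induction A rule: infinite_finite_induct) (auto intro: polyf.intros)

lemma polyf_power: "polyf f \<Longrightarrow> polyf (\<lambda>v. f v ^ n)"
  by (induction n) (auto intro: polyf.intros)

lemma polyf_compose:
  assumes "polyf P" "\<And>k. polyf (\<lambda>x. e x $ k)"
  shows "polyf (\<lambda>x. P (e x))"
  using assms(1) by induction (auto intro: polyf.intros assms(2))

lemma polyf_det:
  fixes M :: "'a::finite \<Rightarrow> 'a \<Rightarrow> complex ^ 'n \<Rightarrow> complex"
  assumes "\<And>i j. polyf (M i j)"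
  shows "polyf (\<lambda>x. det (\<chi> i j. M i j x))"
  unfolding det_def by (auto intro!: polyf_sum polyf.mult polyf_prod polyf.const assms)

lemmas polyf_intros = polyf.intros polyf_minus polyf_diff polyf_sum polyf_prod polyf_power polyf_det

section \<open>Homogeneous parts of polynomial functions\<close>

lemma hom_form_zero: "hom_form d (\<lambda>v :: complex ^ 'n. 0)"
proof -
  have "hom_form d (\<lambda>v :: complex ^ 'n. (v $ i) ^ d)" for i
  proof (induction d)
    case (Suc d)
    then show ?case using hom_form.mult[OF hom_form.coord[of i] Suc] by simp
  qed (use hom_form.const[of 1] in simp)
  from hom_form.mult[OF hom_form.const[of 0] this] show ?thesis by simp
qed

lemma hom_form_sum:
  "(\<And>i. i \<in> A \<Longrightarrow> hom_form d (f i)) \<Longrightarrow> hom_form d (\<lambda>v. \<Sum>i\<in>A. f i v)"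
  by (induction A rule: infinite_finite_induct) (auto intro: hom_form.add hom_form_zero)

lemma polyf_homogeneous_parts:
  assumes "polyf f"
  obtains n h where "\<And>d. hom_form d (h d)" "\<And>d v. d > n \<Longrightarrow> h d v = 0" "\<And>v. f v = (\<Sum>d\<le>n. h d v)"
  using assms
proof (induction arbitrary: thesis)
  case (const c)
  show ?case
    by (rule const[of "\<lambda>d v. if d = 0 then c else 0" 0])
      (auto intro: hom_form_zero hom_form.const)
next
  case (coord i)
  show ?case
  proof (rule coord[of "\<lambda>d v. if d = 1 then v $ i else 0" 1])
    show "hom_form d (\<lambda>v. if d = 1 then v $ i else 0)" for d
      using hom_form.coord[of i] hom_form_zero[of d] by (cases "d = 1") simp_all
  qed auto
next
  case (add f g)
  obtain n h where f: "\<And>d. hom_form d (h d)" "\<And>d v. d > n \<Longrightarrow> h d v = 0" "\<And>v. f v = (\<Sum>d\<le>n. h d v)"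
    using add.IH(1) by blast
  obtain m k where g: "\<And>d. hom_form d (k d)" "\<And>d v. d > m \<Longrightarrow> k d v = 0" "\<And>v. g v = (\<Sum>d\<le>m. k d v)"
    using add.IH(2) by blast
  have "f v = (\<Sum>d\<le>n + m. h d v)" "g v = (\<Sum>d\<le>n + m. k d v)" for v
    unfolding f(3) g(3) by (intro sum.mono_neutral_left; use f(2) g(2) in auto)+
  then show ?case
    by (intro add.prems[of "\<lambda>d v. h d v + k d v" "n + m"])
      (auto simp: sum.distrib f g intro: hom_form.add)
next
  case (mult f g)
  obtain n h where f: "\<And>d. hom_form d (h d)" "\<And>d v. d > n \<Longrightarrow> h d v = 0" "\<And>v. f v = (\<Sum>d\<le>n. h d v)"
    using mult.IH(1) by blast
  obtain m k where g: "\<And>d. hom_form d (k d)" "\<And>d v. d > m \<Longrightarrow> k d v = 0" "\<And>v. g v = (\<Sum>d\<le>m. k d v)"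
    using mult.IH(2) by blast
  let ?l = "\<lambda>d v. \<Sum>i\<le>d. h i v * k (d - i) v"
  show ?case
  proof (rule mult.prems[of ?l "n + m"])
    fix d
    have "hom_form (i + (d - i)) (\<lambda>v. h i v * k (d - i) v)" for i by (intro hom_form.mult f g)
    then show "hom_form d (?l d)" by (intro hom_form_sum) (metis atMost_iff le_add_diff_inverse)
    show "?l d v = 0" if "d > n + m" for v
    proof (intro sum.neutral ballI)
      fix i
      have "i > n \<or> d - i > m" using that by linarith
      then show "h i v * k (d - i) v = 0" using f(2) g(2) by auto
    qed
  next
    fix v
    show "f v * g v = (\<Sum>d\<le>n + m. ?l d v)"
      using polynomial_product[of n "\<lambda>i. h i v" m "\<lambda>i. k i v" 1] f(2) g(2) by (simp add: f(3) g(3) add.commute)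
  qed
qed

lemma polyf_scale:
  assumes "\<And>d. hom_form d (h d)" "\<And>v. f v = (\<Sum>d\<le>n::nat. h d v)"
  shows "f (c *s v) = (\<Sum>d\<le>n. h d v * c ^ d)"
  by (simp add: assms(2) hom_form_scale[OF assms(1)] mult.commute)

text \<open>Along the line through \<open>v\<close>, \<open>f\<close> is a polynomial in the scalar
  \<open>c\<close> whose coefficients are the values \<open>h d v\<close>.\<close>

lemma homogeneous_parts_vanish:
  assumes "\<And>d. hom_form d (h d)" "\<And>v. f v = (\<Sum>d\<le>n::nat. h d v)"
    and "\<And>c. f (c *s v) = 0" "d \<le> n"
  shows "h d v = 0"
  using polyfun_eq_0[of "\<lambda>d. h d v" n] assms(3,4) unfolding polyf_scale[OF assms(1,2)] by auto

text \<open>The ideal of a cone is generated by forms. This passes from forms, which are all that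
  the Zariski closure controls, to arbitrary polynomials, which the ring argument produces.\<close>

lemma polyf_vanish_cone:
  assumes "polyf P" "\<And>v. v \<in> A \<Longrightarrow> P v = 0" "\<And>c v. v \<in> A \<Longrightarrow> c *s v \<in> A"
    and "\<And>f. f \<in> hom_forms \<Longrightarrow> (\<And>v. v \<in> A \<Longrightarrow> f v = 0) \<Longrightarrow> f q = 0"
  shows "P q = 0"
proof -
  obtain n h where h: "\<And>d. hom_form d (h d)" "\<And>v. P v = (\<Sum>d\<le>n. h d v)"
    using polyf_homogeneous_parts[OF assms(1)] by metis
  have "h d q = 0" if "d \<le> n" for d
  proof (rule assms(4))
    show "h d \<in> hom_forms" using h(1) by (auto simp: hom_forms_def)
    show "h d v = 0" if "v \<in> A" for v
      by (rule homogeneous_parts_vanish[OF h]) (use assms(2,3) \<open>v \<in> A\<close> \<open>d \<le> n\<close> in auto)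
  qed
  then show ?thesis by (simp add: h(2))
qed

section \<open>Functions that are holomorphic along complex lines\<close>

text \<open>Differentiability along complex lines suffices, because the identity theorem is only
  applied on the line joining two points.\<close>

definition line_hol :: "(complex ^ 'i) set \<Rightarrow> (complex ^ 'i \<Rightarrow> complex) \<Rightarrow> bool" where
  "line_hol \<Omega> f \<longleftrightarrow> (\<forall>x\<in>\<Omega>. \<forall>v. (\<lambda>z. f (x + z *s v)) field_differentiable at 0)"

lemma line_hol_const: "line_hol \<Omega> (\<lambda>x. c)"
  and line_hol_coord: "line_hol \<Omega> (\<lambda>x. x $ i)"
  and line_hol_add: "line_hol \<Omega> f \<Longrightarrow> line_hol \<Omega> g \<Longrightarrow> line_hol \<Omega> (\<lambda>x. f x + g x)"
  and line_hol_mult: "line_hol \<Omega> f \<Longrightarrow> line_hol \<Omega> g \<Longrightarrow> line_hol \<Omega> (\<lambda>x. f x * g x)"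
  and line_hol_minus: "line_hol \<Omega> f \<Longrightarrow> line_hol \<Omega> (\<lambda>x. - f x)"
  unfolding line_hol_def
  by (auto intro!: derivative_intros field_differentiable_add field_differentiable_mult
      field_differentiable_minus)

lemma line_hol_polyf: 
  assumes "polyf P" "\<And>k. line_hol \<Omega> (\<lambda>x. e x $ k)"
  shows "line_hol \<Omega> (\<lambda>x. P (e x))"
  using assms(1) by induction (auto intro: line_hol_const line_hol_add line_hol_mult assms(2))

lemma line_hol_sum: "(\<And>i. i \<in> A \<Longrightarrow> line_hol \<Omega> (f i)) \<Longrightarrow> line_hol \<Omega> (\<lambda>v. \<Sum>i\<in>A. f i v)"
  by (induction A rule: infinite_finite_induct) (auto intro: line_hol_const line_hol_add)

lemma line_domain:
  fixes x v :: "complex ^ 'i"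
  assumes "open \<Omega>" "convex \<Omega>"
  shows "open {z. x + z *s v \<in> \<Omega>}" "convex {z. x + z *s v \<in> \<Omega>}"
proof -
  have eq: "x + z *s v = (\<chi> i. x $ i + z * v $ i)" for z by (simp add: vec_eq_iff)
  have "continuous_on UNIV (\<lambda>z. x + z *s v)"
    unfolding eq by (intro continuous_intros)
  then show "open {z. x + z *s v \<in> \<Omega>}"
    using open_vimage[OF assms(1)] by (auto simp: vimage_def)
  show "convex {z. x + z *s v \<in> \<Omega>}"
  proof (rule convexI)
    fix y z :: complex and a b :: real
    assume *: "y \<in> {z. x + z *s v \<in> \<Omega>}" "z \<in> {z. x + z *s v \<in> \<Omega>}" "0 \<le> a" "0 \<le> b" "a + b = 1"
    then have "a *\<^sub>R (x + y *s v) + b *\<^sub>R (x + z *s v) \<in> \<Omega>" using convexD[OF assms(2)] by blast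
    moreover have "a *\<^sub>R (x + y *s v) + b *\<^sub>R (x + z *s v) = x + (a *\<^sub>R y + b *\<^sub>R z) *s v"
    proof -
      have "complex_of_real a + complex_of_real b = 1" using *(5) by (metis of_real_1 of_real_add)
      then have "complex_of_real a * x $ i + complex_of_real b * x $ i = x $ i" for i
        by (simp flip: distrib_right)
      then show ?thesis
        by (simp add: vec_eq_iff algebra_simps scaleR_conv_of_real[where 'a = complex])
    qed
    ultimately show "a *\<^sub>R y + b *\<^sub>R z \<in> {z. x + z *s v \<in> \<Omega>}" by simp
  qed
qed

lemma line_hol_holomorphic:
  assumes "open \<Omega>" "convex \<Omega>" "line_hol \<Omega> f"
  shows "(\<lambda>z. f (x + z *s v)) holomorphic_on {z. x + z *s v \<in> \<Omega>}"
  unfolding holomorphic_on_def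
proof
  fix w assume "w \<in> {z. x + z *s v \<in> \<Omega>}"
  then have "(\<lambda>z. f ((x + w *s v) + z *s v)) field_differentiable at 0"
    using assms(3) by (simp add: line_hol_def)
  then have "((\<lambda>z. f ((x + w *s v) + z *s v)) \<circ> (\<lambda>z. z - w)) field_differentiable at w"
    by (intro field_differentiable_compose derivative_intros) auto
  moreover have "(\<lambda>z. f ((x + w *s v) + z *s v)) \<circ> (\<lambda>z. z - w) = (\<lambda>z. f (x + z *s v))"
    by (auto simp: fun_eq_iff vec_eq_iff algebra_simps intro!: arg_cong[of _ _ f])
  ultimately show "(\<lambda>z. f (x + z *s v)) field_differentiable at w within {z. x + z *s v \<in> \<Omega>}"
    by (simp add: field_differentiable_at_within)
qed

text \<open>The complex line through \<open>x\<close> and \<open>y\<close> meets the convex \<Omega>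
  in a connected set. There \<open>f\<close> is nonzero near \<open>x\<close> by continuity, so
  \<open>g\<close> vanishes near \<open>x\<close> and then, by the identity theorem, at
  \<open>y\<close>.\<close>

lemma line_hol_no_zero_divisors:
  assumes \<Omega>: "open \<Omega>" "convex \<Omega>" and f: "line_hol \<Omega> f" and g: "line_hol \<Omega> g"
    and zero: "\<And>x. x \<in> \<Omega> \<Longrightarrow> f x * g x = 0"
    and x: "x \<in> \<Omega>" "f x \<noteq> 0" and y: "y \<in> \<Omega>"
  shows "g y = 0"
proof -
  define D where "D = {z. x + z *s (y - x) \<in> \<Omega>}"
  define F where "F z = f (x + z *s (y - x))" for z
  define G where "G z = g (x + z *s (y - x))" for z
  have D: "open D" "connected D" "0 \<in> D" "1 \<in> D"
    using line_domain[OF \<Omega>, of x "y - x"] x y by (auto simp: D_def convex_connected)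
  have hol: "F holomorphic_on D" "G holomorphic_on D"
    unfolding F_def G_def D_def by (intro line_hol_holomorphic \<Omega> f g)+
  have "open (D \<inter> F -` (- {0}))"
    by (rule continuous_open_preimage[OF holomorphic_on_imp_continuous_on[OF hol(1)] D(1)]) auto
  moreover have "0 \<in> D \<inter> F -` (- {0})" using D(3) x(2) by (simp add: F_def)
  moreover have "G z = 0" if "z \<in> D \<inter> F -` (- {0})" for z
    using that zero[of "x + z *s (y - x)"] by (auto simp: D_def F_def G_def)
  ultimately have "G 1 = 0"
    using analytic_continuation_open[of "D \<inter> F -` (- {0})" D G "\<lambda>z. 0" 1] D hol(2) by auto
  then show ?thesis by (simp add: G_def)
qed

text \<open>A polynomial is holomorphic on the whole line, so here the identity theorem runs on the
  entire plane and \<Omega> only has to be open.\<close>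

lemma polyf_zero_open:
  assumes "polyf P" "open \<Omega>" "x \<in> \<Omega>" "\<And>y. y \<in> \<Omega> \<Longrightarrow> P y = 0"
  shows "P y = 0"
proof -
  have P: "line_hol UNIV P" using line_hol_polyf[OF assms(1), of _ "\<lambda>x. x"] by (simp add: line_hol_coord)
  define F where "F z = P (x + z *s (y - x))" for z
  have "continuous_on UNIV (\<lambda>z. x + z *s (y - x))"
  proof -
    have eq: "x + z *s (y - x) = (\<chi> i. x $ i + z * (y - x) $ i)" for z
      by (simp add: vec_eq_iff algebra_simps)
    show ?thesis unfolding eq by (intro continuous_intros)
  qed
  then have D: "open {z. x + z *s (y - x) \<in> \<Omega>}"
    using open_vimage[OF assms(2)] by (auto simp: vimage_def)
  have hol: "F holomorphic_on UNIV"
    unfolding F_def using line_hol_holomorphic[OF _ _ P, of x "y - x"] by simp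
  have 0: "0 \<in> {z. x + z *s (y - x) \<in> \<Omega>}" using assms(3) by simp
  have zero: "F z = 0" if "z \<in> {z. x + z *s (y - x) \<in> \<Omega>}" for z
    using that assms(4) by (simp add: F_def)
  have ne: "{z. x + z *s (y - x) \<in> \<Omega>} \<noteq> {}" using 0 by blast
  have "F 1 = 0"
    using analytic_continuation_open[OF D open_UNIV ne connected_UNIV subset_UNIV hol holomorphic_on_const zero UNIV_I] .
  then show ?thesis by (simp add: F_def)
qed

section \<open>Generic specialization of holomorphic data\<close>

text \<open>A point \<open>q\<close> satisfying all relations of \<open>G\<close> is a homomorphism
  from the ring generated by the coordinates of \<open>G\<close>; \<open>y\<close> is an extension
  of it to the coordinates of \<open>e\<close>. Therefore every polynomial identity between
  \<open>e\<close> and \<open>G\<close> on \<Omega> persists between \<open>y\<close> and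
  \<open>q\<close>, while \<open>B\<close> records what must remain nonzero.\<close>

theorem generic_specialization:
  fixes G :: "complex ^ 'i \<Rightarrow> complex ^ 'm" and e :: "complex ^ 'i \<Rightarrow> complex ^ 'k"
  assumes \<Omega>: "open \<Omega>" "convex \<Omega>" "x0 \<in> \<Omega>"
    and G: "\<And>k. line_hol \<Omega> (\<lambda>x. G x $ k)" and e: "\<And>k. line_hol \<Omega> (\<lambda>x. e x $ k)"
    and B: "polyf B" "B (e x0) \<noteq> 0"
  obtains A x1 where "polyf A" "x1 \<in> \<Omega>" "A (G x1) \<noteq> 0"
    "\<And>q. (\<And>P. polyf P \<Longrightarrow> (\<And>x. x \<in> \<Omega> \<Longrightarrow> P (G x) = 0) \<Longrightarrow> P q = 0) \<Longrightarrow> A q \<noteq> 0 \<Longrightarrow>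
      \<exists>y. B y \<noteq> 0 \<and> (\<forall>Q P. polyf Q \<and> polyf P \<and> (\<forall>x\<in>\<Omega>. Q (e x) = P (G x)) \<longrightarrow> Q y = P q)"
proof -
  \<comment> \<open>Precomposing with \<open>\<rho>\<close> turns equality on \<open>\<Omega>\<close> into equality of functions.\<close>
  define \<rho> where "\<rho> x = (if x \<in> \<Omega> then x else x0)" for x
  have \<rho>: "\<rho> x \<in> \<Omega>" "x \<in> \<Omega> \<Longrightarrow> \<rho> x = x" for x using \<Omega>(3) by (auto simp: \<rho>_def)
  define H where "H = {\<lambda>x. f (\<rho> x) | f. line_hol \<Omega> f}"
  define R where "R = {\<lambda>x. P (G (\<rho> x)) | P. polyf P}"
  define E where "E = range (\<lambda>k x. e (\<rho> x) $ k)"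
  have HI: "(\<lambda>x. f (\<rho> x)) \<in> H" if "line_hol \<Omega> f" for f using that by (auto simp: H_def)
  have RI: "(\<lambda>x. P (G (\<rho> x))) \<in> R" if "polyf P" for P using that by (auto simp: R_def)
  have HH: "subring_of H H"
    unfolding subring_of_def
  proof (intro conjI ballI subset_refl)
    show "1 \<in> H" using HI[OF line_hol_const[of \<Omega> 1]] by (simp add: one_fun_def)
  next
    fix f assume "f \<in> H"
    then obtain f' where f: "f = (\<lambda>x. f' (\<rho> x))" "line_hol \<Omega> f'" by (auto simp: H_def)
    show "- f \<in> H" using HI[OF line_hol_minus[OF f(2)]] by (simp add: f(1) fun_Compl_def)
    fix g assume "g \<in> H"
    then obtain g' where g: "g = (\<lambda>x. g' (\<rho> x))" "line_hol \<Omega> g'" by (auto simp: H_def)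
    show "f + g \<in> H" using HI[OF line_hol_add[OF f(2) g(2)]] by (simp add: f(1) g(1) plus_fun_def)
    show "f * g \<in> H" using HI[OF line_hol_mult[OF f(2) g(2)]] by (simp add: f(1) g(1) times_fun_def)
  qed
  have H: "domain_set H"
    unfolding domain_set_def
  proof (intro conjI HH ballI impI)
    fix f g assume "f \<in> H" "g \<in> H" and fg: "f * g = 0"
    then obtain f' g' where f: "f = (\<lambda>x. f' (\<rho> x))" "line_hol \<Omega> f'" and g: "g = (\<lambda>x. g' (\<rho> x))" "line_hol \<Omega> g'"
      by (auto simp: H_def)
    have "f' x * g' x = 0" if "x \<in> \<Omega>" for x
      using fun_cong[OF fg, of x] \<rho>(2)[OF that] by (simp add: f g)
    then have "f' x = 0 \<or> g' y = 0" if "x \<in> \<Omega>" "y \<in> \<Omega>" for x y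
      using line_hol_no_zero_divisors[OF \<Omega>(1,2) f(2) g(2)] that by blast
    then have "(\<forall>x\<in>\<Omega>. f' x = 0) \<or> (\<forall>x\<in>\<Omega>. g' x = 0)" by blast
    then show "f = 0 \<or> g = 0" by (auto simp: f g fun_eq_iff \<rho>(1))
  qed
  have R: "subring_of R H"
    unfolding subring_of_def
  proof (intro conjI ballI)
    show "R \<subseteq> H"
      unfolding R_def using HI[OF line_hol_polyf[OF _ G]] by blast
    show "1 \<in> R" using RI[OF polyf.const[of 1]] by (simp add: one_fun_def)
  next
    fix f assume "f \<in> R"
    then obtain f' where f: "f = (\<lambda>x. f' (G (\<rho> x)))" "polyf f'" by (auto simp: R_def)
    show "- f \<in> R" using RI[OF polyf_minus[OF f(2)]] by (simp add: f(1) fun_Compl_def)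
    fix g assume "g \<in> R"
    then obtain g' where g: "g = (\<lambda>x. g' (G (\<rho> x)))" "polyf g'" by (auto simp: R_def)
    show "f + g \<in> R" using RI[OF polyf.add[OF f(2) g(2)]] by (simp add: f(1) g(1) plus_fun_def)
    show "f * g \<in> R" using RI[OF polyf.mult[OF f(2) g(2)]] by (simp add: f(1) g(1) times_fun_def)
  qed
  have "finite E" "E \<subseteq> H" using HI[OF e] by (auto simp: E_def)
  from extend_hom[OF H R this] obtain S where S: "subring_of S H" "R \<subseteq> S" "E \<subseteq> S"
    and ext: "\<And>b. b \<in> S \<Longrightarrow> b \<noteq> 0 \<Longrightarrow> (\<exists>a\<in>R. a \<noteq> 0 \<and> (\<forall>\<phi>. hom_on R \<phi> \<and> \<phi> a \<noteq> 0 \<longrightarrow>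
      (\<exists>\<psi>. hom_on S \<psi> \<and> (\<forall>r\<in>R. \<psi> r = \<phi> r) \<and> \<psi> b \<noteq> 0)))" by (elim exE conjE) blast
  note SD = subring_ofD[OF S(1)]
  have cR: "(\<lambda>x. c) \<in> R" for c using RI[OF polyf.const[of c]] by simp
  have eS: "(\<lambda>x. e (\<rho> x) $ k) \<in> S" for k using S(3) by (auto simp: E_def)
  have polyS: "(\<lambda>x. Q (e (\<rho> x))) \<in> S" if "polyf Q" for Q
    using that
  proof induction
    case (add f g)
    then show ?case using SD(5)[OF add.IH] by (simp add: plus_fun_def)
  next
    case (mult f g)
    then show ?case using SD(6)[OF mult.IH] by (simp add: times_fun_def)
  qed (use cR S(2) eS in auto)
  have polyhom: "\<psi> (\<lambda>x. Q (e (\<rho> x))) = Q (\<chi> k. \<psi> (\<lambda>x. e (\<rho> x) $ k))"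
    if Q: "polyf Q" and \<psi>: "hom_on S \<psi>" "\<And>c. \<psi> (\<lambda>x. c) = c" for Q \<psi>
    using Q
  proof induction
    case (add f g)
    then show ?case using hom_onD(3)[OF \<psi>(1) S(1) polyS[OF add.hyps(1)] polyS[OF add.hyps(2)]]
      by (simp add: plus_fun_def)
  next
    case (mult f g)
    then show ?case using hom_onD(4)[OF \<psi>(1) S(1) polyS[OF mult.hyps(1)] polyS[OF mult.hyps(2)]]
      by (simp add: times_fun_def)
  qed (use \<psi>(2) in auto)
  have "(\<lambda>x. B (e (\<rho> x))) \<noteq> 0"
    using B(2) \<rho>(2)[OF \<Omega>(3)] by (metis zero_fun_apply)
  from ext[OF polyS[OF B(1)] this] obtain a where a: "a \<in> R" "a \<noteq> 0"
    and aext: "\<And>\<phi>. hom_on R \<phi> \<Longrightarrow> \<phi> a \<noteq> 0 \<Longrightarrow>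
      (\<exists>\<psi>. hom_on S \<psi> \<and> (\<forall>r\<in>R. \<psi> r = \<phi> r) \<and> \<psi> (\<lambda>x. B (e (\<rho> x))) \<noteq> 0)" by blast
  obtain A where A: "polyf A" "a = (\<lambda>x. A (G (\<rho> x)))" using a(1) by (auto simp: R_def)
  obtain x where x: "A (G (\<rho> x)) \<noteq> 0" using a(2) by (auto simp: A(2) fun_eq_iff)
  show ?thesis
  proof (rule that[OF A(1) \<rho>(1) x])
    fix q
    assume q: "\<And>P. polyf P \<Longrightarrow> (\<And>x. x \<in> \<Omega> \<Longrightarrow> P (G x) = 0) \<Longrightarrow> P q = 0" and Aq: "A q \<noteq> 0"
    \<comment> \<open>Evaluation at \<open>q\<close>. An element of \<open>R\<close> may come from
      several polynomials, but their difference vanishes on the image of \<open>G\<close>, hence at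
      \<open>q\<close>.\<close>
    define \<phi> where "\<phi> f = (SOME P. polyf P \<and> f = (\<lambda>x. P (G (\<rho> x)))) q" for f
    have \<phi>: "\<phi> (\<lambda>x. P (G (\<rho> x))) = P q" if P: "polyf P" for P
    proof -
      define P' where "P' = (SOME P'. polyf P' \<and> (\<lambda>x. P (G (\<rho> x))) = (\<lambda>x. P' (G (\<rho> x))))"
      have P': "polyf P' \<and> (\<lambda>x. P (G (\<rho> x))) = (\<lambda>x. P' (G (\<rho> x)))"
        unfolding P'_def by (rule someI[of _ P]) (use P in auto)
      have "P' q - P q = 0"
      proof (rule q)
        show "polyf (\<lambda>v. P' v - P v)" using P P' by (intro polyf_diff) auto
        show "P' (G x) - P (G x) = 0" if "x \<in> \<Omega>" for x
          using fun_cong[OF conjunct2[OF P'], of x] \<rho>(2)[OF that] by simp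
      qed
      then show ?thesis unfolding \<phi>_def P'_def[symmetric] by simp
    qed
    have "hom_on R \<phi>"
      unfolding hom_on_def
    proof (intro conjI ballI)
      show "\<phi> 1 = 1" using \<phi>[OF polyf.const[of 1]] by (simp add: one_fun_def)
      fix f g assume "f \<in> R" "g \<in> R"
      then obtain f' g' where fg: "f = (\<lambda>x. f' (G (\<rho> x)))" "polyf f'" "g = (\<lambda>x. g' (G (\<rho> x)))" "polyf g'"
        by (auto simp: R_def)
      show "\<phi> (f + g) = \<phi> f + \<phi> g"
        using \<phi>[OF polyf.add[OF fg(2,4)]] \<phi>[OF fg(2)] \<phi>[OF fg(4)] by (simp add: fg(1,3) plus_fun_def)
      show "\<phi> (f * g) = \<phi> f * \<phi> g"
        using \<phi>[OF polyf.mult[OF fg(2,4)]] \<phi>[OF fg(2)] \<phi>[OF fg(4)] by (simp add: fg(1,3) times_fun_def)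
    qed
    moreover have "\<phi> a \<noteq> 0" using Aq \<phi>[OF A(1)] by (simp add: A(2))
    ultimately obtain \<psi> where \<psi>: "hom_on S \<psi>" "\<forall>r\<in>R. \<psi> r = \<phi> r" "\<psi> (\<lambda>x. B (e (\<rho> x))) \<noteq> 0"
      using aext by blast
    have c: "\<psi> (\<lambda>x. c) = c" for c using \<psi>(2) cR \<phi>[OF polyf.const[of c]] by simp
    define y where "y = (\<chi> k. \<psi> (\<lambda>x. e (\<rho> x) $ k))"
    have "B y \<noteq> 0" using \<psi>(3) unfolding polyhom[OF B(1) \<psi>(1) c] y_def .
    moreover have "Q y = P q" if "polyf Q" "polyf P" "\<forall>x\<in>\<Omega>. Q (e x) = P (G x)" for Q P
    proof -
      have "(\<lambda>x. Q (e (\<rho> x))) = (\<lambda>x. P (G (\<rho> x)))" using that(3) \<rho>(1) by auto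
      then have "\<psi> (\<lambda>x. Q (e (\<rho> x))) = \<psi> (\<lambda>x. P (G (\<rho> x)))" by simp
      also have "\<dots> = P q" using \<psi>(2) RI[OF that(2)] \<phi>[OF that(2)] by simp
      finally show ?thesis unfolding polyhom[OF that(1) \<psi>(1) c] y_def .
    qed
    ultimately show "\<exists>y. B y \<noteq> 0 \<and> (\<forall>Q P. polyf Q \<and> polyf P \<and> (\<forall>x\<in>\<Omega>. Q (e x) = P (G x)) \<longrightarrow> Q y = P q)"
      by blast
  qed
qed

section \<open>Local inverses of polynomial maps\<close>

text \<open>The inverse function theorem is applied over the reals, so complex homogeneity of the
  derivative is recorded alongside. Continuity in \<open>x\<close> for each fixed \<open>h\<close>
  is the continuous differentiability that the theorem asks for.\<close>

lemma polyf_has_derivative: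
  assumes "polyf f"
  shows "\<exists>D. (\<forall>x. (f has_derivative D x) (at x)) \<and> (\<forall>h. continuous_on UNIV (\<lambda>x. D x h)) \<and>
    (\<forall>x c h. D x (c *s h) = c * D x h)"
  using assms
proof induction
  case (const c)
  show ?case by (rule exI[of _ "\<lambda>x h. 0"]) auto
next
  case (coord i)
  show ?case
    by (rule exI[of _ "\<lambda>x h. h $ i"]) (auto intro!: bounded_linear_imp_has_derivative bounded_linear_vec_nth)
next
  case (add f g)
  then obtain D E where D: "\<forall>x. (f has_derivative D x) (at x)" "\<forall>h. continuous_on UNIV (\<lambda>x. D x h)"
      "\<forall>x c h. D x (c *s h) = c * D x h"
    and E: "\<forall>x. (g has_derivative E x) (at x)" "\<forall>h. continuous_on UNIV (\<lambda>x. E x h)"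
      "\<forall>x c h. E x (c *s h) = c * E x h" by blast
  show ?case
    by (rule exI[of _ "\<lambda>x h. D x h + E x h"])
      (use D E in \<open>auto intro!: has_derivative_add continuous_intros simp: algebra_simps\<close>)
next
  case (mult f g)
  then obtain D E where D: "\<forall>x. (f has_derivative D x) (at x)" "\<forall>h. continuous_on UNIV (\<lambda>x. D x h)"
      "\<forall>x c h. D x (c *s h) = c * D x h"
    and E: "\<forall>x. (g has_derivative E x) (at x)" "\<forall>h. continuous_on UNIV (\<lambda>x. E x h)"
      "\<forall>x c h. E x (c *s h) = c * E x h" by blast
  have "continuous_on UNIV f" "continuous_on UNIV g"
    using D(1) E(1) by (auto intro!: has_derivative_continuous_on)
  moreover have "((\<lambda>a. f a * g a) has_derivative (\<lambda>h. f x * E x h + D x h * g x)) (at x)" for x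
    using D(1) E(1) by (intro has_derivative_mult) auto
  moreover have "f x * E x (c *s h) + D x (c *s h) * g x = c * (f x * E x h + D x h * g x)" for x c h
    using D(3) E(3) by (simp add: algebra_simps)
  ultimately show ?case
    by (intro exI[of _ "\<lambda>x h. f x * E x h + D x h * g x"])
      (use D(2) E(2) in \<open>auto intro!: continuous_intros\<close>)
qed

lemma has_derivative_vecI:
  fixes f :: "'a::real_normed_vector \<Rightarrow> complex ^ 'm"
  assumes "\<And>k. ((\<lambda>x. f x $ k) has_derivative (\<lambda>h. f' h $ k)) (at x)"
  shows "(f has_derivative f') (at x)"
proof (subst has_derivative_componentwise_within, intro ballI)
  fix b :: "complex ^ 'm" assume "b \<in> Basis"
  then obtain k u where b: "b = axis k u" by (auto simp: Basis_vec_def)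
  have "((\<lambda>x. f x $ k \<bullet> u) has_derivative (\<lambda>h. f' h $ k \<bullet> u)) (at x)"
    by (intro has_derivative_inner_left assms)
  then show "((\<lambda>x. f x \<bullet> b) has_derivative (\<lambda>h. f' h \<bullet> b)) (at x)"
    by (simp add: b inner_axis)
qed

lemma has_derivative_line:
  fixes x h :: "complex ^ 'n"
  assumes "(f has_derivative D) (at x)" "\<And>c. D (c *s h) = c * (D h :: complex)"
  shows "((\<lambda>z. f (x + z *s h)) has_field_derivative D h) (at 0)"
proof -
  have "((\<lambda>z. x + z *s h) has_derivative (\<lambda>z. z *s h)) (at 0)"
    by (rule has_derivative_vecI) (auto intro!: derivative_eq_intros)
  then have "((\<lambda>z. f (x + z *s h)) has_derivative (\<lambda>z. D (z *s h))) (at 0)"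
    using has_derivative_compose[of "\<lambda>z. x + z *s h" "\<lambda>z. z *s h" 0 UNIV f D] assms(1) by simp
  moreover have "(\<lambda>z. z * D h) = (*) (D h)" by (simp add: fun_eq_iff mult.commute)
  ultimately show ?thesis unfolding has_field_derivative_def assms(2) by simp
qed

text \<open>The derivative at \<open>x0\<close> is assumed to be the identity, so invertibility is
  automatic and all the work lies in setting up \<open>F\<close> in each application.\<close>

theorem polyf_local_inverse:
  fixes F :: "complex ^ 'n \<Rightarrow> complex ^ 'n"
  assumes F: "\<And>k. polyf (\<lambda>x. F x $ k)"
    and der: "\<And>h k. ((\<lambda>z. F (x0 + z *s h) $ k) has_field_derivative h $ k) (at 0)"
  obtains V g where "open V" "F x0 \<in> V" "g (F x0) = x0" "\<And>y. y \<in> V \<Longrightarrow> F (g y) = y"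
    "\<And>k. line_hol V (\<lambda>y. g y $ k)"
proof -
  obtain D where D: "\<And>k x. ((\<lambda>x. F x $ k) has_derivative D k x) (at x)"
      "\<And>k h. continuous_on UNIV (\<lambda>x. D k x h)" "\<And>k x c h. D k x (c *s h) = c * D k x h"
    using polyf_has_derivative[OF F] by metis
  define D' where "D' x h = (\<chi> k. D k x h)" for x h
  have D': "(F has_derivative D' x) (at x)" for x
    by (rule has_derivative_vecI) (simp add: D'_def D(1))
  have lin: "D' x (c *s h) = c *s D' x h" for x c h by (simp add: D'_def D(3) vec_eq_iff)
  have bl: "bounded_linear (D' x)" for x using D' by (rule has_derivative_bounded_linear)
  define f' where "f' x = Blinfun (D' x)" for x
  have f': "blinfun_apply (f' x) = D' x" for x
    unfolding f'_def by (rule bounded_linear_Blinfun_apply[OF bl])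
  have "D k x0 h = h $ k" for k h
    by (rule DERIV_unique[OF has_derivative_line[OF D(1) D(3)] der])
  then have "D' x0 = (\<lambda>h. h)" by (simp add: D'_def fun_eq_iff vec_eq_iff)
  then have id: "id_blinfun o\<^sub>L f' x0 = id_blinfun" by (intro blinfun_eqI) (simp add: f')
  have cont: "continuous_on UNIV f'"
  proof (rule continuous_on_blinfun_componentwise)
    fix i :: "complex ^ 'n"
    show "continuous_on UNIV (\<lambda>x. blinfun_apply (f' x) i)"
      unfolding f' D'_def by (intro continuous_on_vec_lambda D(2))
  qed
  obtain U' V g g' where IFT: "open V" "F x0 \<in> V" "homeomorphism U' V F g" "x0 \<in> U'"
    "\<And>y. y \<in> V \<Longrightarrow> (g has_derivative (g' y)) (at y)"
    "\<And>y. y \<in> V \<Longrightarrow> g' y = inv (blinfun_apply (f' (g y)))"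
    "\<And>y. y \<in> V \<Longrightarrow> bij (blinfun_apply (f' (g y)))"
    using inverse_function_theorem[OF open_UNIV _ cont UNIV_I id, of F] f' D' by metis
  show ?thesis
  proof (rule that[OF IFT(1,2)])
    show "g (F x0) = x0" using IFT(3,4) by (simp add: homeomorphism_def)
    show "F (g y) = y" if "y \<in> V" for y using IFT(3) that by (simp add: homeomorphism_def)
    fix k
    show "line_hol V (\<lambda>y. g y $ k)"
      unfolding line_hol_def
    proof (intro ballI allI)
      fix y v assume y: "y \<in> V"
      have bij: "bij (D' (g y))" and g': "g' y = inv (D' (g y))"
        using IFT(6,7)[OF y] by (simp_all add: f')
      \<comment> \<open>The inverse of a complex homogeneous bijection is complex homogeneous; this
        turns the real derivative of \<open>g\<close> into a complex one along lines.\<close>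
      have "g' y (c *s v) = c *s g' y v" for c
      proof -
        have "D' (g y) (c *s g' y v) = c *s v"
          unfolding lin g' by (simp add: bij bij_is_surj surj_f_inv_f)
        then show ?thesis unfolding g' by (metis bij bij_inv_eq_iff)
      qed
      moreover have "((\<lambda>y. g y $ k) has_derivative (\<lambda>h. g' y h $ k)) (at y)"
        using bounded_linear.has_derivative[OF bounded_linear_vec_nth IFT(5)[OF y]] .
      ultimately have "((\<lambda>z. g (y + z *s v) $ k) has_field_derivative g' y v $ k) (at 0)"
        using has_derivative_line[of "\<lambda>y. g y $ k" "\<lambda>h. g' y h $ k" y v] by simp
      then show "(\<lambda>z. g (y + z *s v) $ k) field_differentiable at 0"
        by (auto simp: field_differentiable_def)
    qed
  qed
qed

section \<open>Linear algebra over the complex numbers\<close>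

text \<open>A proper subspace is killed by a nonzero functional. The functional is built as a linear
  map into \<open>complex ^ 1\<close>, extending prescribed values on a basis.\<close>

lemma vec_subspace_eq_UNIV:
  fixes D :: "(complex ^ 'n) set"
  assumes D: "vec.subspace D"
    and dual: "\<And>\<Lambda>. (\<And>d. d \<in> D \<Longrightarrow> (\<Sum>i\<in>UNIV. \<Lambda> i * d $ i) = 0) \<Longrightarrow> (\<And>i. \<Lambda> i = 0)"
  shows "D = UNIV"
proof (rule ccontr)
  assume "D \<noteq> UNIV"
  then obtain v where v: "v \<notin> D" by blast
  obtain B where B: "B \<subseteq> D" "vec.independent B" "D \<subseteq> vec.span B" using vec.basis_exists[of D] by metis
  have "vec.span B \<subseteq> D" using B(1) D by (metis vec.span_minimal)
  then have vB: "v \<notin> vec.span B" using v by blast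
  then have ind: "vec.independent (insert v B)" using B(2) by (simp add: vec.independent_insert)
  obtain f :: "complex ^ 'n \<Rightarrow> complex ^ 1" where f: "Vector_Spaces.linear (*s) (*s) f"
    "\<And>x. x \<in> insert v B \<Longrightarrow> f x = (if x = v then axis 1 1 else 0)"
    using vec.linear_independent_extend[OF ind, of "\<lambda>x. if x = v then axis 1 1 else 0"] by blast
  have fB: "f x = 0" if "x \<in> D" for x
  proof -
    have "x \<in> vec.span B" using that B(3) by blast
    moreover have "vec.subspace {x. f x = 0}" by (rule vec.linear_subspace_kernel[OF f(1)])
    moreover have "B \<subseteq> {x. f x = 0}" using f(2) vB vec.span_base by fastforce
    ultimately show ?thesis using vec.span_minimal by blast
  qed
  define \<Lambda> where "\<Lambda> i = f (axis i 1) $ 1" for i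
  have rep: "(\<Sum>i\<in>UNIV. \<Lambda> i * d $ i) = f d $ 1" for d
  proof -
    have "f d = f (\<Sum>i\<in>UNIV. d $ i *s axis i 1)" by (simp add: basis_expansion)
    also have "\<dots> = (\<Sum>i\<in>UNIV. d $ i *s f (axis i 1))"
      by (simp add: vec.linear_sum[OF f(1)] vec.linear_scale[OF f(1)])
    finally show ?thesis by (simp add: \<Lambda>_def mult.commute)
  qed
  have "\<Lambda> i = 0" for i by (rule dual) (simp add: rep fB)
  then have "f v $ 1 = 0" using rep[of v] by simp
  moreover have "f v = axis 1 1" using f(2) by simp
  ultimately show False by simp
qed

text \<open>Families instead of sets, so that a repeated vector counts as dependent and independence
  can be expressed by a determinant.\<close>

definition lin_indep :: "('a::finite \<Rightarrow> complex ^ 'n) \<Rightarrow> bool" where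
  "lin_indep T \<longleftrightarrow> (\<forall>c. (\<Sum>s\<in>UNIV. c s *s T s) = 0 \<longrightarrow> (\<forall>s. c s = 0))"

lemma lin_indep_independent:
  assumes "lin_indep T"
  shows "inj T" "vec.independent (range T)"
proof -
  show inj: "inj T"
  proof (rule injI, rule ccontr)
    fix x y assume eq: "T x = T y" and ne: "x \<noteq> y"
    let ?c = "\<lambda>s. (if s = x then 1 else 0) - (if s = y then 1 else (0 :: complex))"
    have "(\<Sum>s\<in>UNIV. ?c s *s T s) =
      (\<Sum>s\<in>UNIV. (if s = x then 1 else 0) *s T s) - (\<Sum>s\<in>UNIV. (if s = y then 1 else 0) *s T s)"
      by (simp only: vec.scale_left_diff_distrib sum_subtractf)
    also have "\<dots> = 0" using eq by (simp add: if_distrib[of "\<lambda>c. c *s _"] cong: if_cong)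
    finally have "?c x = 0" by (rule assms[unfolded lin_indep_def, rule_format])
    then show False using ne by simp
  qed
  show "vec.independent (range T)"
  proof
    assume "vec.dependent (range T)"
    then obtain u where u: "\<exists>v\<in>range T. u v \<noteq> 0" "(\<Sum>v\<in>range T. u v *s v) = 0"
      using vec.dependent_finite[of "range T"] by auto
    have "(\<Sum>s\<in>UNIV. u (T s) *s T s) = 0" using u(2) by (simp add: sum.reindex[OF inj])
    then have "u (T s) = 0" for s by (rule assms[unfolded lin_indep_def, rule_format])
    then show False using u(1) by auto
  qed
qed

text \<open>The rows \<Lambda> are arbitrary functionals instead of selected coordinates; for the
  dual basis the matrix is the identity. With \<Lambda> fixed, the determinant is a polynomial in
  the vectors, so it can be carried through specialization and read backwards by
  \<open>minor_lin_indep\<close>.\<close>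

lemma lin_indep_minor:
  fixes T :: "'a::finite \<Rightarrow> complex ^ 'n"
  assumes "lin_indep T"
  obtains \<Lambda> :: "'a \<Rightarrow> 'n \<Rightarrow> complex" where "det (\<chi> r s. \<Sum>i\<in>UNIV. \<Lambda> r i * T s $ i) \<noteq> 0"
proof -
  note ind = lin_indep_independent[OF assms]
  obtain f :: "complex ^ 'n \<Rightarrow> complex ^ 'a" where f: "Vector_Spaces.linear (*s) (*s) f"
    "\<And>x. x \<in> range T \<Longrightarrow> f x = axis (inv T x) 1"
    using vec.linear_independent_extend[OF ind(2), of "\<lambda>x. axis (inv T x) 1"] by blast
  have rep: "(\<Sum>i\<in>UNIV. f (axis i 1) $ r * d $ i) = f d $ r" for d r
  proof -
    have "f d = f (\<Sum>i\<in>UNIV. d $ i *s axis i 1)" by (simp add: basis_expansion)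
    also have "\<dots> = (\<Sum>i\<in>UNIV. d $ i *s f (axis i 1))"
      by (simp add: vec.linear_sum[OF f(1)] vec.linear_scale[OF f(1)])
    finally show ?thesis by (simp add: mult.commute)
  qed
  have fT: "f (T s) = axis s 1" for s using f(2)[OF rangeI[of T s]] ind(1) by simp
  have "(\<chi> r s. \<Sum>i\<in>UNIV. f (axis i 1) $ r * T s $ i) = (mat 1 :: complex ^ 'a ^ 'a)"
    unfolding rep fT by (simp add: vec_eq_iff mat_def axis_def)
  then show ?thesis using that[of "\<lambda>r i. f (axis i 1) $ r"] by (simp add: det_I)
qed

lemma minor_lin_indep:
  fixes T :: "'a::finite \<Rightarrow> complex ^ 'n"
  assumes "det (\<chi> r s. \<Sum>i\<in>UNIV. \<Lambda> r i * T s $ i) \<noteq> 0"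
  shows "lin_indep T"
  unfolding lin_indep_def
proof (intro allI impI)
  fix c s assume c: "(\<Sum>s\<in>UNIV. c s *s T s) = 0"
  define M where "M = (\<chi> r s. \<Sum>i\<in>UNIV. \<Lambda> r i * T s $ i)"
  have "(M *v (\<chi> s. c s)) $ r = (\<Sum>i\<in>UNIV. \<Lambda> r i * (\<Sum>s\<in>UNIV. c s *s T s) $ i)" for r
    unfolding M_def matrix_vector_mult_def
    by (simp add: sum_distrib_left sum_distrib_right mult.assoc)
      (subst sum.swap, simp add: mult.commute)
  then have "M *v (\<chi> s. c s) = 0" by (simp add: c vec_eq_iff)
  moreover have "invertible M" using assms by (simp add: invertible_det_nz M_def)
  ultimately have "(\<chi> s. c s) = 0"
    by (metis invertible_def matrix_left_invertible_ker)
  then show "c s = 0" by (simp add: vec_eq_iff)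
qed

section \<open>Partially symmetric tensors in \<open>S\<^sup>3(\<complex>\<^sup>3) \<otimes> \<complex>\<^sup>2 \<otimes> \<complex>\<^sup>2\<close>\<close>

text \<open>The cubic monomials in three variables.  The index type \<open>3\<close> has cyclic arithmetic, so \<open>l + 2\<close> is
  the predecessor of \<open>l\<close>, and its element \<open>0\<close> is the index \<open>3\<close>.\<close>

datatype mon = Cub 3 | Up 3 | Dn 3 | Mid

lemma UNIV_mon: "UNIV = range Cub \<union> range Up \<union> range Dn \<union> {Mid}"
proof -
  have "x \<in> range Cub \<union> range Up \<union> range Dn \<union> {Mid}" for x by (cases x) auto
  then show ?thesis by blast
qed

instance mon :: finite
  by standard (simp add: UNIV_mon)

lemma sum_mon:
  "(\<Sum>\<mu>\<in>UNIV. f \<mu>) = (\<Sum>l\<in>UNIV. f (Cub l)) + (\<Sum>l\<in>UNIV. f (Up l)) + (\<Sum>l\<in>UNIV. f (Dn l)) + f Mid"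
proof -
  have "(\<Sum>\<mu>\<in>UNIV. f \<mu>) = sum f (range Cub) + sum f (range Up) + sum f (range Dn) + sum f {Mid}"
    unfolding UNIV_mon by (subst sum.union_disjoint; auto)+
  moreover have "inj Cub" "inj Up" "inj Dn" by (auto simp: inj_def)
  ultimately show ?thesis by (simp add: sum.reindex)
qed

lemma three_cases: fixes l :: 3 obtains "l = 1" | "l = 2" | "l = 0"
  using exhaust_3[of l] by auto

lemma three_simps [simp]:
  "(3::3) = 0" "(4::3) = 1" "(1::3) + 1 = 2" "(1::3) + 2 = 0" "(2::3) + 1 = 0" "(2::3) + 2 = 1"
  "(1::3) \<noteq> 2" "(2::3) \<noteq> 1" "(2::3) \<noteq> 0" "(0::3) \<noteq> 2"
  by simp_all

lemma sum_three: "(\<Sum>l\<in>UNIV. f (l::3)) = f 0 + f 1 + f 2"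
  by (simp add: sum_3 add_ac)

lemma three_rotate: "UNIV = {c, c + 1, c + (2::3)}" "c \<noteq> c + 1" "c \<noteq> c + 2" "c + 1 \<noteq> c + 2"
  "c + 1 + 1 = c + 2" "c + 1 + 2 = c" "c + 2 + 1 = c" "c + 2 + 2 = c + 1"
proof -
  have "x \<in> {c, c + 1, c + 2}" for x by (cases c rule: three_cases; cases x rule: three_cases) auto
  then show "UNIV = {c, c + 1, c + (2::3)}" by blast
qed (cases c rule: three_cases; simp)+

lemma sum_three_rotate: "(\<Sum>l\<in>UNIV. f (l::3)) = f c + f (c + 1) + f (c + 2)"
  by (cases c rule: three_cases) (simp_all add: sum_three add_ac)

fun mval :: "complex ^ 3 \<Rightarrow> mon \<Rightarrow> complex" where
  "mval a (Cub l) = a $ l ^ 3"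
| "mval a (Up l) = a $ l ^ 2 * a $ (l + 1)"
| "mval a (Dn l) = a $ l ^ 2 * a $ (l + 2)"
| "mval a Mid = a $ 0 * a $ 1 * a $ 2"

fun mdiff :: "complex ^ 3 \<Rightarrow> complex ^ 3 \<Rightarrow> mon \<Rightarrow> complex" where
  "mdiff a d (Cub l) = 3 * a $ l ^ 2 * d $ l"
| "mdiff a d (Up l) = 2 * a $ l * d $ l * a $ (l + 1) + a $ l ^ 2 * d $ (l + 1)"
| "mdiff a d (Dn l) = 2 * a $ l * d $ l * a $ (l + 2) + a $ l ^ 2 * d $ (l + 2)"
| "mdiff a d Mid = d $ 0 * a $ 1 * a $ 2 + a $ 0 * d $ 1 * a $ 2 + a $ 0 * a $ 1 * d $ 2"

type_synonym wspace = "complex ^ (mon \<times> 2 \<times> 2)"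

definition pt :: "complex ^ 3 \<Rightarrow> complex ^ 2 \<Rightarrow> complex ^ 2 \<Rightarrow> wspace" where
  "pt a s t = (\<chi> x. mval a (fst x) * s $ fst (snd x) * t $ snd (snd x))"

definition tang :: "complex ^ 3 \<Rightarrow> complex ^ 2 \<Rightarrow> complex ^ 2 \<Rightarrow>
    complex ^ 3 \<Rightarrow> complex ^ 2 \<Rightarrow> complex ^ 2 \<Rightarrow> wspace" where
  "tang a s t a' s' t' = (\<chi> x. mdiff a a' (fst x) * s $ fst (snd x) * t $ snd (snd x) +
     mval a (fst x) * s' $ fst (snd x) * t $ snd (snd x) + mval a (fst x) * s $ fst (snd x) * t' $ snd (snd x))"

definition tangents_span :: "('i::finite \<Rightarrow> complex ^ 3) \<Rightarrow> ('i \<Rightarrow> complex ^ 2) \<Rightarrow> ('i \<Rightarrow> complex ^ 2) \<Rightarrow> bool" where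
  "tangents_span a s t \<longleftrightarrow> (\<forall>w. \<exists>a' s' t'. w = (\<Sum>i\<in>UNIV. tang (a i) (s i) (t i) (a' i) (s' i) (t' i)))"

lemma mdiff_add: "mdiff a (d + d') \<mu> = mdiff a d \<mu> + mdiff a d' \<mu>"
  and mdiff_scale: "mdiff a (c *s d) \<mu> = c * mdiff a d \<mu>"
  and mdiff_zero: "mdiff a 0 \<mu> = 0"
  by (cases \<mu>; simp add: algebra_simps)+

lemma tang_add: "tang a s t (a' + a'') (s' + s'') (t' + t'') = tang a s t a' s' t' + tang a s t a'' s'' t''"
  and tang_scale: "tang a s t (c *s a') (c *s s') (c *s t') = c *s tang a s t a' s' t'"
  and tang_zero: "tang a s t 0 0 0 = 0"
  by (simp_all add: tang_def vec_eq_iff mdiff_add mdiff_scale mdiff_zero algebra_simps)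

lemma tang_sum:
  "tang a s t (\<Sum>x\<in>X. c x *s a' x) (\<Sum>x\<in>X. c x *s s' x) (\<Sum>x\<in>X. c x *s t' x) =
   (\<Sum>x\<in>X. c x *s tang a s t (a' x) (s' x) (t' x))"
  by (induction X rule: infinite_finite_induct) (simp_all add: tang_zero tang_add tang_scale)

lemma mval_derivative:
  "((\<lambda>z. mval (a + z *s d) \<mu>) has_field_derivative mdiff a d \<mu>) (at 0)"
  by (cases \<mu>) (auto intro!: derivative_eq_intros simp: power2_eq_square power3_eq_cube algebra_simps)

lemma pt_derivative:
  "((\<lambda>z. pt (a + z *s a') (s + z *s s') (t + z *s t') $ x) has_field_derivative
     tang a s t a' s' t' $ x) (at 0)"
  unfolding pt_def tang_def
  by (auto intro!: derivative_eq_intros mval_derivative simp: algebra_simps)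

lemma polyf_mval: "(\<And>l. polyf (\<lambda>x. f x $ l)) \<Longrightarrow> polyf (\<lambda>x. mval (f x) \<mu>)"
  by (cases \<mu>) (simp_all add: polyf.mult polyf_power)

text \<open>Each summand has seven parameters although the cone has dimension 5, because of two
  rescalings, so the inverse function theorem does not apply to the parametrisation itself. A lift
  of each basis vector through the tangent map is chosen, and \<open>F\<close> moves only along
  these lifts; its derivative at 0 is then the identity.\<close>

lemma local_decomposition:
  fixes a :: "'i::finite \<Rightarrow> complex ^ 3" and s t :: "'i \<Rightarrow> complex ^ 2"
  assumes "tangents_span a s t" and w0: "w0 = (\<Sum>i\<in>UNIV. pt (a i) (s i) (t i))"
  obtains V \<alpha> \<sigma> \<tau> where "open V" "w0 \<in> V" "\<alpha> w0 = a" "\<sigma> w0 = s" "\<tau> w0 = t"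
    "\<And>w. w \<in> V \<Longrightarrow> (\<Sum>i\<in>UNIV. pt (\<alpha> w i) (\<sigma> w i) (\<tau> w i)) = w"
    "\<And>i l. line_hol V (\<lambda>w. \<alpha> w i $ l)" "\<And>i l. line_hol V (\<lambda>w. \<sigma> w i $ l)" "\<And>i l. line_hol V (\<lambda>w. \<tau> w i $ l)"
proof -
  obtain a' s' t' where lift: "\<And>x. axis x 1 = (\<Sum>i\<in>UNIV. tang (a i) (s i) (t i) (a' x i) (s' x i) (t' x i))"
  proof -
    have "\<forall>x. \<exists>a' s' t'. axis x 1 = (\<Sum>i\<in>UNIV. tang (a i) (s i) (t i) (a' i) (s' i) (t' i))"
      using assms(1) unfolding tangents_span_def by blast
    from choice[OF this] obtain a' where
      "\<forall>x. \<exists>s' t'. axis x 1 = (\<Sum>i\<in>UNIV. tang (a i) (s i) (t i) (a' x i) (s' i) (t' i))" by blast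
    from choice[OF this] obtain s' where
      "\<forall>x. \<exists>t'. axis x 1 = (\<Sum>i\<in>UNIV. tang (a i) (s i) (t i) (a' x i) (s' x i) (t' i))" by blast
    from choice[OF this] show ?thesis using that by blast
  qed
  define A where "A q i = a i + (\<Sum>x\<in>UNIV. q $ x *s a' x i)" for q :: wspace and i
  define S where "S q i = s i + (\<Sum>x\<in>UNIV. q $ x *s s' x i)" for q :: wspace and i
  define T where "T q i = t i + (\<Sum>x\<in>UNIV. q $ x *s t' x i)" for q :: wspace and i
  define F where "F q = (\<Sum>i\<in>UNIV. pt (A q i) (S q i) (T q i))" for q
  have pA: "polyf (\<lambda>q. A q i $ l)" and pS: "polyf (\<lambda>q. S q i $ j)" and pT: "polyf (\<lambda>q. T q i $ j)" for i l j
    unfolding A_def S_def T_def by (simp_all add: polyf_intros)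
  have "polyf (\<lambda>q. F q $ x)" for x
    unfolding F_def pt_def by (simp add: polyf_sum polyf.mult polyf_mval pA pS pT)
  moreover have "((\<lambda>z. F (0 + z *s h) $ x) has_field_derivative h $ x) (at 0)" for h x
  proof -
    have lin: "A (0 + z *s h) i = a i + z *s (\<Sum>x\<in>UNIV. h $ x *s a' x i)"
      "S (0 + z *s h) i = s i + z *s (\<Sum>x\<in>UNIV. h $ x *s s' x i)"
      "T (0 + z *s h) i = t i + z *s (\<Sum>x\<in>UNIV. h $ x *s t' x i)" for z i
      by (simp_all add: A_def S_def T_def vec.scale_sum_right)
    have "((\<lambda>z. F (0 + z *s h) $ x) has_field_derivative (\<Sum>i\<in>UNIV. tang (a i) (s i) (t i)
      (\<Sum>x\<in>UNIV. h $ x *s a' x i) (\<Sum>x\<in>UNIV. h $ x *s s' x i) (\<Sum>x\<in>UNIV. h $ x *s t' x i) $ x)) (at 0)"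
      unfolding F_def lin sum_component by (intro DERIV_sum pt_derivative)
    also have "(\<Sum>i\<in>UNIV. tang (a i) (s i) (t i)
      (\<Sum>x\<in>UNIV. h $ x *s a' x i) (\<Sum>x\<in>UNIV. h $ x *s s' x i) (\<Sum>x\<in>UNIV. h $ x *s t' x i) $ x) =
      (\<Sum>x\<in>UNIV. h $ x *s axis x 1) $ x"
      unfolding tang_sum lift sum_component[symmetric] vec.scale_sum_right by (subst sum.swap) (rule refl)
    finally show ?thesis by (simp only: basis_expansion)
  qed
  ultimately obtain V g where g: "open V" "F 0 \<in> V" "g (F 0) = 0" "\<And>y. y \<in> V \<Longrightarrow> F (g y) = y"
    "\<And>k. line_hol V (\<lambda>y. g y $ k)"
    using polyf_local_inverse[of F 0] by blast
  have zero: "A 0 = a" "S 0 = s" "T 0 = t" by (simp_all add: A_def S_def T_def fun_eq_iff)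
  then have F0: "F 0 = w0" by (simp add: F_def w0)
  show ?thesis
    by (rule that[of V "\<lambda>w. A (g w)" "\<lambda>w. S (g w)" "\<lambda>w. T (g w)"])
      (use g zero F0 in \<open>auto simp flip: F_def intro: line_hol_polyf[OF pA] line_hol_polyf[OF pS] line_hol_polyf[OF pT]\<close>)
qed

section \<open>Configurations invariant under a diagonal group of order three\<close>

definition \<omega> :: complex where "\<omega> = cis (2 * pi / 3)"

lemma omega_cube: "\<omega> ^ 3 = 1"
  unfolding \<omega>_def by (simp add: Complex.DeMoivre)

lemma omega_ne_1: "\<omega> \<noteq> 1"
proof -
  have "sin (2 * pi / 3) > 0" by (rule sin_gt_zero) (use pi_gt_zero in auto)
  then show ?thesis unfolding \<omega>_def by (auto simp: complex_eq_iff)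
qed

lemma omega_sum: "1 + \<omega> + \<omega> ^ 2 = 0"
proof -
  have "(\<omega> - 1) * (1 + \<omega> + \<omega> ^ 2) = \<omega> ^ 3 - 1" by (simp add: algebra_simps power2_eq_square power3_eq_cube)
  then show ?thesis using omega_cube omega_ne_1 by simp
qed

definition \<zeta> :: "3 \<Rightarrow> complex" where
  "\<zeta> k = (if k = 0 then 1 else if k = 1 then \<omega> else \<omega> ^ 2)"

lemma zeta_cube: "\<zeta> k ^ 3 = 1"
proof -
  have "(\<omega> ^ 2) ^ 3 = (\<omega> ^ 3) ^ 2" by (simp only: power_mult[symmetric] mult.commute)
  then show ?thesis by (simp add: \<zeta>_def omega_cube)
qed

text \<open>Invertibility of the character table of the cyclic group of order three: an equation
  valid on a whole orbit splits into its isotypic parts.\<close>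

lemma character_vanish:
  assumes "\<And>k. p + \<zeta> k * q + \<zeta> k ^ 2 * r = 0"
  shows "p = 0" "q = 0" "r = 0"
proof -
  have 1: "p + q + r = 0" "p + \<omega> * q + \<omega> ^ 2 * r = 0" "p + \<omega> ^ 2 * q + \<omega> ^ 4 * r = 0"
    using assms[of 0] assms[of 1] assms[of 2] by (simp_all add: \<zeta>_def flip: power_mult)
  have w4: "\<omega> ^ 4 = \<omega>" using omega_cube by (simp add: power4_eq_xxxx power3_eq_cube)
  have w2: "\<omega> ^ 2 = - 1 - \<omega>" using omega_sum by (simp add: algebra_simps eq_neg_iff_add_eq_0)
  have "3 * p = (p + q + r) + (p + \<omega> * q + \<omega> ^ 2 * r) + (p + \<omega> ^ 2 * q + \<omega> ^ 4 * r)"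
    unfolding w4 w2 by (simp add: algebra_simps)
  then show p: "p = 0" unfolding 1 by simp
  have "q = - r" using 1(1) p by (simp add: eq_neg_iff_add_eq_0)
  then have "r * (\<omega> * (\<omega> - 1)) = 0" using 1(2) p by (simp add: algebra_simps power2_eq_square)
  moreover have "\<omega> \<noteq> 0" using omega_cube by auto
  ultimately show "r = 0" using omega_ne_1 by simp
  then show "q = 0" using \<open>q = - r\<close> by simp
qed

text \<open>The coordinates have weights 0, 1, 2 modulo 3. Every \<open>Up l\<close> thus has weight
  \<open>3 * l + 1\<close>, congruent to 1, every \<open>Dn l\<close> has weight 2, and
  \<open>Cub l\<close> and \<open>Mid\<close> are invariant; the monomials are grouped by cyclic
  shifts for this reason.\<close>

definition orb :: "3 \<Rightarrow> complex ^ 3 \<Rightarrow> complex ^ 3" where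
  "orb k v = (\<chi> l. (if l = 0 then 1 else if l = 1 then \<zeta> k else \<zeta> k ^ 2) * v $ l)"

lemma mval_orb:
  "mval (orb k v) (Cub l) = mval v (Cub l)" "mval (orb k v) (Up l) = \<zeta> k * mval v (Up l)"
  "mval (orb k v) (Dn l) = \<zeta> k ^ 2 * mval v (Dn l)" "mval (orb k v) Mid = mval v Mid"
  and mdiff_orb:
  "mdiff (orb k v) (orb k d) (Cub l) = mdiff v d (Cub l)" "mdiff (orb k v) (orb k d) (Up l) = \<zeta> k * mdiff v d (Up l)"
  "mdiff (orb k v) (orb k d) (Dn l) = \<zeta> k ^ 2 * mdiff v d (Dn l)" "mdiff (orb k v) (orb k d) Mid = mdiff v d Mid"
proof -
  have z: "\<zeta> k * (\<zeta> k * \<zeta> k) = 1" using zeta_cube[of k] by (simp add: power3_eq_cube mult.assoc)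
  then have z': "\<zeta> k * (\<zeta> k * (\<zeta> k * x)) = x" for x by (metis mult.assoc mult_1)
  note e = power2_eq_square power3_eq_cube orb_def
  show "mval (orb k v) (Cub l) = mval v (Cub l)" "mval (orb k v) (Up l) = \<zeta> k * mval v (Up l)"
    "mval (orb k v) (Dn l) = \<zeta> k ^ 2 * mval v (Dn l)" "mval (orb k v) Mid = mval v Mid"
    "mdiff (orb k v) (orb k d) (Cub l) = mdiff v d (Cub l)" "mdiff (orb k v) (orb k d) (Up l) = \<zeta> k * mdiff v d (Up l)"
    "mdiff (orb k v) (orb k d) (Dn l) = \<zeta> k ^ 2 * mdiff v d (Dn l)" "mdiff (orb k v) (orb k d) Mid = mdiff v d Mid"
    by (cases l rule: three_cases; simp add: e z z' mult_ac distrib_left)+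
qed

text \<open>A 2 by 2 matrix with given left and right null vectors is determined up to one scalar,
  here taken to be \<open>m11\<close>.\<close>

lemma rank_one_annihilator:
  fixes m11 :: complex
  assumes "\<sigma>1 * m11 + \<sigma>2 * m21 = 0" "\<sigma>1 * m12 + \<sigma>2 * m22 = 0" "m11 * \<theta>1 + m12 * \<theta>2 = 0"
  shows "m22 * (\<sigma>2 * \<theta>2) = m11 * (\<sigma>1 * \<theta>1)"
    and "m11 = 0 \<Longrightarrow> \<sigma>2 \<noteq> 0 \<Longrightarrow> \<theta>2 \<noteq> 0 \<Longrightarrow> m12 = 0 \<and> m21 = 0 \<and> m22 = 0"
proof -
  have "m22 * \<sigma>2 = - (\<sigma>1 * m12)" "m12 * \<theta>2 = - (m11 * \<theta>1)"
    using assms by (simp_all add: eq_neg_iff_add_eq_0 add.commute mult.commute)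
  then show "m22 * (\<sigma>2 * \<theta>2) = m11 * (\<sigma>1 * \<theta>1)" by algebra
  show "m11 = 0 \<Longrightarrow> \<sigma>2 \<noteq> 0 \<Longrightarrow> \<theta>2 \<noteq> 0 \<Longrightarrow> m12 = 0 \<and> m21 = 0 \<and> m22 = 0" using assms by auto
qed

text \<open>The block of size 16: \<alpha>, \<beta>, \<gamma>, \<delta> stand for the matrices of
  \<open>Cub (c + 1)\<close>, \<open>Cub (c + 2)\<close>, \<open>Cub c\<close>, \<open>Mid\<close>.
  The null vectors tie \<alpha>11 to \<alpha>22 and \<beta>11 to \<beta>22, the gradient equations
  tie \<alpha> to \<beta> at both places, and the last inequality is the determinant of these four
  relations. Once \<alpha> and \<beta> vanish, the diagonal follows, and
  \<open>r1 \<noteq> r2\<close> separates \<gamma> from \<delta> off the diagonal.\<close>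

lemma invariant_part_zero:
  fixes p1 :: complex
  assumes d1: "3 * p1 * \<alpha>11 + \<delta>11 = 0" "3 * q1 * \<beta>11 + \<delta>11 = 0" "3 * r1 * \<gamma>11 + \<delta>11 = 0"
    and d2: "3 * p2 * \<alpha>22 + \<delta>22 = 0" "3 * q2 * \<beta>22 + \<delta>22 = 0" "3 * r2 * \<gamma>22 + \<delta>22 = 0"
    and v12: "p1 * \<alpha>12 + q1 * \<beta>12 + r1 * \<gamma>12 + \<delta>12 = 0" "p2 * \<alpha>12 + q2 * \<beta>12 + r2 * \<gamma>12 + \<delta>12 = 0"
    and v21: "p1 * \<alpha>21 + q1 * \<beta>21 + r1 * \<gamma>21 + \<delta>21 = 0" "p2 * \<alpha>21 + q2 * \<beta>21 + r2 * \<gamma>21 + \<delta>21 = 0"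
    and a: "\<sigma>1 * \<alpha>11 + \<sigma>2 * \<alpha>21 = 0" "\<sigma>1 * \<alpha>12 + \<sigma>2 * \<alpha>22 = 0" "\<alpha>11 * \<theta>1 + \<alpha>12 * \<theta>2 = 0"
    and b: "\<sigma>1' * \<beta>11 + \<sigma>2' * \<beta>21 = 0" "\<sigma>1' * \<beta>12 + \<sigma>2' * \<beta>22 = 0" "\<beta>11 * \<theta>1' + \<beta>12 * \<theta>2' = 0"
    and nz: "p1 \<noteq> 0" "q1 \<noteq> 0" "r1 \<noteq> 0" "p2 \<noteq> 0" "q2 \<noteq> 0" "r2 \<noteq> 0" "r1 \<noteq> r2"
      "\<sigma>2 \<noteq> 0" "\<theta>2 \<noteq> 0" "\<sigma>2' \<noteq> 0" "\<theta>2' \<noteq> 0"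
      "q1 * p2 * (\<sigma>1 * \<theta>1) * (\<sigma>2' * \<theta>2') \<noteq> p1 * q2 * (\<sigma>1' * \<theta>1') * (\<sigma>2 * \<theta>2)"
  shows "\<alpha>11 = 0 \<and> \<alpha>12 = 0 \<and> \<alpha>21 = 0 \<and> \<alpha>22 = 0" "\<beta>11 = 0 \<and> \<beta>12 = 0 \<and> \<beta>21 = 0 \<and> \<beta>22 = 0"
    "\<gamma>11 = 0 \<and> \<gamma>12 = 0 \<and> \<gamma>21 = 0 \<and> \<gamma>22 = 0" "\<delta>11 = 0 \<and> \<delta>12 = 0 \<and> \<delta>21 = 0 \<and> \<delta>22 = 0"
proof -
  have pq: "q1 * \<beta>11 = p1 * \<alpha>11" "q2 * \<beta>22 = p2 * \<alpha>22" using d1(1,2) d2(1,2) by algebra+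
  note A = rank_one_annihilator[OF a] and B = rank_one_annihilator[OF b]
  have "\<alpha>11 * (q1 * p2 * (\<sigma>1 * \<theta>1) * (\<sigma>2' * \<theta>2') - p1 * q2 * (\<sigma>1' * \<theta>1') * (\<sigma>2 * \<theta>2)) = 0"
    using pq A(1) B(1) by algebra
  then have a11: "\<alpha>11 = 0" using nz(12) by simp
  then have b11: "\<beta>11 = 0" using pq(1) nz by simp
  have \<alpha>: "\<alpha>12 = 0 \<and> \<alpha>21 = 0 \<and> \<alpha>22 = 0" using A(2) a11 nz by blast
  have \<beta>: "\<beta>12 = 0 \<and> \<beta>21 = 0 \<and> \<beta>22 = 0" using B(2) b11 nz by blast
  show "\<alpha>11 = 0 \<and> \<alpha>12 = 0 \<and> \<alpha>21 = 0 \<and> \<alpha>22 = 0" "\<beta>11 = 0 \<and> \<beta>12 = 0 \<and> \<beta>21 = 0 \<and> \<beta>22 = 0"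
    using a11 b11 \<alpha> \<beta> by simp_all
  have \<delta>: "\<delta>11 = 0" "\<delta>22 = 0" using d1(1) d2(1) a11 \<alpha> by simp_all
  then have \<gamma>: "\<gamma>11 = 0" "\<gamma>22 = 0" using d1(3) d2(3) nz by simp_all
  have "(r1 - r2) * \<gamma>12 = 0" "(r1 - r2) * \<gamma>21 = 0" using v12 v21 \<alpha> \<beta> by algebra+
  then have "\<gamma>12 = 0" "\<gamma>21 = 0" using nz by simp_all
  moreover then have "\<delta>12 = 0" "\<delta>21 = 0" using v12(1) v21(1) \<alpha> \<beta> by simp_all
  ultimately show "\<gamma>11 = 0 \<and> \<gamma>12 = 0 \<and> \<gamma>21 = 0 \<and> \<gamma>22 = 0" "\<delta>11 = 0 \<and> \<delta>12 = 0 \<and> \<delta>21 = 0 \<and> \<delta>22 = 0"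
    using \<gamma> \<delta> by simp_all
qed

text \<open>The hypotheses say that the gradient of the cubic with terms \<open>A x^2 y\<close>,
  \<open>B y^2 z\<close>, \<open>C z^2 x\<close> vanishes at a point; the determinant is
  \<open>9 x^2 y^2 z^2\<close>.\<close>

lemma up_diagonal_zero:
  fixes x :: complex
  assumes "2 * x * y * A + z\<^sup>2 * C = 0" "x\<^sup>2 * A + 2 * y * z * B = 0" "y\<^sup>2 * B + 2 * z * x * C = 0"
    and "x \<noteq> 0" "y \<noteq> 0" "z \<noteq> 0"
  shows "A = 0 \<and> B = 0 \<and> C = 0"
proof -
  have "9 * (x\<^sup>2 * y\<^sup>2 * z\<^sup>2) * A = 0" using assms(1-3) by algebra
  then have "A = 0" using assms(4-6) by simp
  then show ?thesis using assms by auto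
qed

text \<open>Two evaluations confine the triples with index 12 and with index 21 to the same line,
  leaving one scalar for each. The coordinate points give two equations between these scalars, with
  the last inequality as determinant.\<close>

lemma off_diagonal_zero:
  fixes A12 :: complex
  assumes v12: "x1 * A12 + y1 * B12 + z1 * C12 = 0" "x2 * A12 + y2 * B12 + z2 * C12 = 0"
    and v21: "x1 * A21 + y1 * B21 + z1 * C21 = 0" "x2 * A21 + y2 * B21 + z2 * C21 = 0"
    and e: "\<sigma>1 * \<theta>2 * A12 + \<sigma>2 * \<theta>1 * A21 = 0" "\<sigma>1' * \<theta>2' * B12 + \<sigma>2' * \<theta>1' * B21 = 0"
    and nz: "y1 * z2 \<noteq> z1 * y2" "x1 * z2 \<noteq> z1 * x2" "z1 \<noteq> 0" "\<sigma>2 * \<theta>1 \<noteq> 0"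
      "(\<sigma>1 * \<theta>2) * (\<sigma>2' * \<theta>1') \<noteq> (\<sigma>2 * \<theta>1) * (\<sigma>1' * \<theta>2')"
  shows "A12 = 0 \<and> B12 = 0 \<and> C12 = 0" "A21 = 0 \<and> B21 = 0 \<and> C21 = 0"
proof -
  define n m where "n = x1 * z2 - z1 * x2" and "m = y1 * z2 - z1 * y2"
  have n: "n \<noteq> 0" "m \<noteq> 0" using nz by (simp_all add: n_def m_def)
  have 1: "A12 * n + B12 * m = 0" "A21 * n + B21 * m = 0"
    using v12 v21 unfolding n_def m_def by algebra+
  have "n * (A12 * ((\<sigma>1 * \<theta>2) * (\<sigma>2' * \<theta>1') - (\<sigma>2 * \<theta>1) * (\<sigma>1' * \<theta>2'))) = 0"
    using 1 e by algebra
  then have A12: "A12 = 0" using nz n by simp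
  then have A21: "A21 = 0" using e(1) nz by simp
  have B: "B12 = 0" "B21 = 0" using 1 A12 A21 n by simp_all
  then have "C12 = 0" "C21 = 0" using v12 v21 nz A12 A21 by simp_all
  then show "A12 = 0 \<and> B12 = 0 \<and> C12 = 0" "A21 = 0 \<and> B21 = 0 \<and> C21 = 0" using A12 A21 B by simp_all
qed

section \<open>Functionals on tangent vectors as forms of degree (3,1,1)\<close>

definition contract :: "(mon \<times> 2 \<times> 2 \<Rightarrow> complex) \<Rightarrow> mon \<Rightarrow> complex ^ 2 \<Rightarrow> complex ^ 2 \<Rightarrow> complex" where
  "contract \<Lambda> \<mu> s t = (\<Sum>j\<in>UNIV. \<Sum>k\<in>UNIV. \<Lambda> (\<mu>, j, k) * s $ j * t $ k)"

lemma sum_mon_2_2: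
  "(\<Sum>x\<in>UNIV. f (x :: mon \<times> 2 \<times> 2)) = (\<Sum>\<mu>\<in>UNIV. \<Sum>j\<in>UNIV. \<Sum>k\<in>UNIV. f (\<mu>, j, k))"
  by (simp add: UNIV_Times_UNIV[symmetric] sum.cartesian_product del: UNIV_Times_UNIV)

lemma contract_add: "contract \<Lambda> \<mu> (s + s') t = contract \<Lambda> \<mu> s t + contract \<Lambda> \<mu> s' t"
    "contract \<Lambda> \<mu> s (t + t') = contract \<Lambda> \<mu> s t + contract \<Lambda> \<mu> s t'"
  and contract_scale: "contract \<Lambda> \<mu> (c *s s) t = c * contract \<Lambda> \<mu> s t"
    "contract \<Lambda> \<mu> s (c *s t) = c * contract \<Lambda> \<mu> s t"
  and contract_zero: "contract \<Lambda> \<mu> 0 t = 0" "contract \<Lambda> \<mu> s 0 = 0"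
  by (simp_all add: contract_def sum_2 algebra_simps)

lemma contract_tang:
  "(\<Sum>x\<in>UNIV. \<Lambda> x * tang a s t a' s' t' $ x) =
   (\<Sum>\<mu>\<in>UNIV. mdiff a a' \<mu> * contract \<Lambda> \<mu> s t + mval a \<mu> * contract \<Lambda> \<mu> s' t + mval a \<mu> * contract \<Lambda> \<mu> s t')"
  unfolding sum_mon_2_2 contract_def tang_def by (simp add: sum_2 algebra_simps)

lemma contract_eq_zero:
  assumes "s1 $ 1 * s2 $ 2 \<noteq> s1 $ 2 * s2 $ (1::2)" "t1 $ 1 * t2 $ 2 \<noteq> t1 $ 2 * t2 $ (1::2)"
    and "contract \<Lambda> \<mu> s1 t1 = 0" "contract \<Lambda> \<mu> s1 t2 = 0" "contract \<Lambda> \<mu> s2 t1 = 0" "contract \<Lambda> \<mu> s2 t2 = 0"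
  shows "\<Lambda> (\<mu>, j, k) = 0"
proof -
  have sp: "\<exists>p q. v = p *s v1 + q *s v2" if "v1 $ 1 * v2 $ 2 \<noteq> v1 $ 2 * v2 $ 1" for v v1 v2 :: "complex ^ 2"
  proof -
    let ?d = "v1 $ 1 * v2 $ 2 - v1 $ 2 * v2 $ 1"
    have "v = ((v $ 1 * v2 $ 2 - v $ 2 * v2 $ 1) / ?d) *s v1 + ((v1 $ 1 * v $ 2 - v1 $ 2 * v $ 1) / ?d) *s v2"
      using that by (simp add: vec_eq_iff forall_2 divide_simps) (simp add: algebra_simps)
    then show ?thesis by blast
  qed
  obtain p q p' q' where "axis j 1 = p *s s1 + q *s s2" "axis k 1 = p' *s t1 + q' *s t2"
    using sp[OF assms(1)] sp[OF assms(2)] by metis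
  then have "contract \<Lambda> \<mu> (axis j 1) (axis k 1) = 0"
    by (simp add: contract_add contract_scale assms(3-6))
  then show ?thesis
    by (simp add: contract_def axis_def if_distrib[of "\<lambda>x. x * _"] if_distrib[of "\<lambda>x. _ * x"] cong: if_cong)
qed

text \<open>The eight points are the orbits of two points, indexed by \<open>Inl (b, k)\<close>, and two of the three
  coordinate points, which the group fixes, indexed by \<open>Inr b\<close>.\<close>

type_synonym idx = "(bool \<times> 3) + bool"

definition conf_a :: "3 \<Rightarrow> (bool \<Rightarrow> complex ^ 3) \<Rightarrow> idx \<Rightarrow> complex ^ 3" where
  "conf_a c v = case_sum (\<lambda>(b, k). orb k (v b)) (\<lambda>b. axis (if b then c + 2 else c + 1) 1)"

definition conf_s :: "(bool \<Rightarrow> complex ^ 2) \<Rightarrow> (bool \<Rightarrow> complex ^ 2) \<Rightarrow> idx \<Rightarrow> complex ^ 2" where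
  "conf_s s e = case_sum (\<lambda>(b, k). s b) e"

lemma conf_simps [simp]:
  "conf_a c v (Inl (b, k)) = orb k (v b)" "conf_a c v (Inr False) = axis (c + 1) 1"
  "conf_a c v (Inr True) = axis (c + 2) 1" "conf_s s e (Inl (b, k)) = s b" "conf_s s e (Inr b) = e b"
  by (simp_all add: conf_a_def conf_s_def)

lemma mid_rotate:
  "mval a Mid = a $ (c + 1) * a $ (c + 2) * a $ c"
  "mdiff a d Mid = d $ (c + 1) * a $ (c + 2) * a $ c + a $ (c + 1) * d $ (c + 2) * a $ c + a $ (c + 1) * a $ (c + 2) * d $ c"
  by (cases c rule: three_cases; simp add: mult_ac add_ac)+

text \<open>A functional that annihilates all tangent spaces is a form of degree \<open>(3,1,1)\<close> that is singular at the
  eight points.  The configuration is invariant under the group of order three, so each of the three isotypic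
  parts of the form (\<open>Cub\<close> with \<open>Mid\<close>, \<open>Up\<close>, \<open>Dn\<close>) is itself singular there, and is shown to vanish.\<close>

lemma terracini:
  fixes v :: "bool \<Rightarrow> complex ^ 3" and s t e f :: "bool \<Rightarrow> complex ^ 2" and c :: 3
  assumes s: "s False $ 1 * s True $ 2 \<noteq> s False $ 2 * s True $ 1"
    and t: "t False $ 1 * t True $ 2 \<noteq> t False $ 2 * t True $ 1"
    and e: "\<And>b. e b = \<sigma> b False *s s False + \<sigma> b True *s s True"
    and f: "\<And>b. f b = \<theta> b False *s t False + \<theta> b True *s t True"
    and v: "\<And>b. v b $ (c + 1) * v b $ (c + 2) * v b $ c = 1" "\<And>l. v False $ l ^ 3 \<noteq> v True $ l ^ 3"
    and nz: "\<And>b b'. \<sigma> b b' \<noteq> 0" "\<And>b b'. \<theta> b b' \<noteq> 0"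
    and det1: "v False $ (c + 2) ^ 3 * v True $ (c + 1) ^ 3 *
         (\<sigma> False False * \<theta> False False) * (\<sigma> True True * \<theta> True True) \<noteq>
       v False $ (c + 1) ^ 3 * v True $ (c + 2) ^ 3 *
         (\<sigma> True False * \<theta> True False) * (\<sigma> False True * \<theta> False True)"
    and det2: "(\<sigma> False False * \<theta> False True) * (\<sigma> True True * \<theta> True False) \<noteq>
      (\<sigma> False True * \<theta> False False) * (\<sigma> True False * \<theta> True True)"
  shows "tangents_span (conf_a c v) (conf_s s e) (conf_s t f)"
proof -
  let ?a = "conf_a c v" and ?s = "conf_s s e" and ?t = "conf_s t f"
  define D where "D = {w. \<exists>a' s' t'. w = (\<Sum>i\<in>UNIV. tang (?a i) (?s i) (?t i) (a' i) (s' i) (t' i))}"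
  have D: "vec.subspace D"
  proof (rule vec.subspaceI)
    have "0 = (\<Sum>i\<in>UNIV. tang (?a i) (?s i) (?t i) 0 0 0)" by (simp add: tang_zero)
    then show "0 \<in> D" unfolding D_def by (intro CollectI exI[of _ "\<lambda>i. 0"])
  next
    fix x y assume "x \<in> D" "y \<in> D"
    then obtain a1 s1 t1 a2 s2 t2 where xy: "x = (\<Sum>i\<in>UNIV. tang (?a i) (?s i) (?t i) (a1 i) (s1 i) (t1 i))"
      "y = (\<Sum>i\<in>UNIV. tang (?a i) (?s i) (?t i) (a2 i) (s2 i) (t2 i))" unfolding D_def by blast
    have "x + y = (\<Sum>i\<in>UNIV. tang (?a i) (?s i) (?t i) (a1 i + a2 i) (s1 i + s2 i) (t1 i + t2 i))"
      unfolding xy tang_add sum.distrib ..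
    then show "x + y \<in> D" unfolding D_def
      by (intro CollectI exI[of _ "\<lambda>i. a1 i + a2 i"] exI[of _ "\<lambda>i. s1 i + s2 i"] exI[of _ "\<lambda>i. t1 i + t2 i"])
  next
    fix k x assume "x \<in> D"
    then obtain a1 s1 t1 where x: "x = (\<Sum>i\<in>UNIV. tang (?a i) (?s i) (?t i) (a1 i) (s1 i) (t1 i))"
      unfolding D_def by blast
    have "k *s x = (\<Sum>i\<in>UNIV. tang (?a i) (?s i) (?t i) (k *s a1 i) (k *s s1 i) (k *s t1 i))"
      unfolding x tang_scale vec.scale_sum_right ..
    then show "k *s x \<in> D" unfolding D_def
      by (intro CollectI exI[of _ "\<lambda>i. k *s a1 i"] exI[of _ "\<lambda>i. k *s s1 i"] exI[of _ "\<lambda>i. k *s t1 i"])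
  qed
  have single: "tang (?a i) (?s i) (?t i) a' s' t' \<in> D" for i a' s' t'
  proof -
    have "tang (?a i) (?s i) (?t i) a' s' t' = (\<Sum>i'\<in>UNIV. tang (?a i') (?s i') (?t i')
      (if i' = i then a' else 0) (if i' = i then s' else 0) (if i' = i then t' else 0))"
      by (subst sum.remove[of _ i]) (auto simp: tang_zero intro!: sum.neutral)
    then show ?thesis unfolding D_def
      by (intro CollectI exI[of _ "\<lambda>i'. if i' = i then a' else 0"] exI[of _ "\<lambda>i'. if i' = i then s' else 0"]
          exI[of _ "\<lambda>i'. if i' = i then t' else 0"])
  qed
  have "D = UNIV"
  proof (rule vec_subspace_eq_UNIV[OF D])
    fix \<Lambda> and x :: "mon \<times> 2 \<times> 2" assume ann: "\<And>d. d \<in> D \<Longrightarrow> (\<Sum>i\<in>UNIV. \<Lambda> i * d $ i) = 0"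
    define B where "B = contract \<Lambda>"
    have Blin: "B \<mu> (p + p') q = B \<mu> p q + B \<mu> p' q" "B \<mu> p (q + q') = B \<mu> p q + B \<mu> p q'"
      "B \<mu> (k *s p) q = k * B \<mu> p q" "B \<mu> p (k *s q) = k * B \<mu> p q" "B \<mu> 0 q = 0" "B \<mu> p 0 = 0" for \<mu> p p' q q' k
      by (simp_all add: B_def contract_add contract_scale contract_zero)
    note ann' = ann[OF single, unfolded contract_tang B_def[symmetric]]
    have da: "(\<Sum>\<mu>\<in>UNIV. mdiff (?a i) d \<mu> * B \<mu> (?s i) (?t i)) = 0" for i d
      using ann'[of i d 0 0] by (simp add: Blin)
    have ds: "(\<Sum>\<mu>\<in>UNIV. mval (?a i) \<mu> * B \<mu> s' (?t i)) = 0" for i s'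
      using ann'[of i 0 s' 0] by (simp add: Blin mdiff_zero)
    have dt: "(\<Sum>\<mu>\<in>UNIV. mval (?a i) \<mu> * B \<mu> (?s i) t') = 0" for i t'
      using ann'[of i 0 0 t'] by (simp add: Blin mdiff_zero)
    define m where "m \<mu> i j = B \<mu> (s i) (t j)" for \<mu> i j
    \<comment> \<open>Moving the direction along with the point, from \<open>d\<close> to
      \<open>orb k d\<close>, makes the equation at the \<open>k\<close>-th point of the orbit a
      character sum in \<open>k\<close>.\<close>
    have da': "(\<Sum>l\<in>UNIV. mdiff (v b) d (Cub l) * m (Cub l) b b) + mdiff (v b) d Mid * m Mid b b = 0"
      "(\<Sum>l\<in>UNIV. mdiff (v b) d (Up l) * m (Up l) b b) = 0"
      "(\<Sum>l\<in>UNIV. mdiff (v b) d (Dn l) * m (Dn l) b b) = 0" for b d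
    proof -
      have ch: "((\<Sum>l\<in>UNIV. mdiff (v b) d (Cub l) * m (Cub l) b b) + mdiff (v b) d Mid * m Mid b b) +
        \<zeta> k * (\<Sum>l\<in>UNIV. mdiff (v b) d (Up l) * m (Up l) b b) +
        \<zeta> k ^ 2 * (\<Sum>l\<in>UNIV. mdiff (v b) d (Dn l) * m (Dn l) b b) = 0" for k
        using da[of "Inl (b, k)" "orb k d"]
        by (simp add: sum_mon mdiff_orb m_def sum_distrib_left mult.assoc add_ac del: mdiff.simps)
      note cv = character_vanish[OF ch]
      show "(\<Sum>l\<in>UNIV. mdiff (v b) d (Cub l) * m (Cub l) b b) + mdiff (v b) d Mid * m Mid b b = 0"
        "(\<Sum>l\<in>UNIV. mdiff (v b) d (Up l) * m (Up l) b b) = 0"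
        "(\<Sum>l\<in>UNIV. mdiff (v b) d (Dn l) * m (Dn l) b b) = 0" by (fact cv)+
    qed
    \<comment> \<open>The two forms of \<open>F\<close> are the two ways to move off the point: vary
      the first \<complex>^2 factor, or the second.\<close>
    have dv: "(\<Sum>l\<in>UNIV. mval (v b) (Cub l) * F (Cub l)) + mval (v b) Mid * F Mid = 0"
      "(\<Sum>l\<in>UNIV. mval (v b) (Up l) * F (Up l)) = 0" "(\<Sum>l\<in>UNIV. mval (v b) (Dn l) * F (Dn l)) = 0"
      if "F = (\<lambda>\<mu>. m \<mu> j b) \<or> F = (\<lambda>\<mu>. m \<mu> b j)" for F b j
    proof -
      have ch: "((\<Sum>l\<in>UNIV. mval (v b) (Cub l) * F (Cub l)) + mval (v b) Mid * F Mid) +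
        \<zeta> k * (\<Sum>l\<in>UNIV. mval (v b) (Up l) * F (Up l)) +
        \<zeta> k ^ 2 * (\<Sum>l\<in>UNIV. mval (v b) (Dn l) * F (Dn l)) = 0" for k
        using ds[of "Inl (b, k)" "s j"] dt[of "Inl (b, k)" "t j"] that
        by (auto simp add: sum_mon mval_orb m_def sum_distrib_left mult.assoc add_ac simp del: mval.simps)
      note cv = character_vanish[OF ch]
      show "(\<Sum>l\<in>UNIV. mval (v b) (Cub l) * F (Cub l)) + mval (v b) Mid * F Mid = 0"
        "(\<Sum>l\<in>UNIV. mval (v b) (Up l) * F (Up l)) = 0" "(\<Sum>l\<in>UNIV. mval (v b) (Dn l) * F (Dn l)) = 0"
        by (fact cv)+
    qed
    note R = three_rotate(2-8)[of c] three_rotate(2-4)[of c, symmetric]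
    note sums = sum_three_rotate[of _ c]
    let ?x = "\<lambda>b. v b $ (c + 1)" and ?y = "\<lambda>b. v b $ (c + 2)" and ?z = "\<lambda>b. v b $ c"
    have xyz: "?x b \<noteq> 0" "?y b \<noteq> 0" "?z b \<noteq> 0" for b using v(1)[of b] by auto
    \<comment> \<open>Each partial derivative is multiplied by its own variable; since the
      coordinates have product 1, the \<open>Mid\<close> term becomes the same in all three
      equations.\<close>
    have g0: "3 * ?x b ^ 3 * m (Cub (c + 1)) b b + m Mid b b = 0" "3 * ?y b ^ 3 * m (Cub (c + 2)) b b + m Mid b b = 0"
      "3 * ?z b ^ 3 * m (Cub c) b b + m Mid b b = 0" for b
    proof -
      have 1: "3 * ?x b ^ 2 * m (Cub (c + 1)) b b + ?y b * ?z b * m Mid b b = 0"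
        using da'(1)[of b "axis (c + 1) 1"] by (simp add: sums mid_rotate(1)[of _ c] mid_rotate(2)[where c = c] axis_def R del: mdiff.simps(4))
      have 2: "3 * ?y b ^ 2 * m (Cub (c + 2)) b b + ?x b * ?z b * m Mid b b = 0"
        using da'(1)[of b "axis (c + 2) 1"] by (simp add: sums mid_rotate(1)[of _ c] mid_rotate(2)[where c = c] axis_def R del: mdiff.simps(4))
      have 3: "3 * ?z b ^ 2 * m (Cub c) b b + ?x b * ?y b * m Mid b b = 0"
        using da'(1)[of b "axis c 1"] by (simp add: sums mid_rotate(1)[of _ c] mid_rotate(2)[where c = c] axis_def R del: mdiff.simps(4))
      show "3 * ?x b ^ 3 * m (Cub (c + 1)) b b + m Mid b b = 0" using 1 v(1)[of b] by algebra
      show "3 * ?y b ^ 3 * m (Cub (c + 2)) b b + m Mid b b = 0" using 2 v(1)[of b] by algebra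
      show "3 * ?z b ^ 3 * m (Cub c) b b + m Mid b b = 0" using 3 v(1)[of b] by algebra
    qed
    have g1: "2 * ?x b * ?y b * m (Up (c + 1)) b b + ?z b ^ 2 * m (Up c) b b = 0"
      "?x b ^ 2 * m (Up (c + 1)) b b + 2 * ?y b * ?z b * m (Up (c + 2)) b b = 0"
      "?y b ^ 2 * m (Up (c + 2)) b b + 2 * ?z b * ?x b * m (Up c) b b = 0" for b
      using da'(2)[of b "axis (c + 1) 1"] da'(2)[of b "axis (c + 2) 1"] da'(2)[of b "axis c 1"]
      by (simp_all add: sums axis_def R add_ac)
    have g2: "2 * ?x b * ?z b * m (Dn (c + 1)) b b + ?y b ^ 2 * m (Dn (c + 2)) b b = 0"
      "?x b ^ 2 * m (Dn (c + 1)) b b + 2 * ?z b * ?y b * m (Dn c) b b = 0"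
      "?z b ^ 2 * m (Dn c) b b + 2 * ?y b * ?x b * m (Dn (c + 2)) b b = 0" for b
      using da'(3)[of b "axis (c + 1) 1"] da'(3)[of b "axis (c + 2) 1"] da'(3)[of b "axis c 1"]
      by (simp_all add: sums axis_def R add_ac)
    have h0: "?x b ^ 3 * m (Cub (c + 1)) i j + ?y b ^ 3 * m (Cub (c + 2)) i j + ?z b ^ 3 * m (Cub c) i j + m Mid i j = 0"
      and h1: "?x b ^ 2 * ?y b * m (Up (c + 1)) i j + ?y b ^ 2 * ?z b * m (Up (c + 2)) i j + ?z b ^ 2 * ?x b * m (Up c) i j = 0"
      and h2: "?x b ^ 2 * ?z b * m (Dn (c + 1)) i j + ?y b ^ 2 * ?x b * m (Dn (c + 2)) i j + ?z b ^ 2 * ?y b * m (Dn c) i j = 0"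
      if "i \<noteq> j" for i j b
    proof -
      \<comment> \<open>An off-diagonal entry is seen from both orbits, through the row of one and
        the column of the other, which gives two equations for it.\<close>
      have "b = i \<or> b = j" using that by auto
      then obtain k where F: "(\<lambda>\<mu>. m \<mu> i j) = (\<lambda>\<mu>. m \<mu> k b) \<or> (\<lambda>\<mu>. m \<mu> i j) = (\<lambda>\<mu>. m \<mu> b k)" by blast
      show "?x b ^ 3 * m (Cub (c + 1)) i j + ?y b ^ 3 * m (Cub (c + 2)) i j + ?z b ^ 3 * m (Cub c) i j + m Mid i j = 0"
        using dv(1)[OF F] v(1)[of b] by (simp add: sums mid_rotate(1)[of _ c] R add_ac del: mval.simps(4))
      show "?x b ^ 2 * ?y b * m (Up (c + 1)) i j + ?y b ^ 2 * ?z b * m (Up (c + 2)) i j + ?z b ^ 2 * ?x b * m (Up c) i j = 0"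
        using dv(2)[OF F] by (simp add: sums R add_ac)
      show "?x b ^ 2 * ?z b * m (Dn (c + 1)) i j + ?y b ^ 2 * ?x b * m (Dn (c + 2)) i j + ?z b ^ 2 * ?y b * m (Dn c) i j = 0"
        using dv(3)[OF F] by (simp add: sums R add_ac)
    qed
    \<comment> \<open>At the coordinate point \<open>c + 1\<close> only \<open>Cub (c + 1)\<close>
      has a nonzero value; the derivative towards \<open>c + 2\<close> sees only
      \<open>Up (c + 1)\<close>, and the one towards \<open>c\<close> only
      \<open>Dn (c + 1)\<close>.\<close>
    have e1: "B (Cub (c + 1)) s' (f False) = 0" "B (Cub (c + 1)) (e False) t' = 0"
      "B (Up (c + 1)) (e False) (f False) = 0" "B (Dn (c + 1)) (e False) (f False) = 0" for s' t'
      using ds[of "Inr False" s'] dt[of "Inr False" t'] da[of "Inr False" "axis (c + 2) 1"] da[of "Inr False" "axis c 1"]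
      by (simp_all add: sum_mon sums mid_rotate(1)[of _ c] mid_rotate(2)[where c = c] axis_def R
          del: mval.simps(4) mdiff.simps(4))
    have e2: "B (Cub (c + 2)) s' (f True) = 0" "B (Cub (c + 2)) (e True) t' = 0"
      "B (Up (c + 2)) (e True) (f True) = 0" "B (Dn (c + 2)) (e True) (f True) = 0" for s' t'
      using ds[of "Inr True" s'] dt[of "Inr True" t'] da[of "Inr True" "axis c 1"] da[of "Inr True" "axis (c + 1) 1"]
      by (simp_all add: sum_mon sums mid_rotate(1)[of _ c] mid_rotate(2)[where c = c] axis_def R
          del: mval.simps(4) mdiff.simps(4))
    have E1: "\<sigma> False False * m (Cub (c + 1)) False b + \<sigma> False True * m (Cub (c + 1)) True b = 0"
      "m (Cub (c + 1)) b False * \<theta> False False + m (Cub (c + 1)) b True * \<theta> False True = 0"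
      "\<sigma> True False * m (Cub (c + 2)) False b + \<sigma> True True * m (Cub (c + 2)) True b = 0"
      "m (Cub (c + 2)) b False * \<theta> True False + m (Cub (c + 2)) b True * \<theta> True True = 0" for b
      using e1(2)[of "t b"] e1(1)[of "s b"] e2(2)[of "t b"] e2(1)[of "s b"]
      by (simp_all add: e f Blin m_def mult.commute)
    have c0: "m (Cub (c + 1)) i j = 0" "m (Cub (c + 2)) i j = 0" "m (Cub c) i j = 0" "m Mid i j = 0" for i j
      using invariant_part_zero[OF g0[of False] g0[of True] h0[of False True False, simplified] h0[of False True True, simplified]
          h0[of True False False, simplified] h0[of True False True, simplified]
          E1(1)[of False] E1(1)[of True] E1(2)[of False] E1(3)[of False] E1(3)[of True] E1(4)[of False]
          _ _ _ _ _ _ v(2) nz(1) nz(2) nz(1) nz(2) det1] xyz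
      by (cases i; cases j; simp)+
    \<comment> \<open>With the diagonal already zero, only the mixed terms survive when
      \<open>e\<close> and \<open>f\<close> are expanded in the bases \<open>s\<close> and
      \<open>t\<close>.\<close>
    have E2: "\<sigma> False False * \<theta> False True * m \<mu> False True + \<sigma> False True * \<theta> False False * m \<mu> True False = 0"
      if "B \<mu> (e False) (f False) = 0" "m \<mu> False False = 0" "m \<mu> True True = 0" for \<mu>
      using that by (simp add: e f Blin m_def algebra_simps)
    have E3: "\<sigma> True False * \<theta> True True * m \<mu> False True + \<sigma> True True * \<theta> True False * m \<mu> True False = 0"
      if "B \<mu> (e True) (f True) = 0" "m \<mu> False False = 0" "m \<mu> True True = 0" for \<mu>
      using that by (simp add: e f Blin m_def algebra_simps)
    have up: "m (Up (c + 1)) b b = 0 \<and> m (Up (c + 2)) b b = 0 \<and> m (Up c) b b = 0" for b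
      by (rule up_diagonal_zero[OF g1[of b] xyz])
    have dn: "m (Dn (c + 1)) b b = 0 \<and> m (Dn c) b b = 0 \<and> m (Dn (c + 2)) b b = 0" for b
      by (rule up_diagonal_zero[OF g2[of b] xyz(1,3,2)])
    let ?F = "False" and ?T = "True"
    \<comment> \<open>Because the coordinates have product 1, each of these four minors is, up to
      nonzero factors, a difference of cubes of one coordinate at the two orbits.\<close>
    have n1: "(?y ?F ^ 2 * ?z ?F) * (?z ?T ^ 2 * ?x ?T) \<noteq> (?z ?F ^ 2 * ?x ?F) * (?y ?T ^ 2 * ?z ?T)"
    proof
      assume "(?y ?F ^ 2 * ?z ?F) * (?z ?T ^ 2 * ?x ?T) = (?z ?F ^ 2 * ?x ?F) * (?y ?T ^ 2 * ?z ?T)"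
      then have "?z ?F * ?z ?T * (?y ?F ^ 3 - ?y ?T ^ 3) = 0" using v(1)[of ?F] v(1)[of ?T] by algebra
      then show False using xyz v(2) by simp
    qed
    have n2: "(?x ?F ^ 2 * ?y ?F) * (?z ?T ^ 2 * ?x ?T) \<noteq> (?z ?F ^ 2 * ?x ?F) * (?x ?T ^ 2 * ?y ?T)"
    proof
      assume "(?x ?F ^ 2 * ?y ?F) * (?z ?T ^ 2 * ?x ?T) = (?z ?F ^ 2 * ?x ?F) * (?x ?T ^ 2 * ?y ?T)"
      then have "?x ?F * ?x ?T * (?z ?F ^ 3 - ?z ?T ^ 3) = 0" using v(1)[of ?F] v(1)[of ?T] by algebra
      then show False using xyz v(2) by simp
    qed
    have n3: "(?y ?F ^ 2 * ?x ?F) * (?z ?T ^ 2 * ?y ?T) \<noteq> (?z ?F ^ 2 * ?y ?F) * (?y ?T ^ 2 * ?x ?T)"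
    proof
      assume "(?y ?F ^ 2 * ?x ?F) * (?z ?T ^ 2 * ?y ?T) = (?z ?F ^ 2 * ?y ?F) * (?y ?T ^ 2 * ?x ?T)"
      then have "?y ?F * ?y ?T * (?z ?F ^ 3 - ?z ?T ^ 3) = 0" using v(1)[of ?F] v(1)[of ?T] by algebra
      then show False using xyz v(2) by simp
    qed
    have n4: "(?x ?F ^ 2 * ?z ?F) * (?z ?T ^ 2 * ?y ?T) \<noteq> (?z ?F ^ 2 * ?y ?F) * (?x ?T ^ 2 * ?z ?T)"
    proof
      assume "(?x ?F ^ 2 * ?z ?F) * (?z ?T ^ 2 * ?y ?T) = (?z ?F ^ 2 * ?y ?F) * (?x ?T ^ 2 * ?z ?T)"
      then have "?z ?F * ?z ?T * (?x ?F ^ 3 - ?x ?T ^ 3) = 0" using v(1)[of ?F] v(1)[of ?T] by algebra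
      then show False using xyz v(2) by simp
    qed
    have s12: "\<sigma> False True * \<theta> False False \<noteq> 0" using nz by simp
    have zz: "?z b ^ 2 * ?x b \<noteq> 0" "?z b ^ 2 * ?y b \<noteq> 0" for b using xyz by simp_all
    note up_off = off_diagonal_zero[OF h1[of False True False, simplified] h1[of False True True, simplified]
        h1[of True False False, simplified] h1[of True False True, simplified]
        E2[OF e1(3)] E3[OF e2(3)] n1 n2 zz(1) s12 det2]
    note dn_off = off_diagonal_zero[OF h2[of False True False, simplified] h2[of False True True, simplified]
        h2[of True False False, simplified] h2[of True False True, simplified]
        E2[OF e1(4)] E3[OF e2(4)] n3 n4 zz(2) s12 det2]
    have u: "m (Up (c + 1)) i j = 0 \<and> m (Up (c + 2)) i j = 0 \<and> m (Up c) i j = 0" for i j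
      using up_off up[of False] up[of True] by (cases i; cases j; simp)
    have d: "m (Dn (c + 1)) i j = 0 \<and> m (Dn (c + 2)) i j = 0 \<and> m (Dn c) i j = 0" for i j
      using dn_off dn[of False] dn[of True] by (cases i; cases j; simp)
    have all: "m \<mu> i j = 0" for \<mu> i j
    proof -
      have l: "l = c \<or> l = c + 1 \<or> l = c + 2" for l using three_rotate(1)[of c] by blast
      show ?thesis
      proof (cases \<mu>)
        case (Cub l)
        then show ?thesis using l[of l] c0 by auto
      next
        case (Up l)
        then show ?thesis using l[of l] u by auto
      next
        case (Dn l)
        then show ?thesis using l[of l] d by auto
      next
        case Mid
        then show ?thesis using c0 by auto
      qed
    qed
    obtain \<mu> and j k :: 2 where x: "x = (\<mu>, j, k)" by (metis prod_cases3)
    show "\<Lambda> x = 0" unfolding x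
      by (rule contract_eq_zero[OF s t]) (use all in \<open>simp_all add: m_def B_def\<close>)
  qed
  then show ?thesis unfolding tangents_span_def D_def by blast
qed

section \<open>Linear relations among the summands of a configuration\<close>

lemma sum_idx: "(\<Sum>i\<in>UNIV. g (i :: idx)) =
  (\<Sum>b\<in>UNIV. \<Sum>k\<in>UNIV. g (Inl (b, k))) + (g (Inr False) + g (Inr True))"
proof -
  have "(\<Sum>i\<in>UNIV. g (i :: idx)) = (\<Sum>x\<in>UNIV. g (Inl x)) + (\<Sum>b\<in>UNIV. g (Inr b))"
    unfolding UNIV_Plus_UNIV[symmetric] by (subst sum.Plus) (simp_all add: o_def)
  also have "(\<Sum>x\<in>UNIV. g (Inl x)) = (\<Sum>b\<in>UNIV. \<Sum>k\<in>UNIV. g (Inl (b, k)))"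
    by (simp add: UNIV_Times_UNIV[symmetric] sum.cartesian_product del: UNIV_Times_UNIV)
  finally show ?thesis by (simp add: UNIV_bool add.commute)
qed

definition conf_pt :: "3 \<Rightarrow> (bool \<Rightarrow> complex ^ 3) \<Rightarrow> (bool \<Rightarrow> complex ^ 2) \<Rightarrow> (bool \<Rightarrow> complex ^ 2) \<Rightarrow>
    (bool \<Rightarrow> complex ^ 2) \<Rightarrow> (bool \<Rightarrow> complex ^ 2) \<Rightarrow> idx \<Rightarrow> wspace" where
  "conf_pt c v s t e f i = pt (conf_a c v i) (conf_s s e i) (conf_s t f i)"

lemma rank_one_pair_zero:
  fixes X :: "bool \<Rightarrow> complex" and s t :: "bool \<Rightarrow> complex ^ 2"
  assumes s: "s False $ 1 * s True $ 2 \<noteq> s False $ 2 * s True $ 1"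
    and t: "t False $ 1 * t True $ 2 \<noteq> t False $ 2 * t True $ 1"
    and X: "\<And>j k. X False * (s False $ j * t False $ k) + X True * (s True $ j * t True $ k) = 0"
  shows "X b = 0"
proof -
  have 1: "X False * t False $ k * (s False $ 1 * s True $ 2 - s False $ 2 * s True $ 1) = 0"
    "X True * t True $ k * (s False $ 1 * s True $ 2 - s False $ 2 * s True $ 1) = 0" for k
    using X[of 1 k] X[of 2 k] by algebra+
  then have "X False * t False $ k = 0" "X True * t True $ k = 0" for k using s by simp_all
  from this[of 1] this[of 2] t have "X False = 0" "X True = 0" by auto
  then show ?thesis by (cases b) auto
qed

lemma mval_axis: "mval (axis l 1) \<mu> = (if \<mu> = Cub l then 1 else 0)"
  by (cases \<mu>; cases l rule: three_cases) (auto simp: axis_def three_rotate)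

text \<open>\<open>Mid\<close>, \<open>Up c\<close> and \<open>Dn c\<close> do not occur in the
  coordinate points, and there is one of them for each character. Reading off these entries gives
  the Fourier transform \<open>K\<close> of the coefficients along each orbit. The target
  \<open>w\<close> may be 0 or a coordinate point, for independence and for separation.\<close>

lemma conf_orbit_coefficients:
  fixes \<kappa> :: "idx \<Rightarrow> complex"
  assumes s: "s False $ 1 * s True $ 2 \<noteq> s False $ 2 * s True $ 1"
    and t: "t False $ 1 * t True $ 2 \<noteq> t False $ 2 * t True $ 1"
    and v: "\<And>b l. v b $ l \<noteq> 0"
    and w: "(\<Sum>i\<in>UNIV. \<kappa> i *s conf_pt c v s t e f i) = w"
    and zero: "\<And>j k. w $ (Mid, j, k) = 0" "\<And>j k. w $ (Up c, j, k) = 0" "\<And>j k. w $ (Dn c, j, k) = 0"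
  shows "\<kappa> (Inl x) = 0"
proof -
  define K where "K n b = \<kappa> (Inl (b, 0)) + \<zeta> n * \<kappa> (Inl (b, 1)) + \<zeta> n ^ 2 * \<kappa> (Inl (b, 2))" for n b
  have \<zeta>: "\<zeta> 0 = 1" "\<zeta> 1 = \<omega>" "\<zeta> 2 = \<omega> ^ 2" by (simp_all add: \<zeta>_def)
  have comp: "(\<Sum>b\<in>UNIV. (\<Sum>k\<in>UNIV. \<kappa> (Inl (b, k)) * mval (orb k (v b)) \<mu>) * (s b $ j * t b $ l)) = w $ (\<mu>, j, l)"
    if "\<mu> \<noteq> Cub (c + 1)" "\<mu> \<noteq> Cub (c + 2)" for \<mu> j l
    using that unfolding w[symmetric] sum_component
    by (simp add: sum_idx conf_pt_def pt_def mval_axis sum_distrib_left mult_ac)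
  have Kz: "K n b = 0" for n b
  proof -
    have "K 0 b * mval (v b) Mid = 0"
      by (rule rank_one_pair_zero[OF s t, of "\<lambda>b. K 0 b * mval (v b) Mid"])
        (use comp[of Mid] in \<open>simp add: UNIV_bool zero K_def \<zeta> sum_three mval_orb algebra_simps del: mval.simps\<close>)
    moreover have "K 1 b * mval (v b) (Up c) = 0"
      by (rule rank_one_pair_zero[OF s t, of "\<lambda>b. K 1 b * mval (v b) (Up c)"])
        (use comp[of "Up c"] in \<open>simp add: UNIV_bool zero K_def \<zeta> sum_three mval_orb algebra_simps del: mval.simps\<close>)
    moreover have "K 2 b * mval (v b) (Dn c) = 0"
      by (rule rank_one_pair_zero[OF s t, of "\<lambda>b. K 2 b * mval (v b) (Dn c)"])
        (use comp[of "Dn c"] in \<open>simp add: UNIV_bool zero K_def \<zeta> sum_three mval_orb algebra_simps del: mval.simps\<close>)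
    ultimately have "K 0 b = 0" "K 1 b = 0" "K 2 b = 0" using v by auto
    then show ?thesis by (cases n rule: three_cases) auto
  qed
  then have "\<kappa> (Inl (b, 0)) = 0" "\<kappa> (Inl (b, 1)) = 0" "\<kappa> (Inl (b, 2)) = 0" for b
  proof -
    have k: "\<And>n. \<kappa> (Inl (b, 0)) + \<zeta> n * \<kappa> (Inl (b, 1)) + \<zeta> n ^ 2 * \<kappa> (Inl (b, 2)) = 0"
      using Kz unfolding K_def .
    show "\<kappa> (Inl (b, 0)) = 0" "\<kappa> (Inl (b, 1)) = 0" "\<kappa> (Inl (b, 2)) = 0"
      using character_vanish[OF k] by blast+
  qed
  then show ?thesis by (cases x) (metis three_cases)
qed

lemma conf_fixed_part:
  assumes "\<And>x. \<kappa> (Inl x) = 0"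
  shows "(\<Sum>i\<in>UNIV. \<kappa> i *s conf_pt c v s t e f i) $ (Cub l, j, k) =
    (if l = c + 1 then \<kappa> (Inr False) * (e False $ j * f False $ k)
     else if l = c + 2 then \<kappa> (Inr True) * (e True $ j * f True $ k) else 0)"
  using three_rotate(2-4)[of c] assms
  by (auto simp: sum_component sum_idx conf_pt_def pt_def mval_axis)

lemma vec2_nonzero: "(x :: complex ^ 2) \<noteq> 0 \<Longrightarrow> \<exists>j. x $ j \<noteq> 0"
  by (auto simp: vec_eq_iff)

lemma conf_lin_indep:
  assumes s: "s False $ 1 * s True $ 2 \<noteq> s False $ 2 * s True $ 1"
    and t: "t False $ 1 * t True $ 2 \<noteq> t False $ 2 * t True $ 1"
    and v: "\<And>b l. v b $ l \<noteq> 0" and ef: "\<And>b. e b \<noteq> 0" "\<And>b. f b \<noteq> 0"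
  shows "lin_indep (conf_pt c v s t e f)"
  unfolding lin_indep_def
proof (intro allI impI)
  fix \<kappa> i assume 0: "(\<Sum>i\<in>UNIV. \<kappa> i *s conf_pt c v s t e f i) = 0"
  have 1: "\<kappa> (Inl x) = 0" for x by (rule conf_orbit_coefficients[OF s t v 0]) auto
  obtain j k where jk: "e False $ j \<noteq> 0" "f False $ k \<noteq> 0" using ef vec2_nonzero by blast
  obtain j' k' where jk': "e True $ j' \<noteq> 0" "f True $ k' \<noteq> 0" using ef vec2_nonzero by blast
  have "\<kappa> (Inr False) * (e False $ j * f False $ k) = 0" "\<kappa> (Inr True) * (e True $ j' * f True $ k') = 0"
    using conf_fixed_part[where \<kappa> = \<kappa> and c = c and v = v and s = s and t = t and e = e and f = f and l = "c + 1" and j = j and k = k, OF 1]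
      conf_fixed_part[where \<kappa> = \<kappa> and c = c and v = v and s = s and t = t and e = e and f = f and l = "c + 2" and j = j' and k = k', OF 1]
      three_rotate(2-4)[of c] by (auto simp: 0)
  then have "\<kappa> (Inr b) = 0" for b using jk jk' by (cases b) auto
  then show "\<kappa> i = 0" using 1 by (cases i) auto
qed

text \<open>The invariant that distinguishes decompositions. A coordinate point has only one nonzero
  monomial, a cube, so the orbits cannot contribute to it and it must be a multiple of one of the
  two fixed summands.\<close>

lemma conf_span_fixed:
  assumes s: "s False $ 1 * s True $ 2 \<noteq> s False $ 2 * s True $ 1"
    and t: "t False $ 1 * t True $ 2 \<noteq> t False $ 2 * t True $ 1"
    and v: "\<And>b l. v b $ l \<noteq> 0" and pq: "p \<noteq> 0" "q \<noteq> 0"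
    and span: "(\<Sum>i\<in>UNIV. \<kappa> i *s conf_pt c v s t e f i) = pt (axis l 1) p q"
  shows "l \<noteq> c" "l = c + 1 \<Longrightarrow> p $ 1 * e False $ 2 = p $ 2 * e False $ 1"
proof -
  have 1: "\<kappa> (Inl x) = 0" for x
    by (rule conf_orbit_coefficients[OF s t v span]) (auto simp: pt_def mval_axis)
  have comp: "p $ j * q $ k = (if l = c + 1 then \<kappa> (Inr False) * (e False $ j * f False $ k)
     else if l = c + 2 then \<kappa> (Inr True) * (e True $ j * f True $ k) else 0)" for j k
    using conf_fixed_part[where \<kappa> = \<kappa> and c = c and v = v and s = s and t = t and e = e and f = f and l = l and j = j and k = k, OF 1]
    unfolding span by (simp add: pt_def mval_axis)
  obtain j k where jk: "p $ j \<noteq> 0" "q $ k \<noteq> 0" using pq vec2_nonzero by blast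
  show "l \<noteq> c" using comp[of j k] jk three_rotate(2-4)[of c] by auto
  show "p $ 1 * e False $ 2 = p $ 2 * e False $ 1" if "l = c + 1"
  proof -
    have "q $ k * (p $ 1 * e False $ 2 - p $ 2 * e False $ 1) = 0"
    proof -
      have "p $ 1 * q $ k = \<kappa> (Inr False) * (e False $ 1 * f False $ k)"
        "p $ 2 * q $ k = \<kappa> (Inr False) * (e False $ 2 * f False $ k)"
        using comp[of 1 k] comp[of 2 k] that by simp_all
      then show ?thesis by algebra
    qed
    then show ?thesis using jk by simp
  qed
qed

lemma lin_indep_option:
  assumes "lin_indep T" "\<And>\<kappa>. (\<Sum>i\<in>UNIV. \<kappa> i *s T i) \<noteq> w"
  shows "lin_indep (\<lambda>x. case x of None \<Rightarrow> w | Some i \<Rightarrow> T i)"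
  unfolding lin_indep_def
proof (intro allI impI)
  fix c s assume "(\<Sum>x\<in>UNIV. c x *s (case x of None \<Rightarrow> w | Some i \<Rightarrow> T i)) = 0"
  then have sum: "c None *s w + (\<Sum>i\<in>UNIV. c (Some i) *s T i) = 0"
    by (simp add: UNIV_option_conv sum.reindex)
  have "c None = 0"
  proof (rule ccontr)
    assume c: "c None \<noteq> 0"
    have "(\<Sum>i\<in>UNIV. (- c (Some i) / c None) *s T i) = (- 1 / c None) *s (\<Sum>i\<in>UNIV. c (Some i) *s T i)"
      by (simp add: vec.scale_sum_right)
    also have "\<dots> = (- 1 / c None) *s (- (c None *s w))"
      using sum by (metis add.commute add_eq_0_iff)
    also have "\<dots> = w" using c by (simp add: vec_eq_iff)
    finally show False using assms(2)[of "\<lambda>i. - c (Some i) / c None"] by contradiction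
  qed
  moreover then have "(\<Sum>i\<in>UNIV. c (Some i) *s T i) = 0" using sum by simp
  then have "c (Some i) = 0" for i by (rule assms(1)[unfolded lin_indep_def, rule_format])
  ultimately show "c s = 0" by (cases s) auto
qed

section \<open>A tensor with six explicit decompositions\<close>

text \<open>The tensor is \<open>3 (x\<^sub>1\<^sup>3 C\<^sub>1 + x\<^sub>2\<^sup>3 C\<^sub>2 + x\<^sub>3\<^sup>3 C\<^sub>3 + x\<^sub>1 x\<^sub>2 x\<^sub>3 I)\<close> with \<open>2 \<times> 2\<close> matrices \<open>C\<^sub>l\<close>.  For each
  of the three indices \<open>c\<close>, the simultaneous diagonalisation of \<open>C\<^sub>c\<close> and \<open>I\<close> determines \<open>sdir\<close> and \<open>tdir\<close>,
  and the remaining conditions form a quadratic equation whose two roots are indexed by \<open>w\<close>.\<close>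

definition cmat :: "3 \<Rightarrow> complex ^ 2 ^ 2" where
  "cmat c = (if c = 0 then vector [vector [-4, 2], vector [-6, 4]]
     else if c = 1 then vector [vector [2, 0], vector [-2, -2]]
     else vector [vector [-2, 6], vector [0, 2]])"

definition base_tensor :: wspace where
  "base_tensor = (\<chi> x. case fst x of Cub l \<Rightarrow> 3 * cmat l $ fst (snd x) $ snd (snd x)
     | Mid \<Rightarrow> (if fst (snd x) = snd (snd x) then 3 else 0) | _ \<Rightarrow> 0)"

text \<open>Eigenvectors of \<open>cmat c\<close> for the eigenvalues 2 (\<open>False\<close>) and
  -2 (\<open>True\<close>); \<open>tdir c\<close> is the dual basis, so the outer products sum to
  the identity. The three matrices have trace 0, square 4 and pairwise products of trace -20. The
  eigenvectors are scaled so that \<open>cmat (c + 1)\<close> and \<open>cmat (c + 2)\<close> have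
  entries independent of \<open>c\<close> in this basis, hence so are the tables below.\<close>

definition sdir :: "3 \<Rightarrow> bool \<Rightarrow> complex ^ 2" where
  "sdir c b = (if c = 0 then (if b then vector [1, 1] else vector [1, 3])
     else if c = 1 then (if b then vector [0, -1] else vector [2, -1])
     else (if b then vector [1, 0] else vector [3, 2]))"

definition tdir :: "3 \<Rightarrow> bool \<Rightarrow> complex ^ 2" where
  "tdir c b = (if c = 0 then (if b then vector [3/2, -1/2] else vector [-1/2, 1/2])
     else if c = 1 then (if b then vector [-1/2, -1] else vector [1/2, 0])
     else (if b then vector [1, -3/2] else vector [0, 1/2]))"

text \<open>After the orbit contributions are subtracted, three times the rest of
  \<open>cmat (c + 1)\<close> has rank one; in the bases \<open>sdir\<close> and \<open>tdir\<close>
  it is the outer product of \<open>scoef w False\<close> and \<open>tcoef w False\<close>. The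
  index \<open>True\<close> does the same for \<open>cmat (c + 2)\<close>.\<close>

definition scoef :: "bool \<Rightarrow> bool \<Rightarrow> bool \<Rightarrow> complex" where
  "scoef w b b' = (if w then (if b then (if b' then 9 else -2) else (if b' then 2 else -1))
     else (if b then (if b' then 6 else -1) else (if b' then 3 else -2)))"

definition tcoef :: "bool \<Rightarrow> bool \<Rightarrow> bool \<Rightarrow> complex" where
  "tcoef w b b' = (if w then (if b then (if b' then 3/2 else 7) else (if b' then 9 else 21/2))
     else (if b then (if b' then 3 else 21/2) else (if b' then 9/2 else 7)))"

definition sfix :: "3 \<times> bool \<Rightarrow> bool \<Rightarrow> complex ^ 2" where
  "sfix j b = scoef (snd j) b False *s sdir (fst j) False + scoef (snd j) b True *s sdir (fst j) True"

definition tfix :: "3 \<times> bool \<Rightarrow> bool \<Rightarrow> complex ^ 2" where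
  "tfix j b = tcoef (snd j) b False *s tdir (fst j) False + tcoef (snd j) b True *s tdir (fst j) True"

text \<open>The cubes \<open>p\<close> of the coordinates \<open>c + 1\<close> at the two orbits. In
  the eigenbasis \<open>cmat (c + 1)\<close> has diagonal -5, 5 and off-diagonal product -21, so a
  rest of rank one means that 5 + \<open>p False\<close> times 5 - \<open>p True\<close> is 21. The
  cubes \<open>q\<close> at \<open>c + 2\<close> obey the same equation, and \<open>p b\<close>
  times \<open>q b\<close> is 1/2 or -1/2, the inverse eigenvalue. The two solutions are exchanged
  by swapping \<open>p\<close> and \<open>q\<close>, so \<open>q\<close> is
  \<open>pcoef (\<not> w)\<close>.\<close>

definition pcoef :: "bool \<Rightarrow> bool \<Rightarrow> complex" where
  "pcoef w b = (if w then (if b then -1 else -3/2) else (if b then 1/2 else -1/3))"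

definition cube_root :: "complex \<Rightarrow> complex" where
  "cube_root z = (SOME x. x ^ 3 = z)"

lemma cube_root: "cube_root z ^ 3 = z"
proof -
  have "\<exists>x. x ^ 3 = z"
  proof (cases "z = 0")
    case False
    then have "exp (Ln z / 3) ^ 3 = z" by (simp flip: exp_of_nat_mult)
    then show ?thesis by blast
  qed (auto intro: exI[of _ 0])
  then show ?thesis unfolding cube_root_def by (rule someI_ex)
qed

text \<open>The last coordinate makes the product of all three equal to 1, which yields the identity
  matrix at \<open>Mid\<close>; its cube is then automatically the eigenvalue 2 or -2 of
  \<open>cmat c\<close>.\<close>

definition orbit_rep :: "3 \<times> bool \<Rightarrow> bool \<Rightarrow> complex ^ 3" where
  "orbit_rep j b = (\<chi> l. if l = fst j + 1 then cube_root (pcoef (snd j) b)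
     else if l = fst j + 2 then cube_root (pcoef (\<not> snd j) b)
     else 1 / (cube_root (pcoef (snd j) b) * cube_root (pcoef (\<not> snd j) b)))"

definition base_a where "base_a j = conf_a (fst j) (orbit_rep j)"
definition base_s where "base_s j = conf_s (sdir (fst j)) (sfix j)"
definition base_t where "base_t j = conf_s (tdir (fst j)) (tfix j)"
definition base_pt where "base_pt j i = pt (base_a j i) (base_s j i) (base_t j i)"

lemma base_pt: "base_pt j = conf_pt (fst j) (orbit_rep j) (sdir (fst j)) (tdir (fst j)) (sfix j) (tfix j)"
  by (simp add: fun_eq_iff base_pt_def base_a_def base_s_def base_t_def conf_pt_def)

lemma pcoef_nz: "pcoef w b \<noteq> 0" by (simp add: pcoef_def)

lemma cube_root_nz: "z \<noteq> 0 \<Longrightarrow> cube_root z \<noteq> 0"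
  using cube_root[of z] by auto

lemma orbit_rep_cubes:
  "orbit_rep (c, w) b $ (c + 1) ^ 3 = pcoef w b" "orbit_rep (c, w) b $ (c + 2) ^ 3 = pcoef (\<not> w) b"
  "orbit_rep (c, w) b $ c ^ 3 = (if b then -2 else 2)"
  "orbit_rep (c, w) b $ (c + 1) * orbit_rep (c, w) b $ (c + 2) * orbit_rep (c, w) b $ c = 1"
  "orbit_rep (c, w) b $ l \<noteq> 0"
  using three_rotate(2-4)[of c] cube_root_nz[OF pcoef_nz]
  by (auto simp: orbit_rep_def cube_root power_divide power_mult_distrib pcoef_def)

lemma sdir_det: "sdir c False $ 1 * sdir c True $ 2 \<noteq> sdir c False $ 2 * sdir c True $ 1"
  and tdir_det: "tdir c False $ 1 * tdir c True $ 2 \<noteq> tdir c False $ 2 * tdir c True $ 1"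
  by (cases c rule: three_cases; simp add: sdir_def tdir_def)+

lemma fix_nz: "sfix j b \<noteq> 0" "tfix j b \<noteq> 0"
  by (cases j; cases "fst j" rule: three_cases; cases "snd j"; cases b;
      simp add: sfix_def tfix_def sdir_def tdir_def scoef_def tcoef_def vec_eq_iff forall_2)+

lemma base_tangents_span: "tangents_span (base_a j) (base_s j) (base_t j)"
proof -
  obtain c w where j: "j = (c, w)" by (cases j)
  note o = orbit_rep_cubes[of c w]
  show ?thesis
    unfolding base_a_def base_s_def base_t_def
  proof (rule terracini[where \<sigma> = "scoef w" and \<theta> = "tcoef w"])
    show "sdir (fst j) False $ 1 * sdir (fst j) True $ 2 \<noteq> sdir (fst j) False $ 2 * sdir (fst j) True $ 1"
      "tdir (fst j) False $ 1 * tdir (fst j) True $ 2 \<noteq> tdir (fst j) False $ 2 * tdir (fst j) True $ 1"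
      by (rule sdir_det tdir_det)+
    show "orbit_rep j False $ l ^ 3 \<noteq> orbit_rep j True $ l ^ 3" for l
    proof -
      have "l = c \<or> l = c + 1 \<or> l = c + 2" using three_rotate(1)[of c] by blast
      then show ?thesis using o unfolding j by (cases w) (auto simp: pcoef_def complex_eq_iff)
    qed
    show "orbit_rep j False $ (fst j + 2) ^ 3 * orbit_rep j True $ (fst j + 1) ^ 3 *
        (scoef w False False * tcoef w False False) * (scoef w True True * tcoef w True True) \<noteq>
      orbit_rep j False $ (fst j + 1) ^ 3 * orbit_rep j True $ (fst j + 2) ^ 3 *
        (scoef w True False * tcoef w True False) * (scoef w False True * tcoef w False True)"
      unfolding j fst_conv o by (cases w) (simp_all add: scoef_def tcoef_def pcoef_def complex_eq_iff)
    show "(scoef w False False * tcoef w False True) * (scoef w True True * tcoef w True False) \<noteq>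
      (scoef w False True * tcoef w False False) * (scoef w True False * tcoef w True True)"
      by (cases w) (simp_all add: scoef_def tcoef_def complex_eq_iff)
  qed (use o in \<open>simp_all add: j sfix_def tfix_def scoef_def tcoef_def\<close>)
qed

lemma base_sum: "(\<Sum>i\<in>UNIV. base_pt j i) = base_tensor"
proof -
  obtain c w where j: "j = (c, w)" by (cases j)
  define v where "v = orbit_rep j"
  have \<zeta>: "\<zeta> 0 = 1" "\<zeta> 1 = \<omega>" "\<zeta> 2 = \<omega> ^ 2" by (simp_all add: \<zeta>_def)
  have w4: "\<omega> ^ 4 = \<omega>" using omega_cube by (simp add: power4_eq_xxxx power3_eq_cube)
  \<comment> \<open>Summing over the group projects to the invariant monomials, with factor 3; this
    is the factor in \<open>base_tensor\<close>.\<close>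
  have orbit: "(\<Sum>k\<in>UNIV. mval (orb k u) \<mu>) = (case \<mu> of Cub l \<Rightarrow> 3 * u $ l ^ 3 | Mid \<Rightarrow> 3 * mval u Mid | _ \<Rightarrow> 0)" for u \<mu>
  proof (cases \<mu>)
    case (Up l)
    have "(\<Sum>k\<in>UNIV. mval (orb k u) \<mu>) = (1 + \<omega> + \<omega> ^ 2) * mval u (Up l)"
      unfolding Up by (simp add: sum_three mval_orb \<zeta> distrib_right del: mval.simps)
    then show ?thesis by (simp add: Up omega_sum)
  next
    case (Dn l)
    have "(\<Sum>k\<in>UNIV. mval (orb k u) \<mu>) = (1 + \<omega> + \<omega> ^ 2) * mval u (Dn l)"
      unfolding Dn by (simp add: sum_three mval_orb \<zeta> distrib_right w4 algebra_simps del: mval.simps flip: power_mult)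
    then show ?thesis by (simp add: Dn omega_sum)
  next
    case (Cub l)
    then show ?thesis using mval_orb(1)[of _ u l] by (simp add: sum_three)
  next
    case Mid
    then show ?thesis using mval_orb(4)[of _ u] by (simp add: sum_three)
  qed
  have comp: "(\<Sum>i\<in>UNIV. base_pt j i) $ (\<mu>, m, n) =
      (\<Sum>b\<in>UNIV. (\<Sum>k\<in>UNIV. mval (orb k (v b)) \<mu>) * (sdir c b $ m * tdir c b $ n)) +
      (if \<mu> = Cub (c + 1) then sfix j False $ m * tfix j False $ n
       else if \<mu> = Cub (c + 2) then sfix j True $ m * tfix j True $ n else 0)" for \<mu> m n
    using three_rotate(2-4)[of c]
    by (auto simp: base_pt conf_pt_def pt_def sum_component sum_idx mval_axis sum_distrib_left mult_ac j v_def)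
  have v: "v b $ (c + 1) ^ 3 = pcoef w b" "v b $ (c + 2) ^ 3 = pcoef (\<not> w) b"
    "v b $ c ^ 3 = (if b then -2 else 2)" "mval (v b) Mid = 1" for b
    using orbit_rep_cubes[of c w b] unfolding v_def j mid_rotate(1)[of _ c] by simp_all
  have eq: "(\<Sum>i\<in>UNIV. base_pt j i) $ (\<mu>, m, n) = base_tensor $ (\<mu>, m, n)" for \<mu> m n
  proof (cases \<mu>)
    case (Cub l)
    have "l = c \<or> l = c + 1 \<or> l = c + 2" using three_rotate(1)[of c] by blast
    then show ?thesis
    proof (elim disjE)
      assume l: "l = c"
      show ?thesis
        unfolding comp orbit Cub l mon.case v using three_rotate(2-4)[of c] exhaust_2[of m] exhaust_2[of n]
        by (cases c rule: three_cases) (auto simp: UNIV_bool sdir_def tdir_def base_tensor_def cmat_def)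
    next
      assume l: "l = c + 1"
      show ?thesis
        unfolding comp orbit Cub l mon.case v unfolding j using exhaust_2[of m] exhaust_2[of n]
        by (cases c rule: three_cases; cases w) (auto simp: UNIV_bool sdir_def tdir_def sfix_def tfix_def
            scoef_def tcoef_def pcoef_def base_tensor_def cmat_def)
    next
      assume l: "l = c + 2"
      show ?thesis
        unfolding comp orbit Cub l mon.case v unfolding j using exhaust_2[of m] exhaust_2[of n]
        by (cases c rule: three_cases; cases w) (auto simp: UNIV_bool sdir_def tdir_def sfix_def tfix_def
            scoef_def tcoef_def pcoef_def base_tensor_def cmat_def)
    qed
  next
    case Mid
    show ?thesis
      unfolding comp orbit Mid using exhaust_2[of m] exhaust_2[of n]
      by (cases c rule: three_cases) (auto simp: UNIV_bool v(4) sdir_def tdir_def base_tensor_def simp del: mval.simps)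
  qed (simp_all add: comp orbit base_tensor_def del: sum_component mval.simps)
  show ?thesis by (rule vec_eq_iff[THEN iffD2]) (use eq in \<open>auto\<close>)
qed

lemma base_lin_indep: "lin_indep (base_pt j)"
  unfolding base_pt
  by (rule conf_lin_indep[OF sdir_det tdir_det _ fix_nz]) (metis orbit_rep_cubes(5) surj_pair)

text \<open>If the omitted coordinate points differ, the one omitted by \<open>j\<close> occurs in
  \<open>j'\<close>. If they agree, both contain the coordinate point \<open>c + 1\<close>, but with
  different directions \<open>sfix\<close> for the two roots.\<close>

lemma base_distinct:
  assumes "j \<noteq> j'"
  shows "\<exists>i. lin_indep (\<lambda>x. case x of None \<Rightarrow> base_pt j' i | Some i \<Rightarrow> base_pt j i)"
proof -
  obtain c w c' w' where j: "j = (c, w)" "j' = (c', w')" by (cases j; cases j')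
  have v: "orbit_rep j b $ l \<noteq> 0" for b l using orbit_rep_cubes(5) j by metis
  note span = conf_span_fixed[where c = "fst j" and s = "sdir (fst j)" and t = "tdir (fst j)" and v = "orbit_rep j"
      and e = "sfix j" and f = "tfix j", OF sdir_det tdir_det v, folded base_pt]
  have "\<exists>i. \<forall>\<kappa>. (\<Sum>i\<in>UNIV. \<kappa> i *s base_pt j i) \<noteq> base_pt j' i"
  proof (cases "c = c'")
    case True
    then have w: "w \<noteq> w'" using assms j by auto
    have "(\<Sum>i\<in>UNIV. \<kappa> i *s base_pt j i) \<noteq> base_pt j' (Inr False)" for \<kappa>
    proof
      assume "(\<Sum>i\<in>UNIV. \<kappa> i *s base_pt j i) = base_pt j' (Inr False)"
      then have "sfix j' False $ 1 * sfix j False $ 2 = sfix j' False $ 2 * sfix j False $ 1"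
        using span(2)[OF fix_nz, of \<kappa> "c + 1" j' False j' False] True
        by (simp add: base_pt_def base_a_def base_s_def base_t_def j)
      then show False using w True
        by (cases c rule: three_cases; cases w; cases w'; simp add: j sfix_def scoef_def sdir_def)
    qed
    then show ?thesis by blast
  next
    case False
    then have "c = c' + 1 \<or> c = c' + 2" using three_rotate(1)[of c'] by blast
    then have "base_pt j' (Inr (c = c' + 2)) = pt (axis c 1) (sfix j' (c = c' + 2)) (tfix j' (c = c' + 2))"
      using three_rotate(2-4)[of c'] by (auto simp: base_pt_def base_a_def base_s_def base_t_def j)
    then obtain b where b: "base_pt j' (Inr b) = pt (axis c 1) (sfix j' b) (tfix j' b)" ..
    have "(\<Sum>i\<in>UNIV. \<kappa> i *s base_pt j i) \<noteq> base_pt j' (Inr b)" for \<kappa>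
      using span(1)[OF fix_nz, of \<kappa> c j' b j' b] b by (auto simp: j)
    then show ?thesis by blast
  qed
  then show ?thesis using lin_indep_option[OF base_lin_indep] by blast
qed

section \<open>From partially symmetric tensors to \<open>\<complex>\<^sup>3 \<otimes> \<complex>\<^sup>6 \<otimes> \<complex>\<^sup>6\<close>\<close>

text \<open>The product of three variables as a monomial, independent of their order; it lets
  \<open>w\<close> be read as an array symmetric in three indices.\<close>

definition mono3 :: "3 \<Rightarrow> 3 \<Rightarrow> 3 \<Rightarrow> mon" where
  "mono3 l m n = (if l = m then (if n = l then Cub l else if n = l + 1 then Up l else Dn l)
     else if l = n then (if m = l + 1 then Up l else Dn l)
     else if m = n then (if l = m + 1 then Up m else Dn m) else Mid)"

lemma mval_mono3: "mval a (mono3 l m n) = a $ l * a $ m * a $ n"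
  by (cases l rule: three_cases; cases m rule: three_cases; cases n rule: three_cases)
    (simp_all add: mono3_def power2_eq_square power3_eq_cube)

lemma mono3_surj: "\<exists>l m n. \<mu> = mono3 l m n"
proof (cases \<mu>)
  case (Cub l)
  then show ?thesis by (intro exI[of _ l]) (simp add: mono3_def)
next
  case (Up l)
  then show ?thesis
    by (intro exI[of _ l] exI[of _ "l + 1"]) (cases l rule: three_cases; simp add: mono3_def)
next
  case (Dn l)
  then show ?thesis
    by (intro exI[of _ l] exI[of _ "l + 2"]) (cases l rule: three_cases; simp add: mono3_def)
next
  case Mid
  then have "\<mu> = mono3 0 1 2" by (simp add: mono3_def)
  then show ?thesis by blast
qed

definition tens :: "complex ^ 2 \<Rightarrow> complex ^ 3 \<Rightarrow> complex ^ (2 \<times> 3)" where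
  "tens s a = (\<chi> y. s $ fst y * a $ snd y)"

definition act :: "(6 \<Rightarrow> 2 \<times> 3 \<Rightarrow> complex) \<Rightarrow> complex ^ (2 \<times> 3) \<Rightarrow> complex ^ 6" where
  "act M u = (\<chi> i. \<Sum>y\<in>UNIV. M i y * u $ y)"

type_synonym vspace = "complex ^ (3 \<times> 6 \<times> 6)"

text \<open>The inclusion of the partially symmetric tensors into \<complex>^3 \<otimes>
  (\<complex>^2 \<otimes> \<complex>^3) \<otimes> (\<complex>^2 \<otimes> \<complex>^3), followed by
  \<open>M\<close> and \<open>N\<close> on the last two factors.\<close>

definition big :: "(6 \<Rightarrow> 2 \<times> 3 \<Rightarrow> complex) \<Rightarrow> (6 \<Rightarrow> 2 \<times> 3 \<Rightarrow> complex) \<Rightarrow> wspace \<Rightarrow> vspace" where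
  "big M N w = (\<chi> x. \<Sum>y\<in>UNIV. \<Sum>y'\<in>UNIV. M (fst (snd x)) y * N (snd (snd x)) y' *
     w $ (mono3 (fst x) (snd y) (snd y'), fst y, fst y'))"

lemma big_add: "big M N (w + w') = big M N w + big M N w'"
  and big_scale: "big M N (c *s w) = c *s big M N w"
  by (simp_all add: big_def vec_eq_iff distrib_left sum.distrib sum_distrib_left mult_ac)

lemma big_zero: "big M N 0 = 0"
  by (simp add: big_def vec_eq_iff)

lemma big_sum: "big M N (\<Sum>i\<in>I. f i) = (\<Sum>i\<in>I. big M N (f i))"
  by (induction I rule: infinite_finite_induct) (simp_all add: big_zero big_add)

lemma big_pt: "big M N (pt a s t) = tensor3 a (act M (tens s a)) (act N (tens t a))"
proof -
  have "big M N (pt a s t) $ (l, i, k) = tensor3 a (act M (tens s a)) (act N (tens t a)) $ (l, i, k)" for l i k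
    by (simp add: big_def pt_def tensor3_def act_def tens_def mval_mono3 sum_product sum_distrib_left mult_ac)
  then show ?thesis by (auto simp: vec_eq_iff)
qed

definition ident6 :: "2 \<times> 3 \<Rightarrow> 6" where
  "ident6 = (SOME \<pi>. bij \<pi>)"

lemma bij_ident6: "bij ident6"
proof -
  have "\<exists>\<pi> :: 2 \<times> 3 \<Rightarrow> 6. bij \<pi>"
    using finite_same_card_bij[of "UNIV :: (2 \<times> 3) set" "UNIV :: 6 set"] by simp
  then show ?thesis unfolding ident6_def by (rule someI_ex)
qed

definition perm6 :: "6 \<Rightarrow> 2 \<times> 3 \<Rightarrow> complex" where
  "perm6 i y = (if i = ident6 y then 1 else 0)"

lemma big_perm6_inj:
  assumes "big perm6 perm6 w = 0"
  shows "w = 0"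
proof -
  have inj: "ident6 y = ident6 y' \<longleftrightarrow> y = y'" for y y'
    using bij_ident6 by (meson bij_def inj_eq)
  have "w $ (\<mu>, j, j') = 0" for \<mu> j j'
  proof -
    obtain l m n where \<mu>: "\<mu> = mono3 l m n" using mono3_surj by blast
    have "0 = big perm6 perm6 w $ (l, ident6 (j, m), ident6 (j', n))" using assms by simp
    also have "\<dots> = w $ (\<mu>, j, j')"
    proof -
      have delta: "(\<Sum>y\<in>UNIV. perm6 (ident6 p) y * f y) = f p" for p f
        by (simp add: perm6_def inj if_distrib[of "\<lambda>x. x * _"] cong: if_cong)
      show ?thesis
        by (simp add: big_def mult.assoc delta \<mu> flip: sum_distrib_left)
    qed
    finally show ?thesis by simp
  qed
  then show ?thesis by (auto simp: vec_eq_iff)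
qed

lemma lin_indep_big:
  assumes "lin_indep T"
  shows "lin_indep (\<lambda>x. big perm6 perm6 (T x))"
  unfolding lin_indep_def
proof (intro allI impI)
  fix c s assume "(\<Sum>s\<in>UNIV. c s *s big perm6 perm6 (T s)) = 0"
  then have "big perm6 perm6 (\<Sum>s\<in>UNIV. c s *s T s) = 0" by (simp add: big_sum big_scale)
  then have "(\<Sum>s\<in>UNIV. c s *s T s) = 0" by (rule big_perm6_inj)
  then show "c s = 0" by (rule assms[unfolded lin_indep_def, rule_format])
qed

section \<open>Density of the normal form\<close>

text \<open>At the point of the normal form given by \<open>a0\<close>, \<open>s0\<close> and the identity matrix, \<open>sol_s\<close> and \<open>sol_g\<close>
  solve the linearised equations for prescribed tangent vectors \<open>r\<close>.\<close>

definition a0 :: "idx \<Rightarrow> complex ^ 3" where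
  "a0 = case_sum (\<lambda>(b, k). axis k 1) (\<lambda>b. \<chi> l. 1)"

definition two :: "bool \<Rightarrow> 2" where "two b = (if b then 2 else 1)"

definition s0 :: "idx \<Rightarrow> complex ^ 2" where
  "s0 = case_sum (\<lambda>(b, k). axis (two b) 1) (\<lambda>b. axis (two b) 1)"

definition sol_s :: "(idx \<Rightarrow> 2 \<times> 3 \<Rightarrow> complex) \<Rightarrow> idx \<Rightarrow> complex ^ 2" where
  "sol_s r = case_sum (\<lambda>(b, k). \<chi> j. (\<Sum>k'\<in>UNIV. r (Inl (b, k')) (j, k)) - r (Inr b) (j, k)) (\<lambda>b. 0)"

definition sol_g :: "(idx \<Rightarrow> 2 \<times> 3 \<Rightarrow> complex) \<Rightarrow> 2 \<times> 3 \<Rightarrow> 2 \<times> 3 \<Rightarrow> complex" where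
  "sol_g r y' y = r (Inl (fst y = 2, snd y)) y' -
     (if snd y' = snd y then sol_s r (Inl (fst y = 2, snd y)) $ fst y' else 0)"

lemma two_eq: "(two b = 2) = b" by (simp add: two_def)

text \<open>48 equations for 36 entries of \<open>sol_g\<close> and 12 of \<open>sol_s\<close>. The
  six \<open>Inl\<close> points give the standard basis of \<complex>^2 \<otimes> \<complex>^3, so
  there \<open>sol_g\<close> can absorb any error. Each \<open>Inr\<close> point gives the sum of
  three of these basis vectors, and its equation is met by adjusting \<open>sol_s\<close> at the
  \<open>Inl\<close> points.\<close>

lemma sol_correct:
  "(\<Sum>y\<in>UNIV. sol_g r y' y * tens (s0 i) (a0 i) $ y) + tens (sol_s r i) (a0 i) $ y' = r i y'"
proof -
  obtain j k where y': "y' = (j, k)" by (cases y')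
  have sum: "(\<Sum>y\<in>UNIV. f (y :: 2 \<times> 3)) = (\<Sum>j\<in>UNIV. \<Sum>k\<in>UNIV. f (j, k))" for f :: "_ \<Rightarrow> complex"
    by (simp add: UNIV_Times_UNIV[symmetric] sum.cartesian_product del: UNIV_Times_UNIV)
  show ?thesis
  proof (cases i)
    case (Inl x)
    then show ?thesis
      by (cases x) (simp add: sum tens_def s0_def a0_def axis_def sol_g_def two_eq y'
          if_distrib[of "\<lambda>x. _ * x"] cong: if_cong)
  next
    case (Inr b)
    have "(\<Sum>y\<in>UNIV. sol_g r y' y * tens (s0 i) (a0 i) $ y) = (\<Sum>k'\<in>UNIV. sol_g r y' (two b, k'))"
    proof -
      have "(\<Sum>y\<in>UNIV. sol_g r y' y * tens (s0 i) (a0 i) $ y) =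
          (\<Sum>j\<in>UNIV. (\<Sum>k'\<in>UNIV. sol_g r y' (j, k')) * (if j = two b then 1 else 0))"
        by (simp add: Inr sum tens_def s0_def a0_def axis_def sum_distrib_right)
      then show ?thesis by (simp add: if_distrib[of "\<lambda>x. _ * x"] cong: if_cong)
    qed
    also have "\<dots> = r i y'"
      by (simp add: sol_g_def two_eq sum_subtractf y' sol_s_def Inr)
    finally show ?thesis by (simp add: Inr sol_s_def tens_def)
  qed
qed

lemma sol_s_linear: "sol_s (\<lambda>i y. z * r i y) i = z *s sol_s r i"
  by (cases i) (auto simp: sol_s_def vec_eq_iff sum_distrib_left algebra_simps)

lemma sol_g_linear: "sol_g (\<lambda>i y. z * r i y) y' y = z * sol_g r y' y"
  by (simp add: sol_g_def sol_s_linear algebra_simps)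

section \<open>Parameters of eight simple tensors\<close>

definition pack3 :: "('i::finite \<Rightarrow> complex ^ 3) \<Rightarrow> ('i \<Rightarrow> complex ^ 6) \<Rightarrow> ('i \<Rightarrow> complex ^ 6) \<Rightarrow>
    complex ^ ('i \<times> (3 + 6 + 6))" where
  "pack3 a b c = (\<chi> x. case snd x of Inl l \<Rightarrow> a (fst x) $ l | Inr (Inl n) \<Rightarrow> b (fst x) $ n | Inr (Inr n) \<Rightarrow> c (fst x) $ n)"

definition part1 where "part1 y i = (\<chi> l. y $ (i, Inl l))"
definition part2 where "part2 y i = (\<chi> n. y $ (i, Inr (Inl n)))"
definition part3 where "part3 y i = (\<chi> n. y $ (i, Inr (Inr n)))"

lemma parts_pack3 [simp]: "part1 (pack3 a b c) i = a i" "part2 (pack3 a b c) i = b i" "part3 (pack3 a b c) i = c i"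
  by (simp_all add: part1_def part2_def part3_def pack3_def)

definition unpack :: "complex ^ ('i::finite \<times> (3 + 6 + 6)) \<Rightarrow> 'i \<Rightarrow> vspace" where
  "unpack y i = tensor3 (part1 y i) (part2 y i) (part3 y i)"

lemma polyf_unpack: "polyf (\<lambda>y. unpack y i $ x)"
  by (cases x) (simp add: unpack_def tensor3_def part1_def part2_def part3_def polyf.mult polyf.coord)

text \<open>Perturbing \<open>a\<close>, the two matrices and the vectors of \<complex>^2 around the
  base point reaches an open set of eightfold families. \<open>M\<close>, \<open>S\<close> and
  \<open>A\<close> depend on \<open>q\<close> through the linear solution, so that \<open>F\<close>
  has the identity as derivative at 0.\<close>

lemma normal_form_open:
  obtains V :: "(complex ^ (idx \<times> (3 + 6 + 6))) set" where "open V" "V \<noteq> {}"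
    "\<And>y. y \<in> V \<Longrightarrow> \<exists>M N w. (\<Sum>i\<in>UNIV. unpack y i) = big M N w"
proof -
  define \<pi>' where "\<pi>' = inv ident6"
  have \<pi>: "ident6 (\<pi>' n) = n" for n
    unfolding \<pi>'_def by (simp add: bij_ident6 bij_is_surj surj_f_inv_f)
  \<comment> \<open>Moving \<open>a\<close> already moves \<open>s \<otimes> a\<close>; this part is
    subtracted from the prescribed velocity, and the rest is left to \<open>sol_s\<close> and
    \<open>sol_g\<close>.\<close>
  define rb where "rb q i y = q $ (i, Inr (Inl (ident6 y))) - tens (s0 i) (part1 q i) $ y" for q :: "complex ^ (idx \<times> (3 + 6 + 6))" and i y
  define rc where "rc q i y = q $ (i, Inr (Inr (ident6 y))) - tens (s0 i) (part1 q i) $ y" for q :: "complex ^ (idx \<times> (3 + 6 + 6))" and i y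
  define A where "A q i = a0 i + part1 q i" for q :: "complex ^ (idx \<times> (3 + 6 + 6))" and i
  define S where "S r i = s0 i + sol_s r i" for r i
  define M where "M r n y = (if \<pi>' n = y then 1 else 0) + sol_g r (\<pi>' n) y" for r n y
  define F where "F q = pack3 (A q) (\<lambda>i. act (M (rb q)) (tens (S (rb q) i) (A q i)))
      (\<lambda>i. act (M (rc q)) (tens (S (rc q) i) (A q i)))" for q
  have pA: "polyf (\<lambda>q. A q i $ l)" for i l
    by (simp add: A_def part1_def polyf.add polyf.const polyf.coord)
  have prb: "polyf (\<lambda>q. rb q i y)" and prc: "polyf (\<lambda>q. rc q i y)" for i y
    by (simp_all add: rb_def rc_def tens_def part1_def polyf_diff polyf.coord polyf.mult polyf.const)
  have pact: "polyf (\<lambda>q. act (M (r q)) (tens (S (r q) i) (A q i)) $ n)"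
    if r: "\<And>i y. polyf (\<lambda>q. r q i y)" for r :: "_ \<Rightarrow> idx \<Rightarrow> 2 \<times> 3 \<Rightarrow> complex" and i n
  proof -
    have s: "polyf (\<lambda>q. sol_s (r q) i $ j)" for i j
      by (cases i) (auto simp: sol_s_def intro!: polyf_diff polyf_sum r polyf.const)
    then have "polyf (\<lambda>q. sol_g (r q) y' y)" for y' y
      by (cases "snd y' = snd y") (simp_all add: sol_g_def polyf_diff r)
    then show ?thesis
      using s by (simp add: act_def M_def S_def tens_def polyf_sum polyf.mult polyf.add polyf.const pA)
  qed
  have pF: "polyf (\<lambda>q. F q $ x)" for x
  proof -
    obtain i k where "x = (i, k)" by (cases x)
    consider l where "k = Inl l" | n where "k = Inr (Inl n)" | n where "k = Inr (Inr n)"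
      by (metis sum.exhaust)
    then show ?thesis
      using \<open>x = (i, k)\<close> by cases (simp_all add: F_def pack3_def pA pact prb prc)
  qed
  have tens_diff: "tens s (z *s a) = z *s tens s a" for s z a by (simp add: tens_def vec_eq_iff)
  have part1_scale: "part1 (z *s h) i = z *s part1 h i" for z h i by (simp add: part1_def vec_eq_iff)
  have lin: "rb (z *s h) = (\<lambda>i y. z * rb h i y)" "rc (z *s h) = (\<lambda>i y. z * rc h i y)" for z h
    by (simp_all add: rb_def rc_def fun_eq_iff part1_scale tens_diff algebra_simps)
  have dact: "((\<lambda>z. act (M (\<lambda>i y. z * r i y)) (tens (S (\<lambda>i y. z * r i y) i) (A (z *s h) i)) $ n) has_field_derivative
      r i (\<pi>' n) + tens (s0 i) (part1 h i) $ \<pi>' n) (at 0)" for r h i n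
  proof -
    have "((\<lambda>z. act (M (\<lambda>i y. z * r i y)) (tens (S (\<lambda>i y. z * r i y) i) (A (z *s h) i)) $ n) has_field_derivative
      (\<Sum>y\<in>UNIV. sol_g r (\<pi>' n) y * tens (s0 i) (a0 i) $ y + (if \<pi>' n = y then 1 else 0) *
        (tens (sol_s r i) (a0 i) $ y + tens (s0 i) (part1 h i) $ y))) (at 0)"
      unfolding act_def M_def S_def A_def sol_s_linear sol_g_linear part1_scale tens_def
      by (auto intro!: derivative_eq_intros simp: algebra_simps)
    also have "(\<Sum>y\<in>UNIV. sol_g r (\<pi>' n) y * tens (s0 i) (a0 i) $ y + (if \<pi>' n = y then 1 else 0) *
        (tens (sol_s r i) (a0 i) $ y + tens (s0 i) (part1 h i) $ y)) = r i (\<pi>' n) + tens (s0 i) (part1 h i) $ \<pi>' n"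
      using sol_correct[of r "\<pi>' n" i]
      by (simp add: sum.distrib if_distrib[of "\<lambda>x. x * _"] add.assoc[symmetric] cong: if_cong)
    finally show ?thesis .
  qed
  have dF: "((\<lambda>z. F (0 + z *s h) $ x) has_field_derivative h $ x) (at 0)" for h x
  proof -
    obtain i k where x: "x = (i, k)" by (cases x)
    consider l where "k = Inl l" | n where "k = Inr (Inl n)" | n where "k = Inr (Inr n)"
      by (metis sum.exhaust)
    then show ?thesis
    proof cases
      case 1
      have "(\<lambda>z. F (0 + z *s h) $ x) = (\<lambda>z. a0 i $ l + z * h $ x)"
        by (simp add: F_def pack3_def x 1 A_def part1_def)
      then show ?thesis by (auto intro!: derivative_eq_intros)
    next
      case (2 n)
      then show ?thesis using dact[of "rb h" i h n] by (simp add: F_def pack3_def x lin rb_def \<pi>)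
    next
      case (3 n)
      then show ?thesis using dact[of "rc h" i h n] by (simp add: F_def pack3_def x lin rc_def \<pi>)
    qed
  qed
  obtain V g where V: "open V" "F 0 \<in> V" "\<And>y. y \<in> V \<Longrightarrow> F (g y) = y"
    by (rule polyf_local_inverse[of F 0, OF pF dF]) blast
  show ?thesis
  proof (rule that[OF V(1)])
    show "V \<noteq> {}" using V(2) by blast
    fix y assume "y \<in> V"
    then have y: "y = F (g y)" using V(3) by simp
    let ?q = "g y"
    have "(\<Sum>i\<in>UNIV. unpack y i) = (\<Sum>i\<in>UNIV. unpack (F ?q) i)" using y by simp
    also have "\<dots> = big (M (rb ?q)) (M (rc ?q)) (\<Sum>i\<in>UNIV. pt (A ?q i) (S (rb ?q) i) (S (rc ?q) i))"
      by (simp add: big_sum big_pt F_def unpack_def)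
    finally show "\<exists>M N w. (\<Sum>i\<in>UNIV. unpack y i) = big M N w" by blast
  qed
qed

lemma normal_form_dense:
  fixes y :: "complex ^ (idx \<times> (3 + 6 + 6))"
  assumes P: "polyf P" and zero: "\<And>M N w. P (big M N w) = 0"
  shows "P (\<Sum>i\<in>UNIV. unpack y i) = 0"
proof -
  obtain V :: "(complex ^ (idx \<times> (3 + 6 + 6))) set" where V: "open V" "V \<noteq> {}"
    "\<And>y. y \<in> V \<Longrightarrow> \<exists>M N w. (\<Sum>i\<in>UNIV. unpack y i) = big M N w" by (rule normal_form_open) blast
  have "polyf (\<lambda>y. P (\<Sum>i\<in>UNIV. unpack y i))"
    by (rule polyf_compose[OF P]) (simp add: polyf_sum polyf_unpack)
  moreover obtain y0 where "y0 \<in> V" using V(2) by blast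
  moreover have "P (\<Sum>i\<in>UNIV. unpack y i) = 0" if "y \<in> V" for y using V(3)[OF that] zero by auto
  ultimately show ?thesis using polyf_zero_open[OF _ V(1)] by blast
qed

section \<open>Six decompositions of the general tensor\<close>

type_synonym par = "(6 \<times> 2 \<times> 3) + (6 \<times> 2 \<times> 3) + (mon \<times> 2 \<times> 2)"

definition mat1 where "mat1 x i y = (x :: complex ^ par) $ Inl (i, y)"
definition mat2 where "mat2 x i y = (x :: complex ^ par) $ Inr (Inl (i, y))"
definition wpart where "wpart x = (\<chi> y. (x :: complex ^ par) $ Inr (Inr y))"

lemma par_surj: obtains x where "mat1 x = M" "mat2 x = N" "wpart x = w"
proof
  let ?x = "\<chi> i. case i of Inl p \<Rightarrow> M (fst p) (snd p) | Inr (Inl p) \<Rightarrow> N (fst p) (snd p) | Inr (Inr y) \<Rightarrow> w $ y"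
  show "mat1 ?x = M" "mat2 ?x = N" "wpart ?x = w"
    by (simp_all add: mat1_def mat2_def wpart_def fun_eq_iff)
qed

definition bigG :: "complex ^ par \<Rightarrow> vspace" where
  "bigG x = big (mat1 x) (mat2 x) (wpart x)"

lemma polyf_bigG: "polyf (\<lambda>x. bigG x $ k)"
  by (simp add: bigG_def big_def mat1_def mat2_def wpart_def polyf_sum polyf.mult polyf.coord)

text \<open>Rank at most eight, zero summands and zero sum included: the affine cone over the secant
  variety before taking closure.\<close>

definition rank8 :: "vspace set" where
  "rank8 = range (\<lambda>y :: complex ^ (idx \<times> (3 + 6 + 6)). \<Sum>i\<in>UNIV. unpack y i)"

lemma tensor3_scale: "c *s tensor3 a b d = tensor3 (c *s a) b d"
  by (auto simp: tensor3_def vec_eq_iff)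

lemma rank8I: "(\<Sum>i\<in>(UNIV :: idx set). tensor3 (a i) (b i) (c i)) \<in> rank8"
proof -
  have "(\<Sum>i\<in>(UNIV :: idx set). tensor3 (a i) (b i) (c i)) = (\<Sum>i\<in>UNIV. unpack (pack3 a b c) i)"
    by (simp add: unpack_def)
  then show ?thesis unfolding rank8_def by blast
qed

lemma rank8_scale:
  assumes "v \<in> rank8"
  shows "c *s v \<in> rank8"
proof -
  obtain y :: "complex ^ (idx \<times> (3 + 6 + 6))" where v: "v = (\<Sum>i\<in>UNIV. unpack y i)"
    using assms unfolding rank8_def by blast
  show ?thesis unfolding v unpack_def vec.scale_sum_right tensor3_scale by (rule rank8I)
qed

text \<open>The identity principle enlarges \<Omega> to all parameters, and density of the normal
  form then reaches every sum of eight simple tensors.\<close>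

lemma bigG_dense:
  assumes P: "polyf P" and \<Omega>: "open \<Omega>" "x0 \<in> \<Omega>" "\<And>x. x \<in> \<Omega> \<Longrightarrow> P (bigG x) = 0" and v: "v \<in> rank8"
  shows "P v = 0"
proof -
  have "polyf (\<lambda>x. P (bigG x))" by (rule polyf_compose[OF P polyf_bigG])
  then have "P (bigG x) = 0" for x by (rule polyf_zero_open[OF _ \<Omega>])
  then have "P (big M N w) = 0" for M N w by (metis bigG_def par_surj)
  then show ?thesis using v normal_form_dense[OF P] unfolding rank8_def by blast
qed

text \<open>Independence of the nine vectors says that the summands of the \<open>j\<close>-th expression are independent and
  that some summand of the \<open>j'\<close>-th one lies outside their span.\<close>

definition six_expressions :: "vspace \<Rightarrow> (3 \<times> bool \<Rightarrow> idx \<Rightarrow> vspace) \<Rightarrow> bool" where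
  "six_expressions q T \<longleftrightarrow> (\<forall>j. (\<Sum>i\<in>UNIV. T j i) = q) \<and> (\<forall>j i. \<exists>a b c. T j i = tensor3 a b c) \<and>
     (\<forall>j j'. j \<noteq> j' \<longrightarrow> (\<exists>i0. lin_indep (\<lambda>s. case s of None \<Rightarrow> T j' i0 | Some i \<Rightarrow> T j i)))"

text \<open>\<open>generic_specialization\<close> is applied with \<open>bigG\<close> as the tensor
  and \<open>e\<close> as its six decompositions, pushed forward by \<open>big\<close>; a product of
  minors is the quantity that must stay nonzero.\<close>

theorem general_six_expressions:
  obtains \<Omega> :: "(complex ^ par) set" and x0 x1 and A :: "vspace \<Rightarrow> complex"
  where "open \<Omega>" "convex \<Omega>" "x0 \<in> \<Omega>" "\<And>x. x \<in> \<Omega> \<Longrightarrow> bigG x \<in> rank8"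
    "polyf A" "x1 \<in> \<Omega>" "A (bigG x1) \<noteq> 0"
    "\<And>q. (\<And>P. polyf P \<Longrightarrow> (\<And>v. v \<in> rank8 \<Longrightarrow> P v = 0) \<Longrightarrow> P q = 0) \<Longrightarrow> A q \<noteq> 0 \<Longrightarrow> \<exists>T. six_expressions q T"
proof -
  have "\<forall>j. \<exists>V \<alpha> \<sigma> \<tau>. open V \<and> base_tensor \<in> V \<and>
      \<alpha> base_tensor = base_a j \<and> \<sigma> base_tensor = base_s j \<and> \<tau> base_tensor = base_t j \<and>
      (\<forall>w\<in>V. (\<Sum>i\<in>UNIV. pt (\<alpha> w i) (\<sigma> w i) (\<tau> w i)) = w) \<and>
      (\<forall>i l. line_hol V (\<lambda>w. \<alpha> w i $ l)) \<and> (\<forall>i l. line_hol V (\<lambda>w. \<sigma> w i $ l)) \<and> (\<forall>i l. line_hol V (\<lambda>w. \<tau> w i $ l))"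
    (is "\<forall>j. \<exists>V \<alpha> \<sigma> \<tau>. ?P j V \<alpha> \<sigma> \<tau>")
  proof
    fix j
    have w0: "base_tensor = (\<Sum>i\<in>UNIV. pt (base_a j i) (base_s j i) (base_t j i))"
      using base_sum[of j] by (simp add: base_pt_def)
    obtain V \<alpha> \<sigma> \<tau> where "open V" "base_tensor \<in> V" "\<alpha> base_tensor = base_a j" "\<sigma> base_tensor = base_s j"
      "\<tau> base_tensor = base_t j" "\<And>w. w \<in> V \<Longrightarrow> (\<Sum>i\<in>UNIV. pt (\<alpha> w i) (\<sigma> w i) (\<tau> w i)) = w"
      "\<And>i l. line_hol V (\<lambda>w. \<alpha> w i $ l)" "\<And>i l. line_hol V (\<lambda>w. \<sigma> w i $ l)" "\<And>i l. line_hol V (\<lambda>w. \<tau> w i $ l)"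
      by (rule local_decomposition[OF base_tangents_span[of j] w0]) blast
    then have "?P j V \<alpha> \<sigma> \<tau>" by blast
    then show "\<exists>V \<alpha> \<sigma> \<tau>. ?P j V \<alpha> \<sigma> \<tau>" by blast
  qed
  from choice[OF this] obtain V where "\<forall>j. \<exists>\<alpha> \<sigma> \<tau>. ?P j (V j) \<alpha> \<sigma> \<tau>" by blast
  from choice[OF this] obtain \<alpha> where "\<forall>j. \<exists>\<sigma> \<tau>. ?P j (V j) (\<alpha> j) \<sigma> \<tau>" by blast
  from choice[OF this] obtain \<sigma> where "\<forall>j. \<exists>\<tau>. ?P j (V j) (\<alpha> j) (\<sigma> j) \<tau>" by blast
  from choice[OF this] obtain \<tau> where all: "\<forall>j. ?P j (V j) (\<alpha> j) (\<sigma> j) (\<tau> j)" by blast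
  have V: "open (V j)" "base_tensor \<in> V j"
    and at_base: "\<alpha> j base_tensor = base_a j" "\<sigma> j base_tensor = base_s j" "\<tau> j base_tensor = base_t j"
    and sum: "w \<in> V j \<Longrightarrow> (\<Sum>i\<in>UNIV. pt (\<alpha> j w i) (\<sigma> j w i) (\<tau> j w i)) = w"
    and hol: "line_hol (V j) (\<lambda>w. \<alpha> j w i $ l)" "line_hol (V j) (\<lambda>w. \<sigma> j w i $ m)" "line_hol (V j) (\<lambda>w. \<tau> j w i $ m)"
    for j w i l m using all by blast+
  have wpart_lin: "wpart (x + z *s v) = wpart x + z *s wpart v" for x z v
    by (simp add: wpart_def vec_eq_iff)
  define W where "W = (\<Inter>j. V j)"
  have "open W" unfolding W_def using V by (intro open_INT) auto
  moreover have "continuous_on UNIV wpart"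
    unfolding wpart_def by (intro continuous_intros)
  ultimately have openW: "open (wpart -` W)" by (rule open_vimage)
  obtain x0 where x0: "mat1 x0 = perm6" "mat2 x0 = perm6" "wpart x0 = base_tensor" by (rule par_surj)
  have "x0 \<in> wpart -` W" using V by (simp add: x0 W_def)
  \<comment> \<open>A ball is taken because absence of zero divisors was shown on convex
    domains.\<close>
  then obtain r where r: "r > 0" "ball x0 r \<subseteq> wpart -` W" using openW openE by blast
  define \<Omega> where "\<Omega> = ball x0 r"
  have \<Omega>: "open \<Omega>" "convex \<Omega>" "x0 \<in> \<Omega>" using r by (auto simp: \<Omega>_def)
  have \<Omega>V: "wpart x \<in> V j" if "x \<in> \<Omega>" for x j
  proof -
    have "wpart x \<in> W" using that r(2) unfolding \<Omega>_def by blast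
    then show ?thesis unfolding W_def by blast
  qed
  have line: "line_hol \<Omega> (\<lambda>x. f (wpart x))" if "line_hol (V j) f" for f j
    using that \<Omega>V unfolding line_hol_def wpart_lin by blast
  define e :: "complex ^ par \<Rightarrow> complex ^ ((3 \<times> bool) \<times> idx \<times> (3 + 6 + 6))" where
    "e x = (\<chi> k. pack3 (\<alpha> (fst k) (wpart x)) (\<lambda>i. act (mat1 x) (tens (\<sigma> (fst k) (wpart x) i) (\<alpha> (fst k) (wpart x) i)))
       (\<lambda>i. act (mat2 x) (tens (\<tau> (fst k) (wpart x) i) (\<alpha> (fst k) (wpart x) i))) $ snd k)" for x
  define slice :: "complex ^ ((3 \<times> bool) \<times> idx \<times> (3 + 6 + 6)) \<Rightarrow> 3 \<times> bool \<Rightarrow> complex ^ (idx \<times> (3 + 6 + 6))" where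
    "slice y j = (\<chi> k. y $ (j, k))" for y j
  have slice_e: "unpack (slice (e x) j) i = big (mat1 x) (mat2 x) (pt (\<alpha> j (wpart x) i) (\<sigma> j (wpart x) i) (\<tau> j (wpart x) i))" for x j i
  proof -
    have "slice (e x) j = pack3 (\<alpha> j (wpart x)) (\<lambda>i. act (mat1 x) (tens (\<sigma> j (wpart x) i) (\<alpha> j (wpart x) i)))
       (\<lambda>i. act (mat2 x) (tens (\<tau> j (wpart x) i) (\<alpha> j (wpart x) i)))"
      by (simp add: slice_def e_def vec_eq_iff)
    then show ?thesis by (simp add: unpack_def big_pt)
  qed
  have e_sum: "(\<Sum>i\<in>UNIV. unpack (slice (e x) j) i) = bigG x" if "x \<in> \<Omega>" for x j
    unfolding slice_e big_sum[symmetric] sum[OF \<Omega>V[OF that]] bigG_def ..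
  have ehol: "line_hol \<Omega> (\<lambda>x. e x $ k)" for k
  proof -
    obtain j i y where k: "k = (j, i, y)" by (metis prod_cases3)
    have act: "line_hol \<Omega> (\<lambda>x. act (m x) (tens (s x) (\<alpha> j (wpart x) i)) $ n)"
      if "\<And>n y. line_hol \<Omega> (\<lambda>x. m x n y)" "\<And>n. line_hol \<Omega> (\<lambda>x. s x $ n)" for m s n
      using that line[OF hol(1)] by (simp add: act_def tens_def line_hol_sum line_hol_mult)
    consider l where "y = Inl l" | n where "y = Inr (Inl n)" | n where "y = Inr (Inr n)"
      by (metis sum.exhaust)
    then show ?thesis
    proof cases
      case 1
      then show ?thesis using line[OF hol(1)] by (simp add: e_def pack3_def k)
    next
      case 2
      have "line_hol \<Omega> (\<lambda>x. mat1 x n y)" for n y by (simp add: mat1_def line_hol_coord)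
      then show ?thesis using act[OF _ line[OF hol(2)]] 2 by (simp add: e_def pack3_def k)
    next
      case 3
      have "line_hol \<Omega> (\<lambda>x. mat2 x n y)" for n y by (simp add: mat2_def line_hol_coord)
      then show ?thesis using act[OF _ line[OF hol(3)]] 3 by (simp add: e_def pack3_def k)
    qed
  qed
  have slice_x0: "unpack (slice (e x0) j) i = big perm6 perm6 (base_pt j i)" for j i
    by (simp add: slice_e x0 at_base base_pt_def)
  \<comment> \<open>The implication makes the statement total on pairs of indices, so that choice
    applies directly.\<close>
  have "\<forall>p. \<exists>i \<Lambda>. fst p \<noteq> snd p \<longrightarrow> det (\<chi> r s. \<Sum>t\<in>UNIV. \<Lambda> r t *
      (case s of None \<Rightarrow> unpack (slice (e x0) (snd p)) i | Some i \<Rightarrow> unpack (slice (e x0) (fst p)) i) $ t) \<noteq> 0"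
    (is "\<forall>p. \<exists>i \<Lambda>. fst p \<noteq> snd p \<longrightarrow> ?D p i \<Lambda>")
  proof
    fix p :: "(3 \<times> bool) \<times> (3 \<times> bool)"
    show "\<exists>i \<Lambda>. fst p \<noteq> snd p \<longrightarrow> ?D p i \<Lambda>"
    proof (cases "fst p = snd p")
      case False
      from base_distinct[OF this] obtain i where
        "lin_indep (\<lambda>x. case x of None \<Rightarrow> base_pt (snd p) i | Some i \<Rightarrow> base_pt (fst p) i)" ..
      from lin_indep_big[OF this] have
        "lin_indep (\<lambda>s. case s of None \<Rightarrow> unpack (slice (e x0) (snd p)) i | Some i \<Rightarrow> unpack (slice (e x0) (fst p)) i)"
        unfolding slice_x0 by (simp add: option.case_distrib[of "big perm6 perm6"])
      from lin_indep_minor[OF this] show ?thesis by blast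
    qed blast
  qed
  from choice[OF this] obtain i0 where "\<forall>p. \<exists>\<Lambda>. fst p \<noteq> snd p \<longrightarrow> ?D p (i0 p) \<Lambda>" by blast
  from choice[OF this] obtain \<Lambda> where D: "\<And>p. fst p \<noteq> snd p \<Longrightarrow> ?D p (i0 p) (\<Lambda> p)" by blast
  define minor where "minor p y = det (\<chi> r s. \<Sum>t\<in>UNIV. \<Lambda> p r t *
      (case s of None \<Rightarrow> unpack (slice y (snd p)) (i0 p) | Some i \<Rightarrow> unpack (slice y (fst p)) i) $ t)" for p y
  \<comment> \<open>One polynomial for all 30 ordered pairs of distinct decompositions; each factor
    is nonzero at \<open>x0\<close> by the choice of \<Lambda>.\<close>
  define B where "B y = (\<Prod>p\<in>{p. fst p \<noteq> snd p}. minor p y)" for y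
  have slice_poly: "polyf (\<lambda>y. unpack (slice y j) i $ t)" for j i t
    by (rule polyf_compose[OF polyf_unpack]) (simp add: slice_def polyf.coord)
  have case_poly: "polyf (\<lambda>y. (case s of None \<Rightarrow> unpack (slice y j') i | Some i \<Rightarrow> unpack (slice y j) i) $ t)" for s j j' i t
    by (cases s) (simp_all add: slice_poly)
  have pB: "polyf B"
    unfolding B_def minor_def
    by (intro polyf_prod polyf_det polyf_sum polyf.mult polyf.const) (rule case_poly)
  have B0: "B (e x0) \<noteq> 0" using D by (simp add: B_def minor_def)
  have Ghol: "line_hol \<Omega> (\<lambda>x. bigG x $ k)" for k
    using line_hol_polyf[OF polyf_bigG, of \<Omega> "\<lambda>x. x"] by (simp add: line_hol_coord)
  obtain A x1 where A: "polyf A" "x1 \<in> \<Omega>" "A (bigG x1) \<noteq> 0"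
    "\<And>q. (\<And>P. polyf P \<Longrightarrow> (\<And>x. x \<in> \<Omega> \<Longrightarrow> P (bigG x) = 0) \<Longrightarrow> P q = 0) \<Longrightarrow> A q \<noteq> 0 \<Longrightarrow>
      \<exists>y. B y \<noteq> 0 \<and> (\<forall>Q P. polyf Q \<and> polyf P \<and> (\<forall>x\<in>\<Omega>. Q (e x) = P (bigG x)) \<longrightarrow> Q y = P q)"
    by (rule generic_specialization[OF \<Omega> Ghol ehol pB B0]) blast
  show ?thesis
  proof (rule that[OF \<Omega> _ A(1-3)])
    show "bigG x \<in> rank8" if "x \<in> \<Omega>" for x
      unfolding e_sum[OF that, of undefined, symmetric] unpack_def by (rule rank8I)
    fix q
    assume q: "\<And>P. polyf P \<Longrightarrow> (\<And>v. v \<in> rank8 \<Longrightarrow> P v = 0) \<Longrightarrow> P q = 0" and Aq: "A q \<noteq> 0"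
    have "\<exists>y. B y \<noteq> 0 \<and> (\<forall>Q P. polyf Q \<and> polyf P \<and> (\<forall>x\<in>\<Omega>. Q (e x) = P (bigG x)) \<longrightarrow> Q y = P q)"
    proof (rule A(4)[OF _ Aq])
      fix P assume P: "polyf P" "\<And>x. x \<in> \<Omega> \<Longrightarrow> P (bigG x) = 0"
      show "P q = 0"
        by (rule q[OF P(1)], rule bigG_dense[OF P(1) \<Omega>(1,3) P(2)])
    qed
    then obtain y where y: "B y \<noteq> 0"
      "\<And>Q P. polyf Q \<Longrightarrow> polyf P \<Longrightarrow> (\<And>x. x \<in> \<Omega> \<Longrightarrow> Q (e x) = P (bigG x)) \<Longrightarrow> Q y = P q" by blast
    \<comment> \<open>Each coordinate of \<open>e_sum\<close> is a polynomial identity between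
      \<open>e\<close> and \<open>bigG\<close>, so it passes to \<open>y\<close> and
      \<open>q\<close>.\<close>
    have comp: "(\<Sum>i\<in>UNIV. unpack (slice y j) i) $ k = q $ k" for j k
    proof (rule y(2)[of "\<lambda>y. (\<Sum>i\<in>UNIV. unpack (slice y j) i) $ k" "\<lambda>v. v $ k"])
      show "polyf (\<lambda>y. (\<Sum>i\<in>UNIV. unpack (slice y j) i) $ k)" by (simp add: polyf_sum slice_poly)
      show "(\<Sum>i\<in>UNIV. unpack (slice (e x) j) i) $ k = bigG x $ k" if "x \<in> \<Omega>" for x
        unfolding e_sum[OF that] ..
    qed (rule polyf.coord)
    then have sumq: "(\<Sum>i\<in>UNIV. unpack (slice y j) i) = q" for j by (simp only: vec_eq_iff) blast
    have ind: "lin_indep (\<lambda>s. case s of None \<Rightarrow> unpack (slice y j') (i0 (j, j')) | Some i \<Rightarrow> unpack (slice y j) i)"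
      if "j \<noteq> j'" for j j'
    proof -
      have "minor p y \<noteq> 0" if "fst p \<noteq> snd p" for p
        using y(1) that unfolding B_def prod_zero_iff[OF finite] by blast
      from this[of "(j, j')"] have "minor (j, j') y \<noteq> 0" using that by simp
      then show ?thesis unfolding minor_def fst_conv snd_conv by (rule minor_lin_indep)
    qed
    have "six_expressions q (\<lambda>j i. unpack (slice y j) i)"
      unfolding six_expressions_def
    proof (intro conjI allI impI)
      fix j j' i
      show "(\<Sum>i\<in>UNIV. unpack (slice y j) i) = q" by (rule sumq)
      show "\<exists>a b c. unpack (slice y j) i = tensor3 a b c" unfolding unpack_def by (intro exI) (rule refl)
      assume "j \<noteq> j'"
      then show "\<exists>i0. lin_indep (\<lambda>s. case s of None \<Rightarrow> unpack (slice y j') i0 | Some i \<Rightarrow> unpack (slice y j) i)"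
        by (intro exI[of _ "i0 (j, j')"] ind)
    qed
    then show "\<exists>T. six_expressions q T" by blast
  qed
qed

section \<open>Secant varieties of the Segre variety\<close>

lemma proj_point_scale: "c \<noteq> 0 \<Longrightarrow> proj_point (c *s v) = proj_point v"
proof -
  assume c: "c \<noteq> 0"
  have "x \<in> range (\<lambda>k. k *s v) \<longleftrightarrow> x \<in> range (\<lambda>k. k *s (c *s v))" for x
  proof
    assume "x \<in> range (\<lambda>k. k *s v)"
    then obtain k where "x = k *s v" by blast
    then have "x = (k / c) *s (c *s v)" using c by simp
    then show "x \<in> range (\<lambda>k. k *s (c *s v))" by blast
  qed (auto simp: vec.scale_scale)
  then show ?thesis unfolding proj_point_def vec.span_singleton by blast
qed

lemma proj_point_self: "v \<in> proj_point v"
  unfolding proj_point_def by (rule vec.span_base) simp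

lemma proj_point_subset: "vec.subspace W \<Longrightarrow> proj_point v \<subseteq> W \<longleftrightarrow> v \<in> W"
  unfolding proj_point_def using vec.span_minimal[of "{v}" W] vec.span_base[of v "{v}"] by auto

lemma proj_point_in_space: "v \<noteq> 0 \<Longrightarrow> proj_point v \<in> proj_space"
  unfolding proj_space_def by blast

lemma proj_point_in_proj_of:
  "vec.subspace W \<Longrightarrow> v \<noteq> 0 \<Longrightarrow> proj_point v \<in> proj_of W \<longleftrightarrow> v \<in> W"
  unfolding proj_of_def using proj_point_in_space proj_point_subset by blast

lemma span_proj_points: "vec.span (\<Union> (proj_point ` S)) = vec.span S"
proof
  show "vec.span (\<Union> (proj_point ` S)) \<subseteq> vec.span S"
    by (intro vec.span_minimal) (auto simp: proj_point_def intro: subsetD[OF vec.span_mono])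
  show "vec.span S \<subseteq> vec.span (\<Union> (proj_point ` S))"
    by (intro vec.span_mono) (use proj_point_self in blast)
qed

lemma card_idx: "CARD(idx) = 8"
  by simp

lemma idx_list: obtains xs :: "idx list" where "distinct xs" "set xs = UNIV" "length xs = 8"
  using finite_distinct_list[of "UNIV :: idx set"] distinct_card card_idx by (metis finite)

lemma span_secant_rank8:
  assumes "length xs = 8" "set xs \<subseteq> segre3"
  shows "vec.span (\<Union> (set xs)) \<subseteq> rank8"
proof -
  have "\<forall>Q\<in>set xs. \<exists>a b c. Q = proj_point (tensor3 a b c)"
    using assms(2) unfolding segre3_def by blast
  then obtain a b c where abc: "\<And>Q. Q \<in> set xs \<Longrightarrow> Q = proj_point (tensor3 (a Q) (b Q) (c Q))"
    by metis
  define T where "T n = tensor3 (a (xs ! n)) (b (xs ! n)) (c (xs ! n))" for n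
  have T: "xs ! n = proj_point (T n)" if "n < 8" for n
    unfolding T_def using that assms(1) by (intro abc) simp
  \<comment> \<open>The index is the position in the list, since the points may coincide and exactly
    eight summands are wanted.\<close>
  define D where "D = range (\<lambda>k. \<Sum>n<8::nat. k n *s T n)"
  have DI: "(\<Sum>n<8. k n *s T n) \<in> D" for k unfolding D_def by blast
  have subD: "vec.subspace D"
  proof (rule vec.subspaceI)
    show "0 \<in> D" using DI[of "\<lambda>n. 0"] by simp
  next
    fix x y assume "x \<in> D" "y \<in> D"
    then obtain k l where "x = (\<Sum>n<8. k n *s T n)" "y = (\<Sum>n<8. l n *s T n)" unfolding D_def by blast
    then show "x + y \<in> D" using DI[of "\<lambda>n. k n + l n"] by (simp add: vec.scale_left_distrib sum.distrib)
  next
    fix z x assume "x \<in> D"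
    then obtain k where "x = (\<Sum>n<8. k n *s T n)" unfolding D_def by blast
    then show "z *s x \<in> D" using DI[of "\<lambda>n. z * k n"] by (simp add: vec.scale_sum_right)
  qed
  have TD: "T n \<in> D" if "n < 8" for n
    using DI[of "\<lambda>m. if m = n then 1 else 0"] that
    by (simp add: if_distrib[of "\<lambda>c. c *s _"] cong: if_cong)
  have "\<Union> (set xs) \<subseteq> D"
  proof
    fix v assume "v \<in> \<Union> (set xs)"
    then obtain n where n: "n < 8" "v \<in> xs ! n" using assms(1) by (metis Union_iff in_set_conv_nth)
    have "proj_point (T n) \<subseteq> D" using TD[OF n(1)] by (simp only: proj_point_subset[OF subD])
    then show "v \<in> D" using n(2) T[OF n(1)] by blast
  qed
  then have "vec.span (\<Union> (set xs)) \<subseteq> D" using subD by (rule vec.span_minimal)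
  moreover have "D \<subseteq> rank8"
  proof
    fix x assume "x \<in> D"
    then obtain k where x: "x = (\<Sum>n<8. k n *s T n)" unfolding D_def by blast
    obtain g :: "idx \<Rightarrow> nat" where "bij_betw g UNIV {..<8}"
      using finite_same_card_bij[of "UNIV :: idx set" "{..<8::nat}"] card_idx by auto
    then have "x = (\<Sum>i\<in>UNIV. k (g i) *s T (g i))" unfolding x by (rule sum.reindex_bij_betw[symmetric])
    then show "x \<in> rank8" unfolding T_def tensor3_scale using rank8I by simp
  qed
  ultimately show ?thesis by blast
qed

definition secant_points :: "(vspace set) set" where
  "secant_points = \<Union> {proj_span (set xs) | xs. length xs = 8 \<and> set xs \<subseteq> segre3}"

lemma secant_variety_points: "secant_variety 8 segre3 = zariski closure_of secant_points"
  unfolding secant_variety_def secant_points_def ..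

lemma secant_variety_vanish:
  assumes Q: "Q \<in> secant_variety 8 segre3" "q \<in> Q"
    and f: "f \<in> hom_forms" "\<And>v. v \<in> rank8 \<Longrightarrow> f v = 0"
  shows "f q = 0"
proof -
  have "secant_points \<subseteq> proj_zeros {f}"
  proof
    fix P assume "P \<in> secant_points"
    then obtain xs where "length xs = 8" "set xs \<subseteq> segre3" "P \<in> proj_span (set xs)"
      unfolding secant_points_def by blast
    then have "P \<in> proj_space" "P \<subseteq> rank8"
      using span_secant_rank8 unfolding proj_span_def proj_of_def by blast+
    then show "P \<in> proj_zeros {f}" using f(2) by (intro proj_zerosI) auto
  qed
  moreover have "closedin zariski (proj_zeros {f})"
    unfolding closedin_zariski using f(1) by (intro exI[of _ "{f}"]) simp
  ultimately have "secant_variety 8 segre3 \<subseteq> proj_zeros {f}"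
    unfolding secant_variety_points by (rule closure_of_minimal)
  then show ?thesis using Q proj_zerosD[of Q "{f}" f q] by blast
qed

lemma nonzero_tensor: "tensor3 (\<chi> i. 1) (\<chi> i. 1) (\<chi> i. 1) \<noteq> 0"
proof
  assume "tensor3 (\<chi> i :: 'a. 1) (\<chi> i :: 'b. 1) (\<chi> i :: 'c. 1) = 0"
  then have "tensor3 (\<chi> i :: 'a. 1) (\<chi> i :: 'b. 1) (\<chi> i :: 'c. 1) $ (undefined, undefined, undefined) = 0" by simp
  then show False by (simp add: tensor3_def)
qed

lemma proj_point_in_segre: "tensor3 a b c \<noteq> 0 \<Longrightarrow> proj_point (tensor3 a b c) \<in> segre3"
  unfolding segre3_def by blast

lemma rank8_secant_variety:
  assumes "v \<in> rank8" "v \<noteq> 0"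
  shows "proj_point v \<in> secant_variety 8 segre3"
proof -
  obtain y :: "complex ^ (idx \<times> (3 + 6 + 6))" where v: "v = (\<Sum>i\<in>UNIV. unpack y i)"
    using assms(1) unfolding rank8_def by blast
  let ?t = "tensor3 (\<chi> i. 1) (\<chi> i. 1) (\<chi> i. 1) :: vspace"
  \<comment> \<open>A zero summand is no projective point, so it is replaced by a fixed simple
    tensor; the span still contains every summand of \<open>v\<close>.\<close>
  define T where "T i = (if unpack y i = 0 then ?t else unpack y i)" for i
  obtain js :: "idx list" where js: "distinct js" "set js = UNIV" "length js = 8" by (rule idx_list)
  define xs where "xs = map (\<lambda>i. proj_point (T i)) js"
  have "proj_point (T i) \<in> segre3" for i
    unfolding T_def unpack_def using nonzero_tensor by (auto intro: proj_point_in_segre)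
  then have xs: "length xs = 8" "set xs \<subseteq> segre3" using js by (auto simp: xs_def)
  have set: "set xs = proj_point ` range T" using js by (auto simp: xs_def)
  have "unpack y i \<in> vec.span (range T)" for i
    by (cases "unpack y i = 0") (auto simp: T_def vec.span_zero intro!: vec.span_base image_eqI[of _ _ i])
  then have "v \<in> vec.span (range T)" unfolding v by (intro vec.span_sum)
  then have "proj_point v \<in> proj_span (set xs)"
    unfolding proj_span_def set span_proj_points using assms(2)
    by (simp add: proj_point_in_proj_of vec.subspace_span)
  then have "proj_point v \<in> secant_points" unfolding secant_points_def using xs by blast
  moreover have "secant_points \<subseteq> topspace zariski"
    unfolding topspace_zariski secant_points_def proj_span_def proj_of_def by blast
  ultimately show ?thesis unfolding secant_variety_points using closure_of_subset by blast
qed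

text \<open>The origin is no projective point. A form that is nonzero there has degree 0, hence is
  nonzero at every tensor.\<close>

lemma hom_form_nonzero_point:
  assumes f: "f \<in> hom_forms" and v: "v \<in> rank8" "f v \<noteq> 0"
  obtains u where "u \<in> rank8" "u \<noteq> 0" "f u \<noteq> 0"
proof (cases "v = 0")
  case True
  obtain d where d: "hom_form d f" using f unfolding hom_forms_def by blast
  let ?t = "tensor3 (\<chi> i. 1) (\<chi> i. 1) (\<chi> i. 1) :: vspace"
  have eq: "?t = (\<Sum>i\<in>(UNIV :: idx set). tensor3 (if i = Inr True then (\<chi> i. 1) else 0) (\<chi> i. 1) (\<chi> i. 1))"
    by (subst sum.remove[of _ "Inr True"]) (auto simp: tensor3_def vec_eq_iff intro!: sum.neutral)
  have "?t \<in> rank8" by (rule ssubst[OF eq, of "\<lambda>x. x \<in> rank8"], rule rank8I)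
  moreover have "f (0 *s ?t) = 0 ^ d * f ?t" by (rule hom_form_scale[OF d])
  then have "f ?t \<noteq> 0" using v(2) True by auto
  ultimately show ?thesis using that nonzero_tensor by blast
qed (use v that in blast)

lemma openin_nonvanishing:
  assumes "f \<in> hom_forms"
  shows "openin (subtopology zariski S) (S \<inter> (proj_space - proj_zeros {f}))"
proof -
  have "closedin zariski (proj_zeros {f})"
    unfolding closedin_zariski using assms by (intro exI[of _ "{f}"]) simp
  then have "openin zariski (proj_space - proj_zeros {f})"
    by (metis closedin_def topspace_zariski)
  then show ?thesis by (rule openin_subtopology_Int2)
qed

lemma open_contains_nonvanishing:
  assumes "openin (subtopology zariski S) U" "U \<noteq> {}"
  obtains f Q q where "f \<in> hom_forms" "Q \<in> S" "q \<in> Q" "f q \<noteq> 0"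
    "\<And>P p. P \<in> S \<Longrightarrow> P \<in> proj_space \<Longrightarrow> p \<in> P \<Longrightarrow> f p \<noteq> 0 \<Longrightarrow> P \<in> U"
proof -
  obtain O' where O': "openin zariski O'" "U = O' \<inter> S"
    using assms(1) unfolding openin_subtopology by blast
  then obtain F where F: "F \<subseteq> hom_forms" "proj_space - O' = proj_zeros F" and sub: "O' \<subseteq> proj_space"
    unfolding openin_zariski by blast
  obtain Q where Q: "Q \<in> O'" "Q \<in> S" using assms(2) O'(2) by blast
  then have "Q \<notin> proj_zeros F" "Q \<in> proj_space" using F(2) sub by blast+
  then obtain f q where fq: "f \<in> F" "q \<in> Q" "f q \<noteq> 0" unfolding proj_zeros_def by blast
  have "P \<in> U" if "P \<in> S" "P \<in> proj_space" "p \<in> P" "f p \<noteq> 0" for P p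
  proof -
    have "P \<notin> proj_zeros F" using proj_zerosD[OF _ fq(1) that(3)] that(4) by blast
    then show ?thesis using F(2) that(1,2) O'(2) by blast
  qed
  then show ?thesis using that[of f Q q] fq F(1) Q(2) by blast
qed

section \<open>From six expressions to six secant subspaces\<close>

lemma six_expressions_lin_indep:
  assumes "six_expressions q T"
  shows "lin_indep (T j)" "j \<noteq> j' \<Longrightarrow> \<exists>i. T j' i \<notin> vec.span (range (T j))"
proof -
  obtain c w where j: "j = (c, w)" by (cases j)
  \<comment> \<open>Any second index serves here; independence of nine vectors is only used for the
    first eight of them.\<close>
  have "j \<noteq> (c, \<not> w)" using j by simp
  then obtain i0 where ind: "lin_indep (\<lambda>s. case s of None \<Rightarrow> T (c, \<not> w) i0 | Some i \<Rightarrow> T j i)"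
    using assms unfolding six_expressions_def by blast
  show "lin_indep (T j)"
    unfolding lin_indep_def
  proof (intro allI impI)
    fix k i assume "(\<Sum>i\<in>UNIV. k i *s T j i) = 0"
    then have "(\<Sum>s\<in>UNIV. (case s of None \<Rightarrow> 0 | Some i \<Rightarrow> k i) *s (case s of None \<Rightarrow> T (c, \<not> w) i0 | Some i \<Rightarrow> T j i)) = 0"
      by (simp add: UNIV_option_conv sum.reindex)
    then have "(case Some i of None \<Rightarrow> 0 | Some i \<Rightarrow> k i) = 0"
      by (rule ind[unfolded lin_indep_def, rule_format])
    then show "k i = 0" by simp
  qed
  assume "j \<noteq> j'"
  then obtain i where ind: "lin_indep (\<lambda>s. case s of None \<Rightarrow> T j' i | Some i \<Rightarrow> T j i)" (is "lin_indep ?S")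
    using assms unfolding six_expressions_def by blast
  have S: "?S ` (UNIV - {None}) = range (T j)"
    by (auto simp: UNIV_option_conv image_image)
  have "T j' i \<notin> vec.span (range (T j))"
  proof
    assume "T j' i \<in> vec.span (range (T j))"
    moreover have "range ?S - {?S None} = ?S ` (UNIV - {None})"
      using image_set_diff[OF lin_indep_independent(1)[OF ind], of UNIV "{None}"] by simp
    ultimately have "?S None \<in> vec.span (range ?S - {?S None})" unfolding S by simp
    then have "vec.dependent (range ?S)" unfolding vec.dependent_def by blast
    then show False using lin_indep_independent(2)[OF ind] by blast
  qed
  then show "\<exists>i. T j' i \<notin> vec.span (range (T j))" ..
qed

lemma lin_indep_nonzero: "lin_indep T \<Longrightarrow> T i \<noteq> 0"
  using lin_indep_independent(2)[of T] vec.dependent_zero[of "range T"] by (metis rangeI)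

text \<open>Eight independent summands span a projective 7-space through the point, and the ninth
  vector shows that two such spaces differ. Different spaces have different spanning points, so
  uniqueness of the expression fails as well.\<close>

lemma six_expressions_subspaces:
  assumes T: "six_expressions q T" and q: "q \<noteq> 0"
  shows "\<exists>\<L>. card \<L> \<ge> 6 \<and> (\<forall>L\<in>\<L>. proj_linear 7 L \<and> proj_point q \<in> L \<and> k_secant 8 segre3 L)"
    and "\<not> (\<exists>!D. \<exists>as. expresses 8 segre3 (proj_point q) as \<and> D = mset (map proj_point as))"
proof -
  note ind = six_expressions_lin_indep[OF T]
  have sum: "(\<Sum>i\<in>UNIV. T j i) = q" and simple: "\<exists>a b c. T j i = tensor3 a b c" for j i
    using T unfolding six_expressions_def by blast+
  have nz: "T j i \<noteq> 0" for j i by (rule lin_indep_nonzero[OF ind(1)])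
  have segre: "proj_point (T j i) \<in> segre3" for j i
    using simple[of j i] nz[of j i] proj_point_in_segre by metis
  obtain js :: "idx list" where js: "distinct js" "set js = UNIV" "length js = 8" by (rule idx_list)
  define L where "L j = proj_of (vec.span (range (T j)))" for j
  have spanL: "proj_span (proj_point ` range (T j)) = L j" for j
    unfolding proj_span_def span_proj_points L_def ..
  have lin: "proj_linear 7 (L j)" for j
  proof -
    have "vec.dim (vec.span (range (T j))) = 8"
      using lin_indep_independent[OF ind(1)[of j]] card_idx
      by (simp add: vec.dim_eq_card_independent card_image)
    then show ?thesis unfolding proj_linear_def L_def by (intro exI[of _ "vec.span (range (T j))"]) simp
  qed
  have set_js: "set (map (\<lambda>i. proj_point (T j i)) js) = proj_point ` range (T j)" for j using js by auto
  have "q \<in> vec.span (range (T j))" for j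
    unfolding sum[of j, symmetric] by (intro vec.span_sum vec.span_base) simp
  then have mem: "proj_point q \<in> L j" for j
    unfolding L_def using q by (simp add: proj_point_in_proj_of)
  have ksec: "k_secant 8 segre3 (L j)" for j
    unfolding k_secant_def
  proof (intro conjI exI[of _ "map (\<lambda>i. proj_point (T j i)) js"])
    show "proj_linear (8 - 1) (L j)" using lin[of j] by simp
    show "set (map (\<lambda>i. proj_point (T j i)) js) \<subseteq> segre3" unfolding set_js using segre[of j] by blast
    show "L j = proj_span (set (map (\<lambda>i. proj_point (T j i)) js))" unfolding set_js spanL ..
  qed (use js(3) in simp_all)
  have neq: "L j \<noteq> L j'" if jj': "j \<noteq> j'" for j j'
  proof -
    obtain i where "T j' i \<notin> vec.span (range (T j))" using ind(2)[OF jj'] ..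
    then have "proj_point (T j' i) \<notin> L j" unfolding L_def by (simp add: proj_point_in_proj_of nz)
    moreover have "proj_point (T j' i) \<in> L j'"
      unfolding L_def by (simp add: proj_point_in_proj_of nz vec.span_base)
    ultimately show ?thesis by blast
  qed
  then have "inj L" unfolding inj_def by metis
  then have "card (range L) = 6" by (simp add: card_image)
  then show "\<exists>\<L>. card \<L> \<ge> 6 \<and> (\<forall>L\<in>\<L>. proj_linear 7 L \<and> proj_point q \<in> L \<and> k_secant 8 segre3 L)"
    using lin mem ksec by (intro exI[of _ "range L"]) auto
  have expr: "expresses 8 segre3 (proj_point q) (map (T j) js)" for j
  proof -
    have "sum_list (map (T j) js) = q" using sum_list_distinct_conv_sum_set[OF js(1), of "T j"] js(2) sum by simp
    then show ?thesis unfolding expresses_def using js(3) nz[of j] segre[of j] q by auto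
  qed
  show "\<not> (\<exists>!D. \<exists>as. expresses 8 segre3 (proj_point q) as \<and> D = mset (map proj_point as))"
  proof
    assume "\<exists>!D. \<exists>as. expresses 8 segre3 (proj_point q) as \<and> D = mset (map proj_point as)"
    then have "mset (map proj_point (map (T (0, False)) js)) = mset (map proj_point (map (T (0, True)) js))"
      using expr by blast
    then have "set (map proj_point (map (T (0, False)) js)) = set (map proj_point (map (T (0, True)) js))"
      by (rule mset_eq_setD)
    then have "proj_point ` range (T (0, False)) = proj_point ` range (T (0, True))"
      using js(2) by (simp add: image_image)
    then have "L (0, False) = L (0, True)" by (metis spanL)
    then show False using neq by simp
  qed
qed

theorem theorem3p5:
  fixes X :: "(complex ^ (3 \<times> 6 \<times> 6)) set set"
  assumes "X = segre3"
  shows "\<not> identifiable 8 X \<and>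
    generally (secant_variety 8 X)
      (\<lambda>Q. \<exists>\<L>. card \<L> \<ge> 6 \<and> (\<forall>L\<in>\<L>. proj_linear 7 L \<and> Q \<in> L \<and> k_secant 8 X L))"
proof -
  let ?S = "secant_variety 8 (segre3 :: vspace set set)"
  obtain \<Omega> :: "(complex ^ par) set" and x0 x1 and A :: "vspace \<Rightarrow> complex"
    where \<Omega>: "open \<Omega>" "convex \<Omega>" "x0 \<in> \<Omega>" and rank: "\<And>x. x \<in> \<Omega> \<Longrightarrow> bigG x \<in> rank8"
      and A: "polyf A" "x1 \<in> \<Omega>" "A (bigG x1) \<noteq> 0"
      and six: "\<And>q. (\<And>P. polyf P \<Longrightarrow> (\<And>v. v \<in> rank8 \<Longrightarrow> P v = 0) \<Longrightarrow> P q = 0) \<Longrightarrow> A q \<noteq> 0 \<Longrightarrow>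
        \<exists>T. six_expressions q T"
    by (rule general_six_expressions) blast
  \<comment> \<open>\<open>A\<close> need not be homogeneous, but Zariski open sets are given by
    forms; some homogeneous part of \<open>A\<close> is nonzero at \<open>bigG x1\<close> and
    defines the open set.\<close>
  obtain n h where h: "\<And>d. hom_form d (h d)" "\<And>v. A v = (\<Sum>d\<le>n. h d v)"
    using polyf_homogeneous_parts[OF A(1)] by metis
  obtain d where d: "d \<le> n" "h d (bigG x1) \<noteq> 0"
    using A(3) unfolding h(2) by (metis (no_types, lifting) atMost_iff sum.neutral)
  have hd: "h d \<in> hom_forms" using h(1) by (auto simp: hom_forms_def)
  have good: "\<exists>q T. q \<noteq> 0 \<and> proj_point q = Q \<and> six_expressions q T"
    if Q: "Q \<in> ?S" "Q \<in> proj_space" "p \<in> Q" "h d p \<noteq> 0" for Q p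
  proof -
    obtain u where u: "Q = proj_point u" "u \<noteq> 0" using Q(2) unfolding proj_space_def by blast
    have hu: "h d u \<noteq> 0" using hom_form_zero_on_line[OF hd _ Q(3)[unfolded u(1)]] Q(4) by blast
    \<comment> \<open>\<open>A\<close> may vanish at the representative \<open>u\<close>. Along its
      line \<open>A\<close> is a nonzero polynomial in the scalar, as the coefficient of degree
      \<open>d\<close> does not vanish, so a suitable multiple of \<open>u\<close> works.\<close>
    have "finite {z. (\<Sum>d\<le>n. h d u * z ^ d) = 0}" using polyfun_roots_finite[of "\<lambda>d. h d u" d n] hu d(1) by simp
    then have "finite (insert 0 {z. (\<Sum>d\<le>n. h d u * z ^ d) = 0})" by simp
    then obtain z where z: "z \<noteq> 0" "(\<Sum>d\<le>n. h d u * z ^ d) \<noteq> 0"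
      using ex_new_if_finite[OF infinite_UNIV_char_0] by blast
    have Qz: "proj_point (z *s u) = Q" using proj_point_scale[OF z(1)] u(1) by simp
    have "P (z *s u) = 0" if "polyf P" "\<And>v. v \<in> rank8 \<Longrightarrow> P v = 0" for P
    proof (rule polyf_vanish_cone[OF that rank8_scale])
      fix f :: "vspace \<Rightarrow> complex" assume f: "f \<in> hom_forms" "\<And>v. v \<in> rank8 \<Longrightarrow> f v = 0"
      show "f (z *s u) = 0"
        by (rule secant_variety_vanish[OF Q(1) _ f]) (use proj_point_self[of "z *s u"] Qz in auto)
    qed
    moreover have "A (z *s u) \<noteq> 0" using z(2) polyf_scale[OF h] by simp
    ultimately have "\<exists>T. six_expressions (z *s u) T" by (rule six)
    moreover have "z *s u \<noteq> 0" using z(1) u(2) by simp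
    ultimately show ?thesis using Qz by blast
  qed
  have "generally ?S (\<lambda>Q. \<exists>\<L>. card \<L> \<ge> 6 \<and> (\<forall>L\<in>\<L>. proj_linear 7 L \<and> Q \<in> L \<and> k_secant 8 segre3 L))"
    unfolding generally_def
  proof (intro exI[of _ "?S \<inter> (proj_space - proj_zeros {h d})"] conjI ballI)
    show "openin (subtopology zariski ?S) (?S \<inter> (proj_space - proj_zeros {h d}))"
      by (rule openin_nonvanishing[OF hd])
    obtain u where "u \<in> rank8" "u \<noteq> 0" "h d u \<noteq> 0"
      using hom_form_nonzero_point[OF hd rank[OF A(2)] d(2)] .
    then have "proj_point u \<in> ?S \<inter> (proj_space - proj_zeros {h d})"
      using rank8_secant_variety proj_point_in_space proj_point_self[of u]
      by (auto dest: proj_zerosD[of _ "{h d}" "h d" u])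
    then show "?S \<inter> (proj_space - proj_zeros {h d}) \<noteq> {}" by blast
    fix Q assume Q: "Q \<in> ?S \<inter> (proj_space - proj_zeros {h d})"
    then obtain p where "p \<in> Q" "h d p \<noteq> 0" unfolding proj_zeros_def by blast
    then obtain q T where "q \<noteq> 0" "proj_point q = Q" "six_expressions q T" using good Q by blast
    then show "\<exists>\<L>. card \<L> \<ge> 6 \<and> (\<forall>L\<in>\<L>. proj_linear 7 L \<and> Q \<in> L \<and> k_secant 8 segre3 L)"
      using six_expressions_subspaces(1) by blast
  qed
  moreover have "\<not> identifiable 8 (segre3 :: vspace set set)"
  proof
    assume "identifiable 8 (segre3 :: vspace set set)"
    then obtain U where U: "openin (subtopology zariski ?S) U" "U \<noteq> {}"
      "\<forall>Q\<in>U. \<exists>!D. \<exists>as. expresses 8 segre3 Q as \<and> D = mset (map proj_point as)"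
      unfolding identifiable_def generally_def by (elim exE conjE) (rule that)
    obtain f Q0 q0 where f: "f \<in> hom_forms" "Q0 \<in> ?S" "q0 \<in> Q0" "f q0 \<noteq> 0"
      "\<And>P p. P \<in> ?S \<Longrightarrow> P \<in> proj_space \<Longrightarrow> p \<in> P \<Longrightarrow> f p \<noteq> 0 \<Longrightarrow> P \<in> U"
      by (rule open_contains_nonvanishing[OF U(1,2)]) blast
    have pf: "polyf f" "polyf (h d)" using f(1) hd polyf_hom_form by (auto simp: hom_forms_def)
    \<comment> \<open>The secant variety is irreducible: \<open>f\<close> and \<open>h d\<close> are both nonzero somewhere on the image of \<open>bigG\<close>.\<close>
    have "\<exists>x\<in>\<Omega>. f (bigG x) \<noteq> 0"
      using bigG_dense[OF pf(1) \<Omega>(1,3)] secant_variety_vanish[OF f(2,3,1)] f(4) by blast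
    then obtain y where y: "y \<in> \<Omega>" "f (bigG y) \<noteq> 0" by blast
    have hol: "line_hol \<Omega> (\<lambda>x. P (bigG x))" if "polyf P" for P
      using line_hol_polyf[OF polyf_compose[OF that polyf_bigG], of \<Omega> "\<lambda>x. x"] by (simp add: line_hol_coord)
    have "\<exists>x\<in>\<Omega>. f (bigG x) * h d (bigG x) \<noteq> 0"
      using line_hol_no_zero_divisors[OF \<Omega>(1,2) hol[OF pf(1)] hol[OF pf(2)] _ y A(2)] d(2) by blast
    then obtain x where x: "x \<in> \<Omega>" "f (bigG x) * h d (bigG x) \<noteq> 0" by blast
    \<comment> \<open>Using the product as a single form makes one nonzero \<open>u\<close> serve
      both conditions.\<close>
    obtain u where u: "u \<in> rank8" "u \<noteq> 0" "f u * h d u \<noteq> 0"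
      using hom_form_nonzero_point[OF hom_forms_mult[OF f(1) hd] rank[OF x(1)] x(2)] .
    have S: "proj_point u \<in> ?S" "proj_point u \<in> proj_space" "u \<in> proj_point u"
      using u rank8_secant_variety proj_point_in_space proj_point_self by blast+
    obtain q T where q: "q \<noteq> 0" "proj_point q = proj_point u" "six_expressions q T"
      using good[OF S] u(3) by auto
    have "proj_point u \<in> U" using f(5)[OF S] u(3) by auto
    then have "proj_point q \<in> U" by (simp only: q(2))
    from notE[OF six_expressions_subspaces(2)[OF q(3,1)] bspec[OF U(3) this]] show False .
  qed
  ultimately show ?thesis using assms by simp
qed

end
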